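(* A finite set of points $Z$ in $\mathbb{P}^2=\mathbb{P}^2_{\mathbb{C}}$ admits unexpected irreducible quintics only if $d=|Z|\in\{11,12\}$. Moreover, for each value $d\in\{11,12\}$ at least the following possibilities occur, i.e. the following sets $Z$ admit unexpected irreducible quintics. (1) For $d=12$: the set $Z$ dual to the line arrangement $$\mathcal{M}_5: xyz(x^3-y^3)(y^3-z^3)(z^3-x^3)=0,$$ and the set $Z$ dual to the Hessian line arrangement $$\mathcal{H}: xyz\left((x^3+y^3+z^3)^3-27x^3y^3z^3\right)=0.$$ (2) For $d=11$: the set $Z$ dual to the line arrangement $$\mathcal{M}_5^2: xyz(x^3-y^3)(x^3-z^3)(z-w_1y)(z-w_2y)=0,$$ where $w_1\neq w_2$ are cube roots of unity; the set $Z$ dual to the line arrangement $$\mathcal{A}_3^2: xy(x^3-y^3)(y^3-z^3)(z^3-x^3)=0$$ (both $\mathcal{M}_5^2$ and $\mathcal{A}_3^2$ are obtained from $\mathcal{M}_5$ by deleting a line); and the set $Z$ dual to the line arrangement $\mathcal{H}'$ obtained from the Hessian arrangement $\mathcal{H}$ by deleting a line.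
   Context: Work over $\mathbb{C}$. Unexpected curves: a finite set $Z\subset\mathbb{P}^2$ admits unexpected curves of degree $j\geq 2$ if, for a generic point $q\in\mathbb{P}^2$ (i.e. for $q$ in a nonempty Zariski open subset), $$h^0(\mathbb{P}^2,\mathcal{O}_{\mathbb{P}^2}(j)\otimes\mathcal{I}(Z+(j-1)q))>\max\left(0,\ h^0(\mathbb{P}^2,\mathcal{O}_{\mathbb{P}^2}(j)\otimes\mathcal{I}(Z))-\binom{j}{2}\right),$$ where $\mathcal{I}(Z)$ is the ideal sheaf of functions vanishing on $Z$ and $\mathcal{I}(Z+(j-1)q)$ is the ideal sheaf of functions vanishing on $Z$ and vanishing to order $j-1$ at $q$. An unexpected curve of degree $j$ (for generic $q$) is then a curve $C_q$ of degree $j$ passing through all points of $Z$ and having multiplicity at least $j-1$ at $q$. "Unexpected irreducible quintics" means that $Z$ admits unexpected curves of degree $j=5$ and the corresponding curves $C_q$, for generic $q$, are irreducible. Duality: a point $(a:b:c)\in\mathbb{P}^2$ is dual to the line $ax+by+cz=0$; the set dual to a line arrangement is the set of points dual to its lines. *)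

theory Defs
  imports
    "HOL-Analysis.Analysis"
    "HOL-Library.Poly_Mapping"
    "HOL-Computational_Algebra.Factorial_Ring"
begin

section \<open>The polynomial ring $\mathbb{C}[x,y,z]$\<close>

text \<open>A monomial is a finitely supported exponent map on the three indices \<open>1, 2, 3 :: 3\<close>
  (in the type \<open>3\<close>, the index \<open>3\<close> is \<open>0\<close>; this agrees with the numbering of \<open>vector [a, b, c]\<close>).
  Multiplication on the monoid algebra is the convolution product of Poly_Mapping, so the library
  notion \<^const>\<open>irreducible\<close> applies.\<close>

type_synonym mono3 = "3 \<Rightarrow>\<^sub>0 nat"
type_synonym poly3 = "mono3 \<Rightarrow>\<^sub>0 complex"

definition Var :: "3 \<Rightarrow> poly3" where
  "Var i = Poly_Mapping.single (Poly_Mapping.single i 1) 1"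

definition Const :: "complex \<Rightarrow> poly3" where
  "Const c = Poly_Mapping.single 0 c"

definition eval3 :: "complex ^ 3 \<Rightarrow> poly3 \<Rightarrow> complex" where
  "eval3 v F = (\<Sum>m \<in> Poly_Mapping.keys F.
     Poly_Mapping.lookup F m * (\<Prod>i\<in>UNIV. (v $ i) ^ Poly_Mapping.lookup m i))"

definition homogeneous :: "nat \<Rightarrow> poly3 \<Rightarrow> bool" where
  "homogeneous d F \<longleftrightarrow>
     (\<forall>m \<in> Poly_Mapping.keys F. (\<Sum>i\<in>UNIV. Poly_Mapping.lookup m i) = d)"

lemma eval3_scale:
  assumes "homogeneous d F"
  shows "eval3 (c *s v) F = c ^ d * eval3 v F"
proof -
  have "(\<Prod>i\<in>UNIV. ((c *s v) $ i) ^ Poly_Mapping.lookup m i)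
      = c ^ d * (\<Prod>i\<in>UNIV. (v $ i) ^ Poly_Mapping.lookup m i)"
    if "m \<in> Poly_Mapping.keys F" for m
  proof -
    have "(\<Prod>i\<in>UNIV. c ^ Poly_Mapping.lookup m i) = c ^ d"
      using assms that by (simp add: homogeneous_def flip: power_sum)
    then show ?thesis
      by (simp add: power_mult_distrib prod.distrib)
  qed
  then show ?thesis
    by (simp add: eval3_def sum_distrib_left algebra_simps)
qed

text \<open>Formal partial derivative. If the exponent of the variable \<open>i\<close> in \<open>m\<close> is \<open>0\<close>, the
  truncated subtraction is harmless because the coefficient is then \<open>0\<close>.\<close>

definition partial3 :: "3 \<Rightarrow> poly3 \<Rightarrow> poly3" where
  "partial3 i F = (\<Sum>m \<in> Poly_Mapping.keys F.
     Poly_Mapping.single (m - Poly_Mapping.single i 1)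
       (of_nat (Poly_Mapping.lookup m i) * Poly_Mapping.lookup F m))"

definition scale3 :: "complex \<Rightarrow> poly3 \<Rightarrow> poly3" where
  "scale3 c F = Const c * F"

interpretation poly3: vector_space scale3
  by unfold_locales
    (simp_all add: scale3_def Const_def algebra_simps single_add mult_single
      flip: mult.assoc)


section \<open>The complex projective plane\<close>

text \<open>A point is the set of all its homogeneous coordinate vectors.\<close>

typedef proj_plane = "{{c *s v | c. c \<noteq> 0} | v :: complex ^ 3. v \<noteq> 0}"
  morphisms coords Abs_proj_plane
proof -
  have "axis 1 1 \<noteq> (0 :: complex ^ 3)" by (simp add: axis_eq_0_iff)
  then show ?thesis by blast
qed

text \<open>The next two notions are used for homogeneous \<open>F\<close> only, where they do not depend on the
  choice of the homogeneous coordinates. Vanishing to order \<open>m\<close> (i.e. multiplicity at least \<open>m\<close>)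
  means that all partial derivatives of order less than \<open>m\<close> vanish; the list \<open>is\<close> records the
  successive variables of differentiation.\<close>

definition vanishes_at :: "poly3 \<Rightarrow> proj_plane \<Rightarrow> bool" where
  "vanishes_at F p \<longleftrightarrow> (\<forall>v \<in> coords p. eval3 v F = 0)"

definition vanishes_to_order :: "nat \<Rightarrow> poly3 \<Rightarrow> proj_plane \<Rightarrow> bool" where
  "vanishes_to_order m F p \<longleftrightarrow>
     (\<forall>is. length is < m \<longrightarrow> vanishes_at (foldr partial3 is F) p)"

definition zero_locus :: "poly3 \<Rightarrow> proj_plane set" where
  "zero_locus F = {p. vanishes_at F p}"

definition zariski_closed :: "proj_plane set \<Rightarrow> bool" where
  "zariski_closed S \<longleftrightarrow>
     (\<exists>T. (\<forall>F\<in>T. \<exists>d. homogeneous d F) \<and> S = {p. \<forall>F\<in>T. vanishes_at F p})"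

definition zariski_open :: "proj_plane set \<Rightarrow> bool" where
  "zariski_open U \<longleftrightarrow> zariski_closed (- U)"

definition for_generic :: "(proj_plane \<Rightarrow> bool) \<Rightarrow> bool" where
  "for_generic P \<longleftrightarrow> (\<exists>U. zariski_open U \<and> U \<noteq> {} \<and> (\<forall>q\<in>U. P q))"


section \<open>Unexpected curves\<close>

text \<open>\<open>forms_through j Z\<close> is $H^0(\mathbb{P}^2,\mathcal{O}(j)\otimes\mathcal{I}(Z))$, and
  \<open>forms_through_fat j Z m q\<close> is $H^0(\mathbb{P}^2,\mathcal{O}(j)\otimes\mathcal{I}(Z+mq))$:
  global sections of $\mathcal{O}(j)$ are the forms of degree $j$, and those of the twisted ideal
  sheaf are the forms satisfying the vanishing conditions.\<close>

definition forms_through :: "nat \<Rightarrow> proj_plane set \<Rightarrow> poly3 set" where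
  "forms_through j Z = {F. homogeneous j F \<and> (\<forall>p\<in>Z. vanishes_at F p)}"

definition forms_through_fat :: "nat \<Rightarrow> proj_plane set \<Rightarrow> nat \<Rightarrow> proj_plane \<Rightarrow> poly3 set" where
  "forms_through_fat j Z m q = {F \<in> forms_through j Z. vanishes_to_order m F q}"

definition admits_unexpected_curves :: "proj_plane set \<Rightarrow> nat \<Rightarrow> bool" where
  "admits_unexpected_curves Z j \<longleftrightarrow> 2 \<le> j \<and>
     for_generic (\<lambda>q. int (poly3.dim (forms_through_fat j Z (j - 1) q))
       > max 0 (int (poly3.dim (forms_through j Z)) - int (j choose 2)))"

text \<open>The equations of the curves $C_q$ are the nonzero elements of
  \<open>forms_through_fat 5 Z 4 q\<close>; a curve is irreducible iff its equation is.\<close>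

definition admits_unexpected_irreducible_quintics :: "proj_plane set \<Rightarrow> bool" where
  "admits_unexpected_irreducible_quintics Z \<longleftrightarrow>
     admits_unexpected_curves Z 5 \<and>
     for_generic (\<lambda>q. \<forall>F \<in> forms_through_fat 5 Z 4 q. F \<noteq> 0 \<longrightarrow> irreducible F)"


section \<open>Line arrangements and duality\<close>

text \<open>The line $ax+by+cz=0$ dual to the point $(a:b:c)$. As $(a:b:c)$ varies, these are all the
  lines of the plane.\<close>

definition dual_line :: "proj_plane \<Rightarrow> proj_plane set" where
  "dual_line p = {r. \<forall>u \<in> coords p. \<forall>v \<in> coords r. (\<Sum>i\<in>UNIV. u $ i * v $ i) = 0}"

text \<open>The line arrangement $F=0$, for $F$ a product of linear forms, as its set of lines.\<close>

definition arrangement :: "poly3 \<Rightarrow> proj_plane set set" where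
  "arrangement F = {L \<in> range dual_line. L \<subseteq> zero_locus F}"

definition dual_points :: "proj_plane set set \<Rightarrow> proj_plane set" where
  "dual_points A = {p. dual_line p \<in> A}"

definition M5 :: "proj_plane set set" where
  "M5 = (let x = Var 1; y = Var 2; z = Var 3 in
     arrangement (x * y * z * (x^3 - y^3) * (y^3 - z^3) * (z^3 - x^3)))"

definition Hessian :: "proj_plane set set" where
  "Hessian = (let x = Var 1; y = Var 2; z = Var 3 in
     arrangement (x * y * z * ((x^3 + y^3 + z^3)^3 - 27 * x^3 * y^3 * z^3)))"

definition M5_2 :: "complex \<Rightarrow> complex \<Rightarrow> proj_plane set set" where
  "M5_2 w1 w2 = (let x = Var 1; y = Var 2; z = Var 3 in
     arrangement (x * y * z * (x^3 - y^3) * (x^3 - z^3) * (z - Const w1 * y) * (z - Const w2 * y)))"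

definition A3_2 :: "proj_plane set set" where
  "A3_2 = (let x = Var 1; y = Var 2; z = Var 3 in
     arrangement (x * y * (x^3 - y^3) * (y^3 - z^3) * (z^3 - x^3)))"

end

theory Submission
  imports Defs
    "HOL-Computational_Algebra.Fundamental_Theorem_Algebra"
    "HOL-Computational_Algebra.Polynomial_Factorial"
    "HOL-Computational_Algebra.Field_as_Ring"
begin

text \<open>Let \<open>q = (s : t : 1)\<close>, \<open>x = p\<^sub>1 - s p\<^sub>3\<close>, \<open>y = p\<^sub>2 - t p\<^sub>3\<close>. A quintic with a point of
  multiplicity four at \<open>q\<close> is \<open>z a(x,y) + b(x,y)\<close> with binary forms \<open>a\<close>, \<open>b\<close> of degrees \<open>4\<close>, \<open>5\<close>,
  and it is irreducible iff \<open>a\<close> and \<open>b\<close> have no common zero. For two such quintics through \<open>Z\<close> the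
  form \<open>a b' - a' b\<close> of degree \<open>9\<close> vanishes in the directions of the points of \<open>Z\<close>, so an
  irreducible one is unique as soon as \<open>Z\<close> has ten points. Counting dimensions gives \<open>|Z| \<ge> 11\<close>.

  If \<open>|Z| \<ge> 13\<close>, move \<open>q\<close> to first order in the directions of \<open>s\<close> and \<open>t\<close>. Substituting \<open>z = -b/a\<close>
  in the derivatives of the quintic yields forms \<open>P\<^sub>1\<close>, \<open>P\<^sub>2\<close> of degree \<open>13\<close> vanishing in the
  directions of \<open>Z\<close>, and \<open>x P\<^sub>1 + y P\<^sub>2\<close> is \<open>a\<close> times a form of degree \<open>10\<close> vanishing there as well.
  Hence \<open>P\<^sub>1 = y E\<close> and \<open>P\<^sub>2 = - x E\<close> with \<open>E\<close> of degree \<open>12\<close> (this is the extactic curve, which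
  bounds the number of invariant lines of a foliation of degree \<open>4\<close> by \<open>12\<close>), so \<open>E = 0\<close>, and
  then \<open>a\<close> divides its partial derivatives, which is absurd.

  For the examples it suffices to exhibit one irreducible quintic for the two sets of twelve
  points: by uniqueness and since removing a point raises the dimension of the quintics through
  \<open>Z\<close> by at most one, their subsets with eleven points inherit the property.\<close>

section \<open>Substitution homomorphisms\<close>

text \<open>The count behind 11: quintics have dimension 21 and the fat point is expected to cost
  10, so for |Z| <= 10 unexpectedness gives dimension at least 12 - |Z|. Filling \<open>Z\<close> up
  to ten points would leave two independent quintics, against uniqueness.

  The obstacle in the upper bound is that the hypothesis gives a quintic for each \<open>q\<close>
  separately, with no choice that is differentiable in \<open>q\<close>. Only a first-order term is
  needed, and it comes from kernel vectors of norm one along a sequence tending to \<open>q\<close>.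
  Uniqueness at \<open>q\<close> makes the limit a multiple of the fixed pair (a, b), so the
  deformations along \<open>s\<close> and \<open>t\<close> start from the same quintic. In x P1 + y
  P2 Euler's relation turns the terms with derivatives of \<open>a\<close> and \<open>b\<close> into
  (5 - 4) a b^2; this is why \<open>a\<close> splits off and the degree falls from 14 to 10.
  Thirteen directions then beat the degrees 10 and 12 in turn.

  Binary forms are stored at y = 1, so their degrees are formal and the direction (1 : 0) is visible
  only in top coefficients; several case distinctions come from this.\<close>

lemma prod_UNIV_3: "prod f (UNIV :: 3 set) = f 1 * f 2 * f 3" for f :: "3 \<Rightarrow> 'a::comm_monoid_mult"
  unfolding UNIV_3 by (subst prod.insert) (auto simp: mult.assoc)

lemma poly_mapping_sum_single: "F = (\<Sum>m\<in>Poly_Mapping.keys F. Poly_Mapping.single m (Poly_Mapping.lookup F m))"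
proof (rule poly_mapping_eqI)
  fix k
  show "Poly_Mapping.lookup F k = Poly_Mapping.lookup (\<Sum>m\<in>Poly_Mapping.keys F. Poly_Mapping.single m (Poly_Mapping.lookup F m)) k"
    by (cases "k \<in> Poly_Mapping.keys F")
      (auto simp: lookup_sum lookup_single when_def in_keys_iff sum.delta)
qed

text \<open>Multiplicativity of substitutions and the Leibniz rule are biadditive identities, so
  this induction, applied twice, leaves a computation with two monomials.\<close>

lemma poly_mapping_single_add_induct [case_names zero single add]:
  fixes F :: "'a \<Rightarrow>\<^sub>0 'b::comm_monoid_add"
  assumes "P 0" "\<And>m c. P (Poly_Mapping.single m c)" "\<And>F G. P F \<Longrightarrow> P G \<Longrightarrow> P (F + G)"
  shows "P F"
proof -
  have "P (\<Sum>m\<in>A. Poly_Mapping.single m (Poly_Mapping.lookup F m))" if "finite A" for A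
    using that by (induction A rule: finite_induct) (auto intro: assms)
  then show ?thesis
    using poly_mapping_sum_single[of F] by (metis finite_keys)
qed

text \<open>Depending on \<open>h\<close> this is evaluation at a vector, restriction to a line,
  translation of the fat point, or rewriting as a nested polynomial in z over y over x.\<close>

definition subst3 :: "(complex \<Rightarrow> 'a::comm_ring_1) \<Rightarrow> (3 \<Rightarrow> 'a) \<Rightarrow> poly3 \<Rightarrow> 'a" where
  "subst3 h r F = (\<Sum>m\<in>Poly_Mapping.keys F.
     h (Poly_Mapping.lookup F m) * (\<Prod>i\<in>UNIV. r i ^ Poly_Mapping.lookup m i))"

locale coeff_hom =
  fixes h :: "complex \<Rightarrow> 'a::comm_ring_1"
  assumes h_add: "h (a + b) = h a + h b" and h_mult: "h (a * b) = h a * h b" and h_one: "h 1 = 1"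
begin

lemma h_zero: "h 0 = 0"
  using h_add[of 0 0] by simp

lemma subst3_superset:
  assumes "finite A" "Poly_Mapping.keys F \<subseteq> A"
  shows "subst3 h r F = (\<Sum>m\<in>A. h (Poly_Mapping.lookup F m) * (\<Prod>i\<in>UNIV. r i ^ Poly_Mapping.lookup m i))"
  unfolding subst3_def using assms
  by (intro sum.mono_neutral_left) (auto simp: in_keys_iff h_zero)

lemma subst3_add: "subst3 h r (F + G) = subst3 h r F + subst3 h r G"
proof -
  let ?A = "Poly_Mapping.keys F \<union> Poly_Mapping.keys G"
  have "Poly_Mapping.keys (F + G) \<subseteq> ?A" by (rule keys_add)
  then show ?thesis
    by (simp add: subst3_superset[of ?A] lookup_add h_add distrib_right sum.distrib)
qed

lemma subst3_zero: "subst3 h r 0 = 0"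
  by (simp add: subst3_def)

lemma subst3_single: "subst3 h r (Poly_Mapping.single m c) = h c * (\<Prod>i\<in>UNIV. r i ^ Poly_Mapping.lookup m i)"
  by (subst subst3_superset[of "{m}"]) auto

lemma subst3_mult: "subst3 h r (F * G) = subst3 h r F * subst3 h r G"
proof (induction F rule: poly_mapping_single_add_induct)
  case (single m c)
  show ?case
  proof (induction G rule: poly_mapping_single_add_induct)
    case (single n d)
    show ?case
      by (simp add: mult_single subst3_single lookup_add power_add prod.distrib h_mult mult_ac)
  qed (simp_all add: subst3_zero subst3_add distrib_left)
qed (simp_all add: subst3_zero subst3_add distrib_right)

lemma subst3_Const: "subst3 h r (Const c) = h c"
  by (simp add: Const_def subst3_single)

lemma subst3_Var: "subst3 h r (Var i) = r i"
proof -
  have "(\<Prod>j\<in>UNIV. r j ^ Poly_Mapping.lookup (Poly_Mapping.single i 1) j) = (\<Prod>j\<in>UNIV. if j = i then r j else 1)"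
    by (intro prod.cong) (auto simp: lookup_single when_def)
  then show ?thesis
    by (simp add: Var_def subst3_single h_one)
qed

lemma subst3_one: "subst3 h r 1 = 1"
  using subst3_Const[of r 1] by (simp add: Const_def h_one)

lemma subst3_uminus: "subst3 h r (- F) = - subst3 h r F"
  using subst3_add[of r "- F" F] by (simp add: subst3_zero eq_neg_iff_add_eq_0)

lemma subst3_diff: "subst3 h r (F - G) = subst3 h r F - subst3 h r G"
  using subst3_add[of r F "- G"] by (simp add: subst3_uminus)

lemma subst3_power: "subst3 h r (F ^ n) = subst3 h r F ^ n"
  by (induction n) (simp_all add: subst3_one subst3_mult)

lemma subst3_sum: "subst3 h r (sum f A) = (\<Sum>a\<in>A. subst3 h r (f a))"
  by (induction A rule: infinite_finite_induct) (simp_all add: subst3_zero subst3_add)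

lemmas subst3_simps = subst3_add subst3_zero subst3_mult subst3_Const subst3_Var subst3_one
  subst3_uminus subst3_diff subst3_power subst3_sum

end

interpretation id_hom: coeff_hom "\<lambda>c. c"
  by unfold_locales auto

interpretation pCons_hom: coeff_hom "\<lambda>c. [:c:]"
  by unfold_locales (auto simp: one_pCons)

interpretation pCons3_hom: coeff_hom "\<lambda>c. [:[:[:c:]:]:]"
  by unfold_locales (auto simp: one_pCons)

interpretation Const_hom: coeff_hom Const
  by unfold_locales (auto simp: Const_def single_add mult_single)

lemma eval3_conv_subst3: "eval3 v = subst3 (\<lambda>c. c) (($) v)"
  by (rule ext) (simp add: eval3_def subst3_def)

lemma eval3_numeral [simp]: "eval3 v (numeral n) = numeral n"
proof -
  have "eval3 v (Const (numeral n)) = numeral n"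
    by (simp add: eval3_conv_subst3 id_hom.subst3_Const)
  then show ?thesis by (simp add: Const_def)
qed

lemmas eval3_simps [simp] = id_hom.subst3_simps[where r = "($) v" for v, folded eval3_conv_subst3]

lemma eval3_expand:
  "eval3 v F = (\<Sum>m\<in>Poly_Mapping.keys F. Poly_Mapping.lookup F m *
     (v $ 1 ^ Poly_Mapping.lookup m 1 * v $ 2 ^ Poly_Mapping.lookup m 2 * v $ 3 ^ Poly_Mapping.lookup m 3))"
  by (simp add: eval3_def prod_UNIV_3)

lemma mono3_eqI:
  assumes "Poly_Mapping.lookup m 1 = Poly_Mapping.lookup n 1"
    "Poly_Mapping.lookup m 2 = Poly_Mapping.lookup n 2" "Poly_Mapping.lookup m 3 = Poly_Mapping.lookup n (3::3)"
  shows "m = n"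
proof (rule poly_mapping_eqI)
  fix k :: 3
  show "Poly_Mapping.lookup m k = Poly_Mapping.lookup n k"
    using exhaust_3[of k] assms by auto
qed

text \<open>Kronecker substitution: on \<open>(t, t\<^sup>N, t\<^sup>N\<^sup>2)\<close> with large \<open>N\<close> distinct monomials become
  distinct powers of \<open>t\<close>.\<close>

lemma eval3_zero_imp_zero:
  assumes "\<And>v. eval3 v F = 0"
  shows "F = 0"
proof (rule ccontr)
  assume "F \<noteq> 0"
  then obtain m0 where m0: "m0 \<in> Poly_Mapping.keys F" by fastforce
  let ?l = Poly_Mapping.lookup
  define S where "S = (\<lambda>(m,i). ?l m i) ` (Poly_Mapping.keys F \<times> (UNIV :: 3 set))"
  have "finite S" by (simp add: S_def)
  define N where "N = Suc (Max S)"
  have lt: "?l m i < N" if "m \<in> Poly_Mapping.keys F" for m i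
  proof -
    have "?l m i \<in> S" using that by (force simp: S_def)
    then show ?thesis using \<open>finite S\<close> by (simp add: N_def less_Suc_eq_le)
  qed
  define e where "e m = ?l m 1 + N * (?l m 2 + N * ?l m (3::3))" for m
  have inj: "m = n" if "m \<in> Poly_Mapping.keys F" "n \<in> Poly_Mapping.keys F" "e m = e n" for m n
  proof (rule mono3_eqI)
    have *: "a = a' \<and> b = b'" if "a + N * b = a' + N * b'" "a < N" "a' < N" for a b a' b' :: nat
    proof -
      have "(a + N * b) mod N = (a' + N * b') mod N" using that(1) by presburger
      then have "a = a'" using that(2,3) by simp
      then show ?thesis using that by simp
    qed
    note 1 = *[OF that(3)[unfolded e_def] lt[OF that(1)] lt[OF that(2)]]
    note 2 = *[OF conjunct2[OF 1] lt[OF that(1)] lt[OF that(2)]]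
    show "?l m 1 = ?l n 1" "?l m 2 = ?l n 2" "?l m 3 = ?l n 3" using 1 2 by auto
  qed
  define p where "p = (\<Sum>m\<in>Poly_Mapping.keys F. monom (?l F m) (e m))"
  have "poly p t = 0" for t
  proof -
    have "poly p t = eval3 (vector [t, t ^ N, t ^ (N * N)]) F"
      by (simp add: p_def eval3_expand poly_sum poly_monom e_def power_add power_mult distrib_left mult_ac)
    then show ?thesis using assms by simp
  qed
  then have "p = 0" using poly_all_0_iff_0 by blast
  moreover have "coeff p (e m0) = ?l F m0"
  proof -
    have "coeff p (e m0) = (\<Sum>m\<in>Poly_Mapping.keys F. if m = m0 then ?l F m else 0)"
      unfolding p_def coeff_sum by (intro sum.cong) (auto dest: inj[OF _ m0])
    then show ?thesis using m0 by simp
  qed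
  ultimately show False using m0 by (simp add: in_keys_iff)
qed

lemma eval3_eqI:
  assumes "\<And>v. eval3 v F = eval3 v G"
  shows "F = G"
  using eval3_zero_imp_zero[of "F - G"] assms by simp

lemma eval3_const_imp_unit:
  assumes "\<And>v. eval3 v F = c" "c \<noteq> 0"
  shows "F dvd 1"
proof
  have "F = Const c" by (rule eval3_eqI) (simp add: assms)
  then show "1 = F * Const (1 / c)"
    using assms(2) by (simp add: Const_def mult_single)
qed

lemma not_unit_if_eval3_zero:
  assumes "eval3 v F = 0"
  shows "\<not> F dvd 1"
proof
  assume "F dvd 1"
  then obtain G where "1 = F * G" by (auto simp: dvd_def)
  then have "eval3 v 1 = eval3 v (F * G)" by simp
  then show False using assms by simp
qed

section \<open>Restriction to a line and partial derivatives\<close>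

text \<open>The low coefficients measure the order of vanishing of a form at \<open>u\<close>; the
  finiteness of the roots supplies points off a zero locus.\<close>

definition on_line :: "complex ^ 3 \<Rightarrow> complex ^ 3 \<Rightarrow> poly3 \<Rightarrow> complex poly" where
  "on_line u w = subst3 (\<lambda>c. [:c:]) (\<lambda>i. [:u $ i, w $ i:])"

lemmas on_line_simps [simp] = pCons_hom.subst3_simps[where r = "\<lambda>i. [:u $ i, w $ i:]" for u w, folded on_line_def]

lemma poly_on_line: "poly (on_line u w F) t = eval3 (u + t *s w) F"
  by (simp add: on_line_def subst3_def eval3_def poly_sum poly_prod poly_mult mult_ac)

lemma partial3_superset:
  assumes "finite A" "Poly_Mapping.keys F \<subseteq> A"
  shows "partial3 i F = (\<Sum>m\<in>A. Poly_Mapping.single (m - Poly_Mapping.single i 1)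
       (of_nat (Poly_Mapping.lookup m i) * Poly_Mapping.lookup F m))"
  unfolding partial3_def using assms
  by (intro sum.mono_neutral_left) (auto simp: in_keys_iff)

lemma partial3_add [simp]: "partial3 i (F + G) = partial3 i F + partial3 i G"
proof -
  let ?A = "Poly_Mapping.keys F \<union> Poly_Mapping.keys G"
  have "Poly_Mapping.keys (F + G) \<subseteq> ?A" by (rule keys_add)
  then show ?thesis
    by (simp add: partial3_superset[of ?A] lookup_add single_add distrib_left sum.distrib)
qed

lemma partial3_single: "partial3 i (Poly_Mapping.single m c) =
    Poly_Mapping.single (m - Poly_Mapping.single i 1) (of_nat (Poly_Mapping.lookup m i) * c)"
  by (subst partial3_superset[of "{m}"]) auto

lemma partial3_zero [simp]: "partial3 i 0 = 0"
  by (simp add: partial3_def)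

lemma partial3_mult: "partial3 i (F * G) = partial3 i F * G + F * partial3 i G"
proof (induction F rule: poly_mapping_single_add_induct)
  case (single m c)
  show ?case
  proof (induction G rule: poly_mapping_single_add_induct)
    case (single n d)
    let ?e = "Poly_Mapping.single i (1::nat)"
    \<comment> \<open>Subtraction of exponents is truncated, so the two monomials may differ when
      \<open>i\<close> does not occur in \<open>m\<close>; the coefficient is then 0.\<close>
    have *: "Poly_Mapping.single (m + n - ?e) (of_nat (Poly_Mapping.lookup m i) * c) =
        Poly_Mapping.single ((m - ?e) + n) (of_nat (Poly_Mapping.lookup m i) * c)" for m n :: mono3 and c :: complex
    proof (cases "Poly_Mapping.lookup m i = 0")
      case False
      then have "m + n - ?e = (m - ?e) + n"
        by (intro poly_mapping_eqI) (auto simp: lookup_add lookup_minus lookup_single when_def)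
      then show ?thesis by simp
    qed simp
    show ?case
      using *[of m n "c * d"] *[of n m "c * d"]
      by (simp add: mult_single partial3_single lookup_add distrib_right distrib_left single_add add.commute mult_ac)
  qed (simp_all add: algebra_simps)
qed (simp_all add: algebra_simps)

lemma partial3_Const [simp]: "partial3 i (Const c) = 0"
  by (simp add: Const_def partial3_single)

lemma partial3_Var [simp]: "partial3 i (Var j) = (if i = j then 1 else 0)"
  by (simp add: Var_def partial3_single lookup_single when_def)

text \<open>The chain rule along a line, checked on monomials. Iterated, it expresses Taylor
  coefficients at \<open>u\<close> through partial derivatives there.\<close>

lemma pderiv_on_line:
  "pderiv (on_line u w F) = (\<Sum>i\<in>UNIV. smult (w $ i) (on_line u w (partial3 i F)))"
proof (induction F rule: poly_mapping_single_add_induct)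
  case (single m c)
  have ne: "(1::3) \<noteq> 2" "(2::3) \<noteq> 1" "(1::3) \<noteq> 3" "(3::3) \<noteq> 1" "(2::3) \<noteq> 3" "(3::3) \<noteq> 2" by auto
  have pd: "pderiv ([:a, b:] ^ k) = smult (of_nat k * b) ([:a, b:] ^ (k - 1))" for a b :: complex and k
    by (cases k) (auto simp: pderiv_power_Suc pderiv_pCons mult.commute simp del: power_Suc)
  show ?case
    by (simp add: on_line_def partial3_single pCons_hom.subst3_single prod_UNIV_3 sum_3 lookup_minus
      lookup_single when_def ne pderiv_mult pderiv_smult pd smult_add_right algebra_simps del: power_Suc)
qed (auto simp: pderiv_add sum.distrib smult_add_right)

section \<open>Homogeneous polynomials\<close>

lemma homogeneous_zero [simp]: "homogeneous d 0"
  by (simp add: homogeneous_def)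

lemma homogeneous_add: "homogeneous d F \<Longrightarrow> homogeneous d G \<Longrightarrow> homogeneous d (F + G)"
  using keys_add[of F G] by (auto simp: homogeneous_def)

lemma homogeneous_mult:
  assumes "homogeneous d F" "homogeneous e G"
  shows "homogeneous (d + e) (F * G)"
  unfolding homogeneous_def
proof
  fix m assume "m \<in> Poly_Mapping.keys (F * G)"
  then obtain a b where "a \<in> Poly_Mapping.keys F" "b \<in> Poly_Mapping.keys G" "m = a + b"
    using keys_mult[of F G] by auto
  then show "(\<Sum>i\<in>UNIV. Poly_Mapping.lookup m i) = d + e"
    using assms by (simp add: homogeneous_def lookup_add sum.distrib)
qed

lemma homogeneous_Const [simp]: "homogeneous 0 (Const c)"
  by (simp add: homogeneous_def Const_def)

lemma homogeneous_Const_mult: "homogeneous d F \<Longrightarrow> homogeneous d (Const c * F)"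
  using homogeneous_mult[OF homogeneous_Const] by fastforce

lemma homogeneous_Var [simp]: "homogeneous 1 (Var i)" "homogeneous (Suc 0) (Var i)"
  by (auto simp: homogeneous_def Var_def lookup_single when_def)

lemma homogeneous_one [simp]: "homogeneous 0 1"
  by (simp add: homogeneous_def)

lemma homogeneous_power: "homogeneous d F \<Longrightarrow> homogeneous (d * n) (F ^ n)"
proof (induction n)
  case (Suc n)
  then show ?case using homogeneous_mult[of d F "d * n" "F ^ n"] by simp
qed simp

lemma homogeneous_power_linear: "homogeneous 1 F \<Longrightarrow> homogeneous n (F ^ n)"
  using homogeneous_power[of 1 F n] by simp

lemma homogeneous_uminus: "homogeneous d F \<Longrightarrow> homogeneous d (- F)"
  by (simp add: homogeneous_def)

lemma homogeneous_diff: "homogeneous d F \<Longrightarrow> homogeneous d G \<Longrightarrow> homogeneous d (F - G)"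
  using homogeneous_add[OF _ homogeneous_uminus, of d F G] by simp

lemma homogeneous_sum: "(\<And>a. a \<in> A \<Longrightarrow> homogeneous d (f a)) \<Longrightarrow> homogeneous d (sum f A)"
  by (induction A rule: infinite_finite_induct) (auto intro: homogeneous_add)

lemma homogeneous_prod_ex:
  "(\<And>a. a \<in> A \<Longrightarrow> \<exists>d. homogeneous d (f a)) \<Longrightarrow> \<exists>d. homogeneous d (prod f A)"
proof (induction A rule: infinite_finite_induct)
  case (insert a A)
  then show ?case by (metis homogeneous_mult insertCI prod.insert)
qed (auto intro!: exI[of _ 0])

section \<open>Coefficients of forms by exponent triples\<close>

definition mono3 :: "nat \<Rightarrow> nat \<Rightarrow> nat \<Rightarrow> mono3" where
  "mono3 i j k = Poly_Mapping.single 1 i + Poly_Mapping.single 2 j + Poly_Mapping.single 3 k"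

lemma lookup_mono3 [simp]:
  "Poly_Mapping.lookup (mono3 i j k) 1 = i"
  "Poly_Mapping.lookup (mono3 i j k) 2 = j"
  "Poly_Mapping.lookup (mono3 i j k) 3 = k"
proof -
  have "(1::3) \<noteq> 2" "(2::3) \<noteq> 1" "(1::3) \<noteq> 3" "(3::3) \<noteq> 1" "(2::3) \<noteq> 3" "(3::3) \<noteq> 2" by auto
  then show "Poly_Mapping.lookup (mono3 i j k) 1 = i"
    "Poly_Mapping.lookup (mono3 i j k) 2 = j"
    "Poly_Mapping.lookup (mono3 i j k) 3 = k"
    by (simp_all add: mono3_def lookup_add lookup_single when_def del: one_neq_zero)
qed

definition cf :: "poly3 \<Rightarrow> nat \<Rightarrow> nat \<Rightarrow> nat \<Rightarrow> complex" where
  "cf F i j k = Poly_Mapping.lookup F (mono3 i j k)"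

lemma homogeneous_keys_mono3:
  assumes "homogeneous n F" "m \<in> Poly_Mapping.keys F"
  shows "\<exists>k\<le>n. \<exists>i\<le>n - k. m = mono3 i (n - k - i) k"
proof -
  have "Poly_Mapping.lookup m 1 + Poly_Mapping.lookup m 2 + Poly_Mapping.lookup m 3 = n"
    using assms by (simp add: homogeneous_def sum_3)
  then show ?thesis
    by (intro exI[of _ "Poly_Mapping.lookup m 3"] conjI exI[of _ "Poly_Mapping.lookup m 1"] mono3_eqI)
      (auto)
qed

text \<open>Sorting monomials by their power of z writes F as a sum of z^k times binary forms of
  degree n - k, the shape in which a fat point at (0 : 0 : 1) can be read off.\<close>

lemma eval3_homogeneous:
  assumes "homogeneous n F"
  shows "eval3 v F = (\<Sum>k\<le>n. \<Sum>i\<le>n-k. cf F i (n - k - i) k * (v $ 1 ^ i * v $ 2 ^ (n - k - i) * v $ 3 ^ k))"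
proof -
  let ?S = "SIGMA k:{..n}. {..n-k}"
  let ?m = "\<lambda>(k,i). mono3 i (n - k - i) k"
  have inj: "inj_on ?m ?S"
  proof (rule inj_onI)
    fix a b assume "?m a = ?m b"
    then have "mono3 (snd a) (n - fst a - snd a) (fst a) = mono3 (snd b) (n - fst b - snd b) (fst b)"
      by (simp add: case_prod_beta)
    then show "a = b"
      by (metis lookup_mono3(1,3) prod.expand)
  qed
  have "Poly_Mapping.keys F \<subseteq> ?m ` ?S"
    using homogeneous_keys_mono3[OF assms] by (force simp: image_iff)
  then have "eval3 v F = (\<Sum>m\<in>?m ` ?S. Poly_Mapping.lookup F m *
     (v $ 1 ^ Poly_Mapping.lookup m 1 * v $ 2 ^ Poly_Mapping.lookup m 2 * v $ 3 ^ Poly_Mapping.lookup m 3))"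
    by (subst id_hom.subst3_superset[of "?m ` ?S" F "($) v", folded eval3_conv_subst3]) (auto simp: prod_UNIV_3)
  also have "\<dots> = (\<Sum>(k,i)\<in>?S. cf F i (n - k - i) k * (v $ 1 ^ i * v $ 2 ^ (n - k - i) * v $ 3 ^ k))"
    unfolding sum.reindex[OF inj] by (intro sum.cong) (auto simp: cf_def)
  also have "\<dots> = (\<Sum>k\<le>n. \<Sum>i\<le>n-k. cf F i (n - k - i) k * (v $ 1 ^ i * v $ 2 ^ (n - k - i) * v $ 3 ^ k))"
    by (subst sum.Sigma) auto
  finally show ?thesis .
qed

lemma homogeneous_eq_zero:
  assumes "homogeneous n F" "\<And>k i. k \<le> n \<Longrightarrow> i \<le> n - k \<Longrightarrow> cf F i (n - k - i) k = 0"
  shows "F = 0"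
  by (rule eval3_zero_imp_zero) (simp add: eval3_homogeneous[OF assms(1)] assms(2) del: diff_diff_left)

section \<open>Points of the projective plane\<close>

text \<open>For \<open>v = 0\<close> the set is {0}, outside the carrier of the type, so
  \<open>pt 0\<close> is an unspecified point.\<close>

definition pt :: "complex ^ 3 \<Rightarrow> proj_plane" where
  "pt v = Abs_proj_plane {c *s v | c. c \<noteq> 0}"

lemma coords_pt: "v \<noteq> 0 \<Longrightarrow> coords (pt v) = {c *s v | c. c \<noteq> 0}"
  unfolding pt_def by (rule Abs_proj_plane_inverse) blast

lemma pt_exhaust:
  obtains v where "v \<noteq> 0" "p = pt v"
proof -
  obtain v where v: "v \<noteq> 0" "coords p = {c *s v | c. c \<noteq> 0}" using coords[of p] by auto
  then have "coords p = coords (pt v)" by (simp add: coords_pt)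
  then show ?thesis using that v(1) by (simp add: coords_inject)
qed

lemma pt_scale: "c \<noteq> 0 \<Longrightarrow> pt (c *s v) = pt v"
proof -
  assume "c \<noteq> 0"
  have "(\<exists>d. x = d *s (c *s v) \<and> d \<noteq> 0) \<longleftrightarrow> (\<exists>d. x = d *s v \<and> d \<noteq> 0)" for x
  proof
    assume "\<exists>d. x = d *s v \<and> d \<noteq> 0"
    then obtain d where "x = d *s v" "d \<noteq> 0" by blast
    with \<open>c \<noteq> 0\<close> show "\<exists>d. x = d *s (c *s v) \<and> d \<noteq> 0"
      by (intro exI[of _ "d / c"]) (simp add: vector_smult_assoc)
  next
    assume "\<exists>d. x = d *s (c *s v) \<and> d \<noteq> 0"
    then obtain d where "x = d *s (c *s v)" "d \<noteq> 0" by blast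
    with \<open>c \<noteq> 0\<close> show "\<exists>d. x = d *s v \<and> d \<noteq> 0"
      by (intro exI[of _ "d * c"]) (simp add: vector_smult_assoc)
  qed
  then show ?thesis by (simp add: pt_def)
qed

lemma pt_eqD:
  assumes "pt v = pt w" "v \<noteq> 0" "w \<noteq> 0"
  obtains c where "c \<noteq> 0" "w = c *s v"
proof -
  have "w \<in> coords (pt w)" unfolding coords_pt[OF assms(3)]
    by (auto intro!: exI[of _ 1])
  then have "w \<in> coords (pt v)" using assms by simp
  then show ?thesis using that coords_pt[OF assms(2)] by auto
qed

lemma vanishes_at_pt:
  assumes "homogeneous d F" "v \<noteq> 0"
  shows "vanishes_at F (pt v) \<longleftrightarrow> eval3 v F = 0"
proof -
  have "vanishes_at F (pt v) \<longleftrightarrow> (\<forall>c. c \<noteq> 0 \<longrightarrow> eval3 (c *s v) F = 0)"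
    unfolding vanishes_at_def coords_pt[OF assms(2)] by auto
  also have "\<dots> \<longleftrightarrow> eval3 v F = 0"
    using eval3_scale[OF assms(1)] by (metis mult_zero_right vector_smult_lid one_neq_zero)
  finally show ?thesis .
qed

definition dot3 :: "complex ^ 3 \<Rightarrow> complex ^ 3 \<Rightarrow> complex" where
  "dot3 u v = u $ 1 * v $ 1 + u $ 2 * v $ 2 + u $ 3 * v $ 3"

definition cross :: "complex ^ 3 \<Rightarrow> complex ^ 3 \<Rightarrow> complex ^ 3" where
  "cross u v = vector [u $ 2 * v $ 3 - u $ 3 * v $ 2, u $ 3 * v $ 1 - u $ 1 * v $ 3, u $ 1 * v $ 2 - u $ 2 * v $ 1]"

lemma vec3_eq_iff: "u = v \<longleftrightarrow> u $ 1 = v $ 1 \<and> u $ 2 = v $ 2 \<and> u $ 3 = (v $ 3 :: complex)"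
  for u v :: "complex ^ 3"
  by (simp add: vec_eq_iff forall_3)

text \<open>The coordinates of the cross product are the 2 by 2 minors; dividing by a nonzero
  coordinate of \<open>u\<close> gives the factor of proportionality.\<close>

lemma cross_eq_0_imp_pt_eq:
  assumes "cross u v = 0" "u \<noteq> 0" "v \<noteq> 0"
  shows "pt u = pt v"
proof -
  have eqs: "u $ 2 * v $ 3 = u $ 3 * v $ 2" "u $ 3 * v $ 1 = u $ 1 * v $ 3" "u $ 1 * v $ 2 = u $ 2 * v $ 1"
    using assms(1) by (auto simp: cross_def vec3_eq_iff)
  obtain k where k: "u $ k \<noteq> 0" using assms(2) by (auto simp: vec_eq_iff)
  define c where "c = v $ k / u $ k"
  have "v = c *s u"
    using exhaust_3[of k] k eqs by (auto simp: vec3_eq_iff c_def field_simps)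
  moreover from this have "c \<noteq> 0" using assms(3) by auto
  ultimately show ?thesis by (simp add: pt_scale)
qed

section \<open>Generic points\<close>

abbreviation chart :: "complex \<Rightarrow> complex \<Rightarrow> complex ^ 3" where
  "chart s t \<equiv> vector [s, t, 1]"

lemma chart_nonzero [simp]: "chart s t \<noteq> 0"
  by (simp add: vec3_eq_iff)

text \<open>A nonempty open set contains the nonempty complement of a single curve, and multiplying
  its equation by z keeps the points in the chart. Genericity becomes a statement on pairs (s, t)
  outside the zero set of one form.\<close>

lemma for_generic_chart_iff:
  "for_generic P \<longleftrightarrow> (\<exists>d F s t. homogeneous d F \<and> eval3 (chart s t) F \<noteq> 0 \<and>
     (\<forall>s t. eval3 (chart s t) F \<noteq> 0 \<longrightarrow> P (pt (chart s t))))"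
proof
  assume "for_generic P"
  then obtain U q where U: "zariski_open U" "q \<in> U" "\<forall>q\<in>U. P q"
    by (auto simp: for_generic_def)
  then obtain T where T: "\<forall>F\<in>T. \<exists>d. homogeneous d F" "- U = {p. \<forall>F\<in>T. vanishes_at F p}"
    by (auto simp: zariski_open_def zariski_closed_def)
  from U(2) T(2) obtain F where F: "F \<in> T" "\<not> vanishes_at F q" by auto
  then obtain d where d: "homogeneous d F" using T(1) by auto
  obtain w where w: "w \<noteq> 0" "q = pt w" by (rule pt_exhaust)
  \<comment> \<open>\<open>q\<close> may lie on z = 0. On the line from \<open>w\<close> along the
    third axis neither F nor z vanishes identically, so some point avoids both zero sets.\<close>
  define G where "G = F * Var 3"
  have "poly (on_line w (axis 3 1) F) 0 \<noteq> 0"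
    using F(2) w vanishes_at_pt[OF d] by (simp add: poly_on_line)
  then have "on_line w (axis 3 1) F \<noteq> 0" by auto
  then have "on_line w (axis 3 1) F * [:w $ 3, 1:] \<noteq> 0"
    by (intro no_zero_divisors) auto
  then have "on_line w (axis 3 1) G \<noteq> 0"
    by (simp add: G_def)
  then obtain r where "poly (on_line w (axis 3 1) G) r \<noteq> 0"
    using poly_all_0_iff_0 by blast
  then obtain v where v: "eval3 v F \<noteq> 0" "v $ 3 \<noteq> 0"
    unfolding poly_on_line by (auto simp: G_def simp del: vector_add_component vector_smult_component)
  have "v = v $ 3 *s chart (v $ 1 / v $ 3) (v $ 2 / v $ 3)"
    using v(2) by (simp add: vec3_eq_iff)
  then have "eval3 (chart (v $ 1 / v $ 3) (v $ 2 / v $ 3)) F \<noteq> 0"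
    using eval3_scale[OF d] v(1) by (metis mult_zero_right)
  moreover have "P (pt (chart s t))" if "eval3 (chart s t) F \<noteq> 0" for s t
  proof -
    have "\<not> vanishes_at F (pt (chart s t))"
      using that vanishes_at_pt[OF d] by simp
    then have "pt (chart s t) \<in> U" using T(2) F(1) by auto
    then show ?thesis using U(3) by auto
  qed
  ultimately show "\<exists>d F s t. homogeneous d F \<and> eval3 (chart s t) F \<noteq> 0 \<and>
     (\<forall>s t. eval3 (chart s t) F \<noteq> 0 \<longrightarrow> P (pt (chart s t)))"
    using d by blast
next
  assume "\<exists>d F s t. homogeneous d F \<and> eval3 (chart s t) F \<noteq> 0 \<and>
     (\<forall>s t. eval3 (chart s t) F \<noteq> 0 \<longrightarrow> P (pt (chart s t)))"
  then obtain d F s t where *: "homogeneous d F" "eval3 (chart s t) F \<noteq> 0"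
     "\<And>s t. eval3 (chart s t) F \<noteq> 0 \<Longrightarrow> P (pt (chart s t))" by auto
  have h: "homogeneous (d + 1) (F * Var 3)" by (intro homogeneous_mult * homogeneous_Var)
  let ?U = "{p. \<not> vanishes_at (F * Var 3) p}"
  have "zariski_open ?U"
    unfolding zariski_open_def zariski_closed_def using h
    by (intro exI[of _ "{F * Var 3}"]) auto
  moreover have "pt (chart s t) \<in> ?U"
    using * vanishes_at_pt[OF h] by simp
  moreover have "P p" if "p \<in> ?U" for p
  proof -
    obtain v where v: "v \<noteq> 0" "p = pt v" by (rule pt_exhaust)
    then have n: "eval3 v F \<noteq> 0" "v $ 3 \<noteq> 0" using that vanishes_at_pt[OF h v(1)] by auto
    have eq: "v = v $ 3 *s chart (v $ 1 / v $ 3) (v $ 2 / v $ 3)"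
      using n(2) by (simp add: vec3_eq_iff)
    then have "eval3 (chart (v $ 1 / v $ 3) (v $ 2 / v $ 3)) F \<noteq> 0"
      using eval3_scale[OF *(1)] n(1) by (metis mult_zero_right)
    then have "P (pt (chart (v $ 1 / v $ 3) (v $ 2 / v $ 3)))" by (rule *)
    then show ?thesis using pt_scale[OF n(2)] eq v(2) by metis
  qed
  ultimately show "for_generic P" unfolding for_generic_def by blast
qed

lemma for_generic_mono: "for_generic P \<Longrightarrow> (\<And>q. P q \<Longrightarrow> Q q) \<Longrightarrow> for_generic Q"
  by (auto simp: for_generic_def)

text \<open>Two nonempty open sets meet: on the line joining a point of each, both forms restrict to
  nonzero polynomials, and so does their product.\<close>

lemma for_generic_conj:
  assumes "for_generic P" "for_generic Q"
  shows "for_generic (\<lambda>q. P q \<and> Q q)"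
proof -
  obtain d F s t where P: "homogeneous d F" "eval3 (chart s t) F \<noteq> 0"
    "\<forall>s t. eval3 (chart s t) F \<noteq> 0 \<longrightarrow> P (pt (chart s t))"
    using assms(1) unfolding for_generic_chart_iff by blast
  obtain d' G s' t' where Q: "homogeneous d' G" "eval3 (chart s' t') G \<noteq> 0"
    "\<forall>s t. eval3 (chart s t) G \<noteq> 0 \<longrightarrow> Q (pt (chart s t))"
    using assms(2) unfolding for_generic_chart_iff by blast
  let ?l = "on_line (chart s t) (vector [s' - s, t' - t, 0])"
  have l: "chart s t + r *s vector [s' - s, t' - t, 0] = chart (s + r * (s' - s)) (t + r * (t' - t))" for r
    by (simp add: vec3_eq_iff)
  have "poly (?l F) 0 \<noteq> 0" "poly (?l G) 1 \<noteq> 0"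
    unfolding poly_on_line l using P(2) Q(2) by simp_all
  then have "?l (F * G) \<noteq> 0" by auto
  then obtain r where "poly (?l (F * G)) r \<noteq> 0" using poly_all_0_iff_0 by blast
  then have "eval3 (chart (s + r * (s' - s)) (t + r * (t' - t))) (F * G) \<noteq> 0"
    unfolding poly_on_line l .
  moreover have "homogeneous (d + d') (F * G)" by (intro homogeneous_mult P Q)
  ultimately show ?thesis unfolding for_generic_chart_iff
    using P(3) Q(3) by (intro exI[of _ "d + d'"] exI[of _ "F * G"]) auto
qed

lemma for_generic_ball:
  assumes "finite A" "\<And>a. a \<in> A \<Longrightarrow> for_generic (P a)"
  shows "for_generic (\<lambda>q. \<forall>a\<in>A. P a q)"
  using assms
proof (induction A rule: finite_induct)
  case empty
  show ?case unfolding for_generic_chart_iff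
    by (intro exI[of _ 0] exI[of _ 1]) auto
next
  case (insert a A)
  then have "for_generic (\<lambda>q. P a q \<and> (\<forall>a\<in>A. P a q))" by (intro for_generic_conj) auto
  then show ?case by (rule for_generic_mono) auto
qed

lemma for_generic_ex_chart: "for_generic P \<Longrightarrow> \<exists>s t. P (pt (chart s t))"
  unfolding for_generic_chart_iff by blast

section \<open>Binary forms\<close>

text \<open>A binary form of degree \<open>n\<close> is given by its dehomogenization \<open>p\<close> at \<open>y = 1\<close>.\<close>

definition hev :: "nat \<Rightarrow> complex poly \<Rightarrow> complex \<Rightarrow> complex \<Rightarrow> complex" where
  "hev n p x y = (\<Sum>i\<le>n. coeff p i * (x ^ i * y ^ (n - i)))"

lemma hev_add: "hev n (p + q) x y = hev n p x y + hev n q x y"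
  by (simp add: hev_def distrib_right sum.distrib)

lemma hev_diff: "hev n (p - q) x y = hev n p x y - hev n q x y"
  by (simp add: hev_def left_diff_distrib sum_subtractf)

lemma hev_smult: "hev n (smult c p) x y = c * hev n p x y"
  by (simp add: hev_def sum_distrib_left mult.assoc)

lemma hev_minus: "hev n (- p) x y = - hev n p x y"
  by (simp add: hev_def sum_negf)

lemma hev_zero [simp]: "hev n 0 x y = 0"
  by (simp add: hev_def)

lemma hev_y0: "hev n p x 0 = coeff p n * x ^ n"
proof -
  have "hev n p x 0 = (\<Sum>i\<le>n. if i = n then coeff p n * x ^ n else 0)"
    unfolding hev_def by (intro sum.cong) auto
  then show ?thesis by simp
qed

lemma hev_poly:
  assumes "degree p \<le> n" "y \<noteq> 0"
  shows "hev n p x y = y ^ n * poly p (x / y)"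
proof -
  have "poly p (x / y) = (\<Sum>i\<le>n. coeff p i * (x / y) ^ i)"
    unfolding poly_altdef using assms(1)
    by (intro sum.mono_neutral_left) (auto simp: coeff_eq_0)
  moreover have "x ^ i * y ^ (n - i) = y ^ n * (x / y) ^ i" if "i \<le> n" for i
    using that assms(2) by (simp add: power_divide power_diff)
  ultimately show ?thesis
    unfolding hev_def by (auto simp: sum_distrib_left intro!: sum.cong)
qed

lemma hev_y1: "degree p \<le> n \<Longrightarrow> hev n p x 1 = poly p x"
  by (simp add: hev_poly)

text \<open>Here \<open>m\<close> and \<open>n\<close> are formal degrees that may exceed the true
  ones. This is multiplicativity of binary forms at the direction (1 : 0), where one cannot divide
  by y.\<close>

lemma coeff_mult_top:
  assumes "degree p \<le> m" "degree q \<le> n"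
  shows "coeff (p * q) (m + n) = coeff p m * coeff q n"
proof (cases "degree p = m \<and> degree q = n")
  case True
  then show ?thesis using coeff_mult_degree_sum[of p q] by simp
next
  case False
  then have "degree (p * q) < m + n" using degree_mult_le[of p q] assms by linarith
  moreover have "coeff p m = 0 \<or> coeff q n = 0" using False assms by (metis coeff_eq_0 le_neq_implies_less)
  ultimately show ?thesis by (auto simp: coeff_eq_0)
qed

lemma hev_mult:
  assumes "degree p \<le> m" "degree q \<le> n"
  shows "hev (m + n) (p * q) x y = hev m p x y * hev n q x y"
proof (cases "y = 0")
  case True
  then show ?thesis by (simp add: hev_y0 coeff_mult_top[OF assms] power_add)
next
  case False
  have "degree (p * q) \<le> m + n" using degree_mult_le[of p q] assms by linarith
  then show ?thesis using False assms by (simp add: hev_poly power_add)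
qed

text \<open>The form y is the polynomial 1 read in formal degree 1: setting y = 1 forgets
  it.\<close>

lemma hev_Suc:
  assumes "degree p \<le> n"
  shows "hev (Suc n) p x y = y * hev n p x y"
  using hev_mult[of 1 1 p n x y] assms by (simp add: hev_def[of "Suc 0"])

lemma hev_pCons_0:
  assumes "degree p \<le> n"
  shows "hev (Suc n) (pCons 0 p) x y = x * hev n p x y"
  using hev_mult[of "[:0, 1:]" 1 p n x y] assms by (simp add: hev_def[of "Suc 0"])

text \<open>Zeros with Y nonzero give distinct roots X / Y of \<open>p\<close>. At most one zero
  remains, at (1 : 0), and it lowers the degree of \<open>p\<close> below \<open>n\<close>, so it is
  paid for as well.\<close>

lemma hev_eq_0_imp_eq_0:
  assumes deg: "degree p \<le> n" and "finite I" and card: "card I > n"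
    and zero: "\<And>i. i \<in> I \<Longrightarrow> hev n p (X i) (Y i) = 0"
    and indep: "\<And>i j. i \<in> I \<Longrightarrow> j \<in> I \<Longrightarrow> i \<noteq> j \<Longrightarrow> X i * Y j \<noteq> X j * Y i"
  shows "p = 0"
proof (rule ccontr)
  assume "p \<noteq> 0"
  define J where "J = {i\<in>I. Y i \<noteq> 0}"
  have J: "finite J" "J \<subseteq> I" using assms by (auto simp: J_def)
  have "inj_on (\<lambda>i. X i / Y i) J"
    using indep by (auto simp: inj_on_def J_def field_simps)
  moreover have "(\<lambda>i. X i / Y i) ` J \<subseteq> {x. poly p x = 0}"
  proof (clarsimp simp: J_def)
    fix i assume "i \<in> I" "Y i \<noteq> 0"
    then show "poly p (X i / Y i) = 0" using zero[of i] hev_poly[OF deg, of "Y i" "X i"] by simp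
  qed
  ultimately have "card J \<le> card {x. poly p x = 0}"
    using poly_roots_finite[OF \<open>p \<noteq> 0\<close>] by (metis card_image card_mono)
  also have "\<dots> \<le> degree p" using card_poly_roots_bound[OF \<open>p \<noteq> 0\<close>] .
  finally have le: "card J \<le> degree p" .
  then have "J \<noteq> I" using card deg by auto
  then obtain i where i: "i \<in> I" "Y i = 0" by (auto simp: J_def)
  have "j = i" if "j \<in> I" "Y j = 0" for j
    using indep[OF that(1) i(1)] that(2) i(2) by (metis mult_zero_right)
  then have "I \<subseteq> insert i J" unfolding J_def by blast
  then have "I = insert i J" using i(1) J(2) by blast
  moreover have "i \<notin> J" using i by (simp add: J_def)
  ultimately have "card I = Suc (card J)" using J by simp
  then have "degree p = n" "card J = n" using le card deg by auto
  \<comment> \<open>The finite roots force degree \<open>n\<close>, so vanishing in the direction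
    with Y = 0 means X = 0 there; but (0, 0) is proportional to every other direction.\<close>
  have "coeff p n * X i ^ n = 0" using zero[OF i(1)] i(2) by (simp add: hev_y0)
  moreover have "coeff p n \<noteq> 0" using \<open>degree p = n\<close> \<open>p \<noteq> 0\<close> by auto
  ultimately have "X i = 0" "n > 0" by auto
  then obtain j where "j \<in> J" using \<open>card J = n\<close> by fastforce
  then have "j \<in> I" "j \<noteq> i" using J \<open>i \<notin> J\<close> by blast+
  then show False using indep[OF i(1), of j] \<open>X i = 0\<close> i(2) by auto
qed

lemma hev_factor:
  assumes deg: "degree p \<le> Suc n" and z: "hev (Suc n) p x0 y0 = 0" and nz: "(x0, y0) \<noteq> (0, 0)"
  obtains p1 where "degree p1 \<le> n" "\<And>x y. hev (Suc n) p x y = (y0 * x - x0 * y) * hev n p1 x y"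
proof (cases "y0 = 0")
  case True
  \<comment> \<open>For the direction (1 : 0) the linear factor is a multiple of y, invisible at y =
    1: the quotient is \<open>p\<close> up to scale, in lower formal degree.\<close>
  then have "coeff p (Suc n) = 0" using z nz by (simp add: hev_y0)
  then have d: "degree p \<le> n" using deg by (metis coeff_0_degree_minus_1 degree_le diff_Suc_1 le_Suc_eq leading_coeff_0_iff nat_less_le not_less_eq_eq zero_le)
  show ?thesis
    by (rule that[of "smult (- 1 / x0) p"])
      (use d nz True in \<open>auto simp: hev_Suc hev_smult hev_minus\<close>)
next
  case False
  then have "poly p (x0 / y0) = 0" using z hev_poly[OF deg, of y0 x0] by simp
  then obtain p1 where p1: "p = [:- (x0 / y0), 1:] * p1" by (auto simp: poly_eq_0_iff_dvd)
  then have d: "degree p1 \<le> n" using deg by (cases "p1 = 0") (auto simp: degree_mult_eq simp del: mult_pCons_left)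
  show ?thesis
  proof (rule that[of "smult (1 / y0) p1"])
    fix x y
    have "hev (1 + n) p x y = hev 1 [:- (x0 / y0), 1:] x y * hev n p1 x y"
      unfolding p1 by (rule hev_mult) (use d in auto)
    then show "hev (Suc n) p x y = (y0 * x - x0 * y) * hev n (smult (1 / y0) p1) x y"
      using False by (simp add: hev_smult hev_def[of "Suc 0"] field_simps)
  qed (use d in auto)
qed

text \<open>Coprimality as binary forms. It is stronger than coprimality of the polynomials, since
  it includes the direction (1 : 0), seen only through the formal degrees 4 and 5.\<close>

definition no_common_zero :: "complex poly \<Rightarrow> complex poly \<Rightarrow> bool" where
  "no_common_zero a b \<longleftrightarrow> (\<forall>x y. (x, y) \<noteq> (0, 0) \<longrightarrow> hev 4 a x y = 0 \<longrightarrow> hev 5 b x y \<noteq> 0)"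

context
  fixes a b :: "complex poly"
  assumes deg: "degree a \<le> 4" "degree b \<le> 5" and ncz: "no_common_zero a b"
begin

lemma no_common_zero_top: "coeff a 4 \<noteq> 0 \<or> coeff b 5 \<noteq> 0"
  using ncz[unfolded no_common_zero_def, rule_format, of 1 0] by (auto simp: hev_y0)

lemma no_common_zero_coprime: "coprime a b"
proof (rule coprimeI)
  fix d assume d: "d dvd a" "d dvd b"
  have "degree d = 0"
  proof (rule ccontr)
    assume "degree d \<noteq> 0"
    then obtain x where "poly d x = 0"
      using fundamental_theorem_of_algebra[of d] constant_degree[of d] by auto
    then have "poly a x = 0" "poly b x = 0" using d by (auto simp: dvd_def)
    then show False
      using ncz[unfolded no_common_zero_def, rule_format, of x 1] deg by (simp add: hev_y1)
  qed
  moreover have "d \<noteq> 0" using d no_common_zero_top by auto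
  ultimately show "is_unit d" by (simp add: is_unit_iff_degree)
qed

text \<open>A binary form of degree 5 always has a zero, which would be a common zero if
  \<open>a\<close> were 0.\<close>

lemma no_common_zero_nz: "a \<noteq> 0"
proof
  assume "a = 0"
  then have "degree b = 5" using no_common_zero_top deg le_degree[of b 5] by auto
  then obtain x where "poly b x = 0"
    using fundamental_theorem_of_algebra[of b] constant_degree[of b] by auto
  then show False
    using ncz[unfolded no_common_zero_def, rule_format, of x 1] deg \<open>a = 0\<close> by (simp add: hev_y1)
qed

text \<open>Coprimality gives a' = a c and b' = b c with a polynomial \<open>c\<close>; since
  \<open>a\<close> or \<open>b\<close> attains its formal degree, \<open>c\<close> is
  constant.\<close>

lemma no_common_zero_proportional:
  assumes "degree a' \<le> 4" "degree b' \<le> 5" "a * b' = a' * b"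
  obtains c where "a' = smult c a" "b' = smult c b"
proof -
  have "a dvd a' * b" using assms(3) by (metis dvd_triv_left)
  then have "a dvd a'" using coprime_dvd_mult_left_iff[OF no_common_zero_coprime] by simp
  then obtain c where c: "a' = a * c" by (auto simp: dvd_def)
  then have "a * b' = a * (b * c)" using assms(3) by (simp add: mult_ac)
  then have c': "b' = b * c" using no_common_zero_nz by simp
  have "degree c = 0"
  proof (cases "c = 0")
    case False
    from no_common_zero_top show ?thesis
    proof
      assume "coeff a 4 \<noteq> 0"
      then have "degree a = 4" using deg le_degree by (metis le_antisym)
      then show ?thesis using c assms(1) False no_common_zero_nz by (simp add: degree_mult_eq)
    next
      assume *: "coeff b 5 \<noteq> 0"
      then have "degree b = 5" "b \<noteq> 0" using deg le_degree by (metis le_antisym) (use * in auto)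
      then show ?thesis using c' assms(2) False by (simp add: degree_mult_eq)
    qed
  qed simp
  then obtain k where "c = [:k:]" by (metis degree_eq_zeroE)
  then show ?thesis using that[of k] c c' by simp
qed

end

section \<open>Quintics with a point of multiplicity four\<close>

definition quintic :: "complex \<Rightarrow> complex \<Rightarrow> complex poly \<Rightarrow> complex poly \<Rightarrow> complex ^ 3 \<Rightarrow> complex" where
  "quintic s t a b v = v $ 3 * hev 4 a (v $ 1 - s * v $ 3) (v $ 2 - t * v $ 3)
     + hev 5 b (v $ 1 - s * v $ 3) (v $ 2 - t * v $ 3)"

text \<open>Differentiating along the line with the chain rule lowers \<open>m\<close> and
  \<open>k\<close> by one, which reduces the claim to constant terms, that is, values at
  \<open>q\<close>.\<close>

lemma on_line_order:
  assumes "\<And>is. length is < m \<Longrightarrow> eval3 q (foldr partial3 is F) = 0" "k < m"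
  shows "coeff (on_line q w F) k = 0"
  using assms
proof (induction m arbitrary: F k)
  case (Suc m)
  show ?case
  proof (cases k)
    case 0
    have "coeff (on_line q w F) 0 = poly (on_line q w F) 0" by (simp add: poly_0_coeff_0)
    also have "\<dots> = eval3 q F" by (simp add: poly_on_line)
    also have "\<dots> = 0" using Suc.prems(1)[of "[]"] by simp
    finally show ?thesis using 0 by simp
  next
    case (Suc j)
    have "coeff (on_line q w (partial3 i F)) j = 0" for i
    proof (rule Suc.IH)
      fix "is" :: "3 list" assume "length is < m"
      \<comment> \<open>\<open>foldr\<close> applies the last entry of the list first, so the new
        variable is appended at the end.\<close>
      then show "eval3 q (foldr partial3 is (partial3 i F)) = 0"
        using Suc.prems(1)[of "is @ [i]"] by simp
    qed (use Suc Suc.prems in simp)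
    then have "coeff (pderiv (on_line q w F)) j = 0"
      by (simp add: pderiv_on_line coeff_sum)
    then show ?thesis using Suc by (simp add: coeff_pderiv del: of_nat_Suc)
  qed
qed simp

text \<open>Moves the fat point (s : t : 1) to (0 : 0 : 1), where its multiplicity is read off from
  the powers of z.\<close>

definition shift3 :: "complex \<Rightarrow> complex \<Rightarrow> poly3 \<Rightarrow> poly3" where
  "shift3 s t = subst3 Const (\<lambda>i. if i = 1 then Var 1 + Const s * Var 3
     else if i = 2 then Var 2 + Const t * Var 3 else Var 3)"

lemma eval3_prod: "eval3 v (prod f A) = (\<Prod>a\<in>A. eval3 v (f a))"
  by (induction A rule: infinite_finite_induct) simp_all

lemma eval3_shift3: "eval3 v (shift3 s t F) = eval3 (vector [v $ 1 + s * v $ 3, v $ 2 + t * v $ 3, v $ 3]) F"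
proof -
  have ne: "(2::3) \<noteq> 1" "(3::3) \<noteq> 1" "(3::3) \<noteq> 2" by auto
  show ?thesis
    by (simp add: shift3_def subst3_def eval3_expand[of "vector _"] eval3_prod prod_UNIV_3 ne)
qed

lemma homogeneous_shift3:
  assumes "homogeneous d F"
  shows "homogeneous d (shift3 s t F)"
  unfolding shift3_def subst3_def
proof (intro homogeneous_sum homogeneous_Const_mult)
  fix m assume m: "m \<in> Poly_Mapping.keys F"
  let ?r = "\<lambda>i::3. if i = 1 then Var 1 + Const s * Var 3 else if i = 2 then Var 2 + Const t * Var 3 else Var 3"
  have "homogeneous 1 (?r i)" for i
    by (auto intro!: homogeneous_add homogeneous_Const_mult simp del: One_nat_def)
  then have h: "homogeneous k (?r i ^ k)" for i k by (rule homogeneous_power_linear)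
  have "homogeneous (Poly_Mapping.lookup m 1 + Poly_Mapping.lookup m 2 + Poly_Mapping.lookup m 3)
      (?r 1 ^ Poly_Mapping.lookup m 1 * ?r 2 ^ Poly_Mapping.lookup m 2 * ?r 3 ^ Poly_Mapping.lookup m 3)"
    by (intro homogeneous_mult h)
  moreover have "Poly_Mapping.lookup m 1 + Poly_Mapping.lookup m 2 + Poly_Mapping.lookup m 3 = d"
    using m assms by (simp add: homogeneous_def sum_3)
  ultimately show "homogeneous d (\<Prod>i\<in>UNIV. ?r i ^ Poly_Mapping.lookup m i)"
    unfolding prod_UNIV_3 by metis
qed

text \<open>After translation F is a sum of z^k \<open>p k\<close> with \<open>p k\<close> of degree
  5 - k. On a line through the fat point \<open>p k\<close> appears as the coefficient of T^(5-k);
  multiplicity four kills the exponents up to 3, that is, all k >= 2.\<close>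

lemma quintic_of_form:
  assumes "homogeneous 5 F" "vanishes_to_order 4 F (pt (chart s t))"
  obtains a b where "degree a \<le> 4" "degree b \<le> 5" "\<And>v. eval3 v F = quintic s t a b v"
proof -
  define G where "G = shift3 s t F"
  have hG: "homogeneous 5 G" unfolding G_def by (rule homogeneous_shift3) fact
  define p where "p k = (\<Sum>i\<le>5-k. monom (cf G i (5 - k - i) k) i)" for k
  have deg: "degree (p k) \<le> 5 - k" for k
    unfolding p_def by (intro degree_sum_le) (auto intro: order.trans[OF degree_monom_le])
  have "hev (5 - k) (p k) x y = (\<Sum>i\<le>5-k. cf G i (5 - k - i) k * (x ^ i * y ^ (5 - k - i)))" for k x y
    unfolding hev_def p_def by (intro sum.cong) (auto simp: coeff_sum)
  then have G: "eval3 v G = (\<Sum>k\<le>5. v $ 3 ^ k * hev (5 - k) (p k) (v $ 1) (v $ 2))" for v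
    unfolding eval3_homogeneous[OF hG] by (simp add: sum_distrib_left mult_ac)
  have van: "eval3 (chart s t) (foldr partial3 is F) = 0" if "length is < 4" for "is"
  proof -
    have "vanishes_at (foldr partial3 is F) (pt (chart s t))"
      using assms(2) that by (simp add: vanishes_to_order_def)
    moreover have "chart s t \<in> coords (pt (chart s t))"
      by (auto simp: coords_pt intro!: exI[of _ 1])
    ultimately show ?thesis by (simp add: vanishes_at_def)
  qed
  have 0: "hev (5 - k) (p k) x y = 0" if "2 \<le> k" "k \<le> 5" for k x y
  proof -
    let ?l = "on_line (chart s t) (vector [x, y, 0]) F"
    have sc: "hev m q (T * x) (T * y) = T ^ m * hev m q x y" for m q T
    proof -
      have "(T * x) ^ i * (T * y) ^ (m - i) = T ^ m * (x ^ i * y ^ (m - i))" if "i \<le> m" for i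
      proof -
        have "T ^ m = T ^ i * T ^ (m - i)" using that by (simp flip: power_add)
        then show ?thesis by (simp add: power_mult_distrib mult_ac)
      qed
      then show ?thesis unfolding hev_def sum_distrib_left by (intro sum.cong) (auto simp: mult_ac)
    qed
    have "poly ?l T = poly (\<Sum>k\<le>5. monom (hev (5 - k) (p k) x y) (5 - k)) T" for T
    proof -
      have "chart s t + T *s vector [x, y, 0] = vector [T * x + s * 1, T * y + t * 1, 1]"
        by (simp add: vec3_eq_iff)
      then have "poly ?l T = eval3 (vector [T * x, T * y, 1]) G"
        by (simp add: poly_on_line G_def eval3_shift3 add.commute)
      then show ?thesis by (simp add: G sc poly_sum poly_monom mult.commute)
    qed
    then have "?l = (\<Sum>k\<le>5. monom (hev (5 - k) (p k) x y) (5 - k))"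
      using poly_eq_poly_eq_iff by blast
    moreover have "coeff (\<Sum>j\<le>5. monom (hev (5 - j) (p j) x y) (5 - j)) (5 - k) =
      (\<Sum>j\<le>5. if j = k then hev (5 - k) (p k) x y else 0)"
      unfolding coeff_sum using that by (intro sum.cong) auto
    ultimately have "coeff ?l (5 - k) = hev (5 - k) (p k) x y"
      using that by simp
    moreover have "coeff ?l (5 - k) = 0"
      by (rule on_line_order[of 4]) (use van that in auto)
    ultimately show ?thesis by simp
  qed
  have G': "eval3 v G = hev 5 (p 0) (v $ 1) (v $ 2) + v $ 3 * hev 4 (p 1) (v $ 1) (v $ 2)" for v
  proof -
    have "eval3 v G = (\<Sum>k\<in>{0,1}. v $ 3 ^ k * hev (5 - k) (p k) (v $ 1) (v $ 2))"
      unfolding G by (intro sum.mono_neutral_right) (auto intro!: 0)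
    then show ?thesis by simp
  qed
  show ?thesis
  proof (rule that[of "p 1" "p 0"])
    fix v :: "complex ^ 3"
    have "eval3 v F = eval3 (vector [v $ 1 - s * v $ 3, v $ 2 - t * v $ 3, v $ 3]) G"
      unfolding G_def eval3_shift3 by (rule arg_cong[of _ _ "\<lambda>v. eval3 v F"]) (simp add: vec3_eq_iff)
    then show "eval3 v F = quintic s t (p 1) (p 0) v" by (simp add: G' quintic_def)
  qed (use deg[of 0] deg[of 1] in auto)
qed

text \<open>\<open>ord_ge X Y k\<close> is the \<open>k\<close>-th power of the ideal generated by \<open>X\<close> and \<open>Y\<close>.\<close>

inductive ord_ge :: "poly3 \<Rightarrow> poly3 \<Rightarrow> nat \<Rightarrow> poly3 \<Rightarrow> bool" for X Y where
  ord_ge_0: "ord_ge X Y 0 F"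
| ord_ge_X: "ord_ge X Y k F \<Longrightarrow> ord_ge X Y (Suc k) (X * F)"
| ord_ge_Y: "ord_ge X Y k F \<Longrightarrow> ord_ge X Y (Suc k) (Y * F)"
| ord_ge_add: "ord_ge X Y k F \<Longrightarrow> ord_ge X Y k G \<Longrightarrow> ord_ge X Y k (F + G)"

lemma ord_ge_mult: "ord_ge X Y k F \<Longrightarrow> ord_ge X Y k (H * F)"
proof (induction rule: ord_ge.induct)
  case (ord_ge_X k F)
  then show ?case using ord_ge.ord_ge_X[of X Y k "H * F"] by (simp add: mult.left_commute)
next
  case (ord_ge_Y k F)
  then show ?case using ord_ge.ord_ge_Y[of X Y k "H * F"] by (simp add: mult.left_commute)
qed (auto intro: ord_ge.intros simp: distrib_left)

lemma ord_ge_pred: "ord_ge X Y k F \<Longrightarrow> ord_ge X Y (k - 1) F"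
  by (induction rule: ord_ge.induct) (auto intro: ord_ge.intros ord_ge_mult)

text \<open>By the product rule each differentiation costs at most one factor \<open>X\<close> or
  \<open>Y\<close>.\<close>

lemma ord_ge_partial3: "ord_ge X Y k F \<Longrightarrow> ord_ge X Y (k - 1) (partial3 i F)"
proof (induction rule: ord_ge.induct)
  case (ord_ge_X k F)
  have "ord_ge X Y k (partial3 i X * F)" by (intro ord_ge_mult ord_ge_X)
  \<comment> \<open>The induction hypothesis gives order \<open>Suc (k - 1)\<close>, which differs
    from \<open>k\<close> only for k = 0, where every polynomial qualifies.\<close>
  moreover have "ord_ge X Y k (X * partial3 i F)"
    using ord_ge.ord_ge_X[OF ord_ge_X.IH] by (cases k) (auto intro: ord_ge_0)
  ultimately show ?case by (simp add: partial3_mult ord_ge_add)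
next
  case (ord_ge_Y k F)
  have "ord_ge X Y k (partial3 i Y * F)" by (intro ord_ge_mult ord_ge_Y)
  moreover have "ord_ge X Y k (Y * partial3 i F)"
    using ord_ge.ord_ge_Y[OF ord_ge_Y.IH] by (cases k) (auto intro: ord_ge_0)
  ultimately show ?case by (simp add: partial3_mult ord_ge_add)
qed (auto intro: ord_ge.intros)

lemma ord_ge_foldr: "ord_ge X Y k F \<Longrightarrow> ord_ge X Y (k - length is) (foldr partial3 is F)"
proof (induction "is")
  case (Cons i "is")
  then show ?case using ord_ge_partial3[of X Y "k - length is" _ i] by simp
qed simp

lemma eval3_ord_ge: "ord_ge X Y k F \<Longrightarrow> eval3 v X = 0 \<Longrightarrow> eval3 v Y = 0 \<Longrightarrow> 0 < k \<Longrightarrow> eval3 v F = 0"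
  by (induction rule: ord_ge.induct) auto

lemma ord_ge_zero: "ord_ge X Y k 0"
proof (induction k)
  case (Suc k)
  then show ?case using ord_ge_X[OF Suc] by simp
qed (rule ord_ge_0)

lemma ord_ge_sum: "(\<And>a. a \<in> A \<Longrightarrow> ord_ge X Y k (f a)) \<Longrightarrow> ord_ge X Y k (sum f A)"
  by (induction A rule: infinite_finite_induct) (auto intro: ord_ge_add ord_ge_zero)

lemma ord_ge_power: "ord_ge X Y (i + j) (X ^ i * Y ^ j)"
proof (induction i)
  case 0
  show ?case
  proof (induction j)
    case (Suc j)
    then show ?case using ord_ge_Y[of X Y j "Y ^ j"] by simp
  qed (simp add: ord_ge_0)
next
  case (Suc i)
  then show ?case using ord_ge_X[OF Suc] by (simp add: mult.assoc)
qed

section \<open>Quintics built from a pair of binary forms\<close>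

definition hform :: "nat \<Rightarrow> complex poly \<Rightarrow> poly3 \<Rightarrow> poly3 \<Rightarrow> poly3" where
  "hform n p X Y = (\<Sum>i\<le>n. Const (coeff p i) * (X ^ i * Y ^ (n - i)))"

lemma eval3_hform [simp]: "eval3 v (hform n p X Y) = hev n p (eval3 v X) (eval3 v Y)"
  by (simp add: hform_def hev_def)

lemma homogeneous_hform:
  assumes "homogeneous 1 X" "homogeneous 1 Y"
  shows "homogeneous n (hform n p X Y)"
  unfolding hform_def
proof (intro homogeneous_sum homogeneous_Const_mult)
  fix i assume "i \<in> {..n}"
  then show "homogeneous n (X ^ i * Y ^ (n - i))"
    using homogeneous_mult[OF homogeneous_power_linear[OF assms(1), of i] homogeneous_power_linear[OF assms(2), of "n - i"]]
    by simp
qed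

lemma ord_ge_hform: "ord_ge X Y n (hform n p X Y)"
  unfolding hform_def
proof (rule ord_ge_sum, rule ord_ge_mult)
  fix i assume "i \<in> {..n}"
  then show "ord_ge X Y n (X ^ i * Y ^ (n - i))" using ord_ge_power[of X Y i "n - i"] by simp
qed

definition quintic3 :: "complex \<Rightarrow> complex \<Rightarrow> complex poly \<Rightarrow> complex poly \<Rightarrow> poly3" where
  "quintic3 s t a b = Var 3 * hform 4 a (Var 1 - Const s * Var 3) (Var 2 - Const t * Var 3)
     + hform 5 b (Var 1 - Const s * Var 3) (Var 2 - Const t * Var 3)"

lemma eval3_quintic3: "eval3 v (quintic3 s t a b) = quintic s t a b v"
  by (simp add: quintic3_def quintic_def)

lemma homogeneous_quintic3: "homogeneous 5 (quintic3 s t a b)"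
proof -
  have l: "homogeneous 1 (Var i - Const s * Var 3)" for i s
    by (intro homogeneous_diff homogeneous_Const_mult homogeneous_Var)
  have "homogeneous (1 + 4) (Var 3 * hform 4 a (Var 1 - Const s * Var 3) (Var 2 - Const t * Var 3))"
    by (intro homogeneous_mult homogeneous_hform homogeneous_Var l)
  then show ?thesis unfolding quintic3_def
    by (intro homogeneous_add homogeneous_hform l) simp
qed

text \<open>Both summands lie in the fourth power of the ideal of the point, and fewer than four
  derivatives leave a generator in every term.\<close>

lemma vanishes_to_order_quintic3: "vanishes_to_order 4 (quintic3 s t a b) (pt (chart s t))"
  unfolding vanishes_to_order_def vanishes_at_def
proof (intro allI impI ballI)
  fix "is" :: "3 list" and v assume l: "length is < 4" and "v \<in> coords (pt (chart s t))"
  then obtain c where v: "v = c *s chart s t" by (auto simp: coords_pt)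
  let ?X = "Var 1 - Const s * Var 3" and ?Y = "Var 2 - Const t * Var 3"
  have "ord_ge ?X ?Y 4 (quintic3 s t a b)"
    unfolding quintic3_def
    using ord_ge_pred[OF ord_ge_hform[of ?X ?Y 5 b]]
    by (intro ord_ge_add ord_ge_mult ord_ge_hform) simp
  from ord_ge_foldr[OF this, of "is"] show "eval3 v (foldr partial3 is (quintic3 s t a b)) = 0"
    by (rule eval3_ord_ge) (use l in \<open>auto simp: v\<close>)
qed

section \<open>Irreducibility\<close>

definition ev :: "complex poly poly poly \<Rightarrow> complex \<Rightarrow> complex \<Rightarrow> complex \<Rightarrow> complex" where
  "ev P x y z = poly (poly (poly P [:[:z:]:]) [:y:]) x"

lemma poly_const_roots_imp_zero:
  fixes P :: "'a::idom poly poly"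
  assumes "\<And>y. poly P [:y:] = 0" "infinite (UNIV :: 'a set)"
  shows "P = 0"
proof (rule ccontr)
  assume "P \<noteq> 0"
  then have "finite {r. poly P r = 0}" by (rule poly_roots_finite)
  moreover have "range (\<lambda>y. [:y:]) \<subseteq> {r. poly P r = 0}" using assms(1) by auto
  ultimately have "finite (range (\<lambda>y::'a. [:y:]))" by (rule rev_finite_subset)
  moreover have "inj (\<lambda>y::'a. [:y:])" by (auto simp: inj_on_def)
  ultimately show False using assms(2) finite_imageD by blast
qed

lemma poly2_eq_0:
  fixes Q :: "complex poly poly"
  assumes "\<And>x y. poly (poly Q [:y:]) x = 0"
  shows "Q = 0"
proof (rule poly_const_roots_imp_zero)
  show "poly Q [:y:] = 0" for y using assms poly_all_0_iff_0 by blast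
qed (rule infinite_UNIV_char_0)

lemma ev_eq_0:
  assumes "\<And>x y z. ev P x y z = 0"
  shows "P = 0"
proof (rule ccontr)
  assume "P \<noteq> 0"
  then have "finite {r. poly P r = 0}" by (rule poly_roots_finite)
  moreover have "range (\<lambda>z. [:[:z:]:]) \<subseteq> {r. poly P r = 0}"
  proof clarify
    fix z show "poly P [:[:z:]:] = 0"
      by (rule poly2_eq_0) (use assms in \<open>simp add: ev_def\<close>)
  qed
  ultimately have "finite (range (\<lambda>z::complex. [:[:z:]:]))" by (rule rev_finite_subset)
  moreover have "inj (\<lambda>z::complex. [:[:z:]:])" by (auto simp: inj_on_def)
  ultimately show False using infinite_UNIV_char_0 finite_imageD by blast
qed

text \<open>The form in coordinates centred at (s : t : 1), as a polynomial in z over C[x][y]. Its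
  \<open>degree\<close> is the degree in z, which is additive on products and equals 1 for the
  quintics in question.\<close>

definition nest3 :: "complex \<Rightarrow> complex \<Rightarrow> poly3 \<Rightarrow> complex poly poly poly" where
  "nest3 s t = subst3 (\<lambda>c. [:[:[:c:]:]:]) (\<lambda>i. if i = 1 then [:[:[:0, 1:]:], [:[:s:]:]:]
     else if i = 2 then [:[:0, 1:], [:[:t:]:]:] else [:0, 1:])"

lemma nest3_mult: "nest3 s t (F * G) = nest3 s t F * nest3 s t G"
  unfolding nest3_def by (rule pCons3_hom.subst3_mult)

lemma ev_nest3: "ev (nest3 s t F) x y z = eval3 (vector [x + s * z, y + t * z, z]) F"
proof -
  have ne: "(2::3) \<noteq> 1" "(3::3) \<noteq> 1" "(3::3) \<noteq> 2" by auto
  show ?thesis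
    by (simp add: ev_def nest3_def subst3_def poly_sum prod_UNIV_3 ne eval3_expand poly_power mult_ac add_ac)
qed

text \<open>A nonconstant polynomial in two variables has a zero off the origin: fix x nonzero such
  that the leading coefficient in y survives and solve for y; if y does not occur, take a root x and
  y = 1.\<close>

lemma constant_if_no_zero:
  fixes P :: "complex poly poly"
  assumes "P \<noteq> 0" "\<And>x y. (x, y) \<noteq> (0, 0) \<Longrightarrow> poly (poly P [:y:]) x \<noteq> 0"
  obtains c where "c \<noteq> 0" "P = [:[:c:]:]"
proof -
  have "degree P = 0"
  proof (rule ccontr)
    assume d: "degree P \<noteq> 0"
    have "lead_coeff P * [:0, 1:] \<noteq> 0" using assms(1) by (intro no_zero_divisors) auto
    then obtain x where "poly (lead_coeff P * [:0, 1:]) x \<noteq> 0"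
      using poly_all_0_iff_0 by blast
    then have x: "poly (lead_coeff P) x \<noteq> 0" "x \<noteq> 0" by auto
    define R where "R = map_poly (\<lambda>c. poly c x) P"
    have R: "poly R y = poly (poly P [:y:]) x" for y
      unfolding R_def by (induction P) (auto simp: map_poly_pCons)
    have "coeff R (degree P) \<noteq> 0" using x by (simp add: R_def coeff_map_poly)
    then have "degree R \<noteq> 0" using d le_degree by fastforce
    then obtain y where "poly R y = 0"
      using fundamental_theorem_of_algebra[of R] constant_degree[of R] by auto
    then show False using R assms(2)[of x y] x by simp
  qed
  then obtain p where p: "P = [:p:]" by (metis degree_eq_zeroE)
  have "degree p = 0"
  proof (rule ccontr)
    assume "degree p \<noteq> 0"
    then obtain x where "poly p x = 0"
      using fundamental_theorem_of_algebra[of p] constant_degree[of p] by auto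
    then show False using assms(2)[of x 1] p by simp
  qed
  then obtain c where "p = [:c:]" by (metis degree_eq_zeroE)
  then show ?thesis using that p assms(1) by auto
qed

lemma quintic_at: "quintic s t a b (vector [x + s * z, y + t * z, z]) = z * hev 4 a x y + hev 5 b x y"
  by (simp add: quintic_def)

text \<open>Since z a + b is linear in z, one of two factors is free of z and divides both
  \<open>a\<close> and \<open>b\<close>. It then has no zero off the origin and is constant.\<close>

lemma irreducible_quintic3:
  assumes deg: "degree a \<le> 4" "degree b \<le> 5" and ncz: "no_common_zero a b"
  shows "irreducible (quintic3 s t a b)"
proof (rule irreducibleI)
  let ?F = "quintic3 s t a b"
  define biv where "biv n p = (\<Sum>i\<le>n. monom (monom (coeff p i) i) (n - i))" for n and p :: "complex poly"
  have biv: "poly (poly (biv n p) [:y:]) x = hev n p x y" for n p x y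
    by (simp add: biv_def poly_sum poly_monom hev_def mult_ac poly_power)
  have nest: "nest3 s t ?F = [:biv 5 b, biv 4 a:]"
  proof -
    have "ev (nest3 s t ?F - [:biv 5 b, biv 4 a:]) x y z = 0" for x y z
    proof -
      have "ev (nest3 s t ?F - [:biv 5 b, biv 4 a:]) x y z = ev (nest3 s t ?F) x y z - ev [:biv 5 b, biv 4 a:] x y z"
        by (simp add: ev_def)
      also have "ev (nest3 s t ?F) x y z = z * hev 4 a x y + hev 5 b x y"
        by (simp add: ev_nest3 eval3_quintic3 quintic_at)
      also have "ev [:biv 5 b, biv 4 a:] x y z = z * hev 4 a x y + hev 5 b x y"
        by (simp add: ev_def biv)
      finally show ?thesis by simp
    qed
    then show ?thesis using ev_eq_0 by (metis eq_iff_diff_eq_0)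
  qed
  have a0: "biv 4 a \<noteq> 0"
  proof
    assume "biv 4 a = 0"
    then have "hev 4 a x 1 = 0" for x using biv[of 4 a 1 x] by simp
    then have "a = 0" using hev_y1[OF deg(1)] poly_all_0_iff_0 by metis
    then show False using no_common_zero_nz[OF deg ncz] by simp
  qed
  show "?F \<noteq> 0"
  proof
    assume "?F = 0"
    then have "nest3 s t ?F = 0" by (simp add: nest3_def subst3_def)
    then show False using nest a0 by simp
  qed
  show "\<not> ?F dvd 1"
    by (rule not_unit_if_eval3_zero[of 0]) (simp add: eval3_quintic3 quintic_def hev_y0)
  have unit: "A dvd 1" if AB: "?F = A * B" and d: "degree (nest3 s t A) = 0" for A B
  proof -
    obtain P where P: "nest3 s t A = [:P:]" using d by (metis degree_eq_zeroE)
    have "[:biv 5 b, biv 4 a:] = [:P:] * nest3 s t B"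
      using nest unfolding AB nest3_mult P by (rule sym)
    then have "[:biv 5 b, biv 4 a:] = smult P (nest3 s t B)" by simp
    then have b5: "biv 5 b = P * coeff (nest3 s t B) 0" and a4: "biv 4 a = P * coeff (nest3 s t B) 1"
      by (metis coeff_smult coeff_pCons_0, metis One_nat_def coeff_smult coeff_pCons_0 coeff_pCons_Suc)
    then have e: "hev 5 b x y = poly (poly P [:y:]) x * poly (poly (coeff (nest3 s t B) 0) [:y:]) x"
      "hev 4 a x y = poly (poly P [:y:]) x * poly (poly (coeff (nest3 s t B) 1) [:y:]) x" for x y
      by (metis biv poly_mult)+
    have "P \<noteq> 0" using a4 a0 by auto
    moreover have "poly (poly P [:y:]) x \<noteq> 0" if "(x, y) \<noteq> (0, 0)" for x y
      using ncz that e[of x y] unfolding no_common_zero_def by fastforce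
    ultimately obtain c where c: "c \<noteq> 0" "P = [:[:c:]:]" by (rule constant_if_no_zero)
    have "eval3 v A = c" for v
    proof -
      have "v = vector [(v $ 1 - s * v $ 3) + s * v $ 3, (v $ 2 - t * v $ 3) + t * v $ 3, v $ 3]"
        by (simp add: vec3_eq_iff)
      then have "eval3 v A = ev (nest3 s t A) (v $ 1 - s * v $ 3) (v $ 2 - t * v $ 3) (v $ 3)"
        unfolding ev_nest3 by simp
      then show ?thesis by (simp add: P c ev_def)
    qed
    then show ?thesis using c(1) by (rule eval3_const_imp_unit)
  qed
  fix A B assume AB: "?F = A * B"
  have "[:biv 5 b, biv 4 a:] = nest3 s t A * nest3 s t B"
    using nest unfolding AB nest3_mult by (rule sym)
  moreover have "degree [:biv 5 b, biv 4 a:] = 1" using a0 by simp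
  ultimately have "degree (nest3 s t A) + degree (nest3 s t B) = 1"
    by (metis degree_0 degree_mult_eq mult_eq_0_iff zero_neq_one)
  then have "degree (nest3 s t A) = 0 \<or> degree (nest3 s t B) = 0" by arith
  then show "A dvd 1 \<or> B dvd 1"
    using unit[OF AB] unit[of B A] AB by (metis mult.commute)
qed

text \<open>At a common zero (x : y) of \<open>a\<close> and \<open>b\<close> the line through the
  fat point in that direction splits off.\<close>

lemma irreducible_quintic3_imp_no_common_zero:
  assumes deg: "degree a \<le> 4" "degree b \<le> 5" and irr: "irreducible (quintic3 s t a b)"
  shows "no_common_zero a b"
  unfolding no_common_zero_def
proof (intro allI impI notI)
  fix x y assume nz: "(x, y) \<noteq> (0, 0)" and z: "hev 4 a x y = 0" "hev 5 b x y = 0"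
  have "\<exists>a1. \<forall>u w. hev 4 a u w = (y * u - x * w) * hev 3 a1 u w"
  proof (rule hev_factor[of a 3 x y])
    fix p assume "\<And>u w. hev (Suc 3) a u w = (y * u - x * w) * hev 3 p u w"
    then show ?thesis by (intro exI[of _ p]) simp
  qed (use deg z nz in simp_all)
  then obtain a1 where a1: "\<And>u w. hev 4 a u w = (y * u - x * w) * hev 3 a1 u w" by blast
  have "\<exists>b1. \<forall>u w. hev 5 b u w = (y * u - x * w) * hev 4 b1 u w"
  proof (rule hev_factor[of b 4 x y])
    fix p assume "\<And>u w. hev (Suc 4) b u w = (y * u - x * w) * hev 4 p u w"
    then show ?thesis by (intro exI[of _ p]) simp
  qed (use deg z nz in simp_all)
  then obtain b1 where b1: "\<And>u w. hev 5 b u w = (y * u - x * w) * hev 4 b1 u w" by blast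
  let ?X = "Var 1 - Const s * Var 3" and ?Y = "Var 2 - Const t * Var 3"
  let ?L = "Const y * ?X - Const x * ?Y" and ?G = "Var 3 * hform 3 a1 ?X ?Y + hform 4 b1 ?X ?Y"
  have "quintic3 s t a b = ?L * ?G"
    by (rule eval3_eqI) (simp add: eval3_quintic3 quintic_def a1 b1 algebra_simps)
  moreover have "\<not> ?L dvd 1" "\<not> ?G dvd 1"
    by (rule not_unit_if_eval3_zero[of 0]; simp add: hev_y0)+
  ultimately show False using irr unfolding irreducible_def by blast
qed

section \<open>Spaces of forms\<close>

lemma eval3_scale3 [simp]: "eval3 v (scale3 c F) = c * eval3 v F"
  by (simp add: scale3_def)

lemma lookup_scale3: "Poly_Mapping.lookup (scale3 c F) m = c * Poly_Mapping.lookup F m"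
proof (induction F rule: poly_mapping_single_add_induct)
  case (single n d)
  show ?case by (simp add: scale3_def Const_def mult_single lookup_single when_def)
qed (simp_all add: scale3_def lookup_add distrib_left)

lemma partial3_scale3: "partial3 i (scale3 c F) = scale3 c (partial3 i F)"
  by (simp add: scale3_def partial3_mult)

lemma foldr_partial3_add: "foldr partial3 is (F + G) = foldr partial3 is F + foldr partial3 is G"
  by (induction "is") simp_all

lemma foldr_partial3_scale3: "foldr partial3 is (scale3 c F) = scale3 c (foldr partial3 is F)"
  by (induction "is") (simp_all add: partial3_scale3)

lemma foldr_partial3_zero: "foldr partial3 is 0 = 0"
  by (induction "is") simp_all

lemma subspace_homogeneous: "poly3.subspace {F. homogeneous d F}"
  by (auto simp: poly3.subspace_def scale3_def intro: homogeneous_add homogeneous_Const_mult)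

lemma subspace_forms_through: "poly3.subspace (forms_through j Z)"
  by (auto simp: poly3.subspace_def forms_through_def vanishes_at_def scale3_def
      intro: homogeneous_add homogeneous_Const_mult)

lemma subspace_forms_through_fat: "poly3.subspace (forms_through_fat j Z m q)"
  using subspace_forms_through[of j Z]
  by (auto simp: poly3.subspace_def forms_through_fat_def vanishes_to_order_def vanishes_at_def
      foldr_partial3_add foldr_partial3_scale3 foldr_partial3_zero)

text \<open>\<open>poly3.dim\<close> is 0 on spaces of infinite dimension, so a bound on it alone
  says little; a finite spanning set is a genuine bound and passes to subsets.\<close>

definition fin_span :: "poly3 set \<Rightarrow> nat \<Rightarrow> bool" where
  "fin_span W n \<longleftrightarrow> (\<exists>B. finite B \<and> card B \<le> n \<and> W \<subseteq> poly3.span B)"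

lemma fin_span_subset: "fin_span W n \<Longrightarrow> W' \<subseteq> W \<Longrightarrow> fin_span W' n"
  unfolding fin_span_def by blast

lemma fin_span_mono: "fin_span W n \<Longrightarrow> n \<le> n' \<Longrightarrow> fin_span W n'"
  unfolding fin_span_def by (meson order_trans)

lemma fin_span_dim_le: "fin_span W n \<Longrightarrow> poly3.dim W \<le> n"
  unfolding fin_span_def using poly3.dim_le_card order_trans by blast

lemma fin_span_dim:
  assumes "fin_span W n"
  shows "fin_span W (poly3.dim W)"
proof -
  obtain B where B: "B \<subseteq> W" "poly3.independent B" "W \<subseteq> poly3.span B" "card B = poly3.dim W"
    by (rule poly3.basis_exists)
  obtain C where C: "finite C" "W \<subseteq> poly3.span C" using assms by (auto simp: fin_span_def)
  then have "finite B" using poly3.independent_span_bound[OF C(1) B(2)] B(1) by blast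
  then show ?thesis using B by (auto simp: fin_span_def)
qed

lemma dim_pos:
  assumes "fin_span W n" "F \<in> W" "F \<noteq> 0"
  shows "poly3.dim W > 0"
proof (rule ccontr)
  assume "\<not> poly3.dim W > 0"
  then have "fin_span W 0" using fin_span_dim[OF assms(1)] by simp
  then show False using assms by (auto simp: fin_span_def)
qed

text \<open>A vector outside the kernel of \<open>f\<close>, added to a spanning set of the kernel,
  spans the whole space.\<close>

lemma fin_span_step:
  assumes W: "poly3.subspace W" and add: "\<And>F G. f (F + G) = f F + f G"
    and sc: "\<And>c F. f (scale3 c F) = c * (f F :: complex)"
    and span: "fin_span {F\<in>W. f F = 0} n"
  shows "fin_span W (Suc n)"
proof (cases "\<forall>F\<in>W. f F = 0")
  case True
  then have "{F\<in>W. f F = 0} = W" by auto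
  then show ?thesis using span fin_span_mono[of W n "Suc n"] by simp
next
  case False
  then obtain G where G: "G \<in> W" "f G \<noteq> 0" by auto
  obtain B where B: "finite B" "card B \<le> n" "{F\<in>W. f F = 0} \<subseteq> poly3.span B"
    using span by (auto simp: fin_span_def)
  have "F \<in> poly3.span (insert G B)" if "F \<in> W" for F
  proof -
    define H where "H = F + scale3 (- (f F / f G)) G"
    have "H \<in> W" unfolding H_def using W that G by (intro poly3.subspace_add poly3.subspace_scale)
    moreover have "f H = 0" unfolding H_def by (simp only: add sc) (use G in simp)
    ultimately have "H \<in> poly3.span B" using B by auto
    then have "H \<in> poly3.span (insert G B)" using poly3.span_mono[of B "insert G B"] by auto
    moreover have "G \<in> poly3.span (insert G B)" by (simp add: poly3.span_base)
    ultimately have "H + scale3 (f F / f G) G \<in> poly3.span (insert G B)"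
      by (intro poly3.span_add poly3.span_scale)
    then show ?thesis by (simp add: H_def)
  qed
  then show ?thesis using B
    unfolding fin_span_def by (intro exI[of _ "insert G B"]) (auto simp: card_insert_if)
qed

text \<open>All dimension counts use this bound; the functionals are values at points or
  coefficients of monomials.\<close>

lemma fin_span_functionals:
  assumes "finite K" and W: "poly3.subspace W" and add: "\<And>k F G. f k (F + G) = f k F + f k G"
    and sc: "\<And>k c F. f k (scale3 c F) = c * (f k F :: complex)"
    and span: "fin_span {F\<in>W. \<forall>k\<in>K. f k F = 0} n"
  shows "fin_span W (n + card K)"
  using assms(1) span
proof (induction K arbitrary: n rule: finite_induct)
  case (insert k K)
  have f0: "f k 0 = 0" for k using sc[of k 0 0] by simp
  have "poly3.subspace {F\<in>W. \<forall>k\<in>K. f k F = 0}"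
    using W by (auto simp: poly3.subspace_def add sc f0)
  moreover have "{F \<in> {F\<in>W. \<forall>k\<in>K. f k F = 0}. f k F = 0} = {F\<in>W. \<forall>k\<in>insert k K. f k F = 0}"
    by auto
  ultimately have "fin_span {F\<in>W. \<forall>k\<in>K. f k F = 0} (Suc n)"
    using fin_span_step[of "{F\<in>W. \<forall>k\<in>K. f k F = 0}" "f k" n] add sc insert.prems by metis
  then show ?case using insert by fastforce
qed simp

lemma fin_span_zero: "W \<subseteq> {0} \<Longrightarrow> fin_span W n"
  unfolding fin_span_def by (intro exI[of _ "{}"]) auto

definition monos5 :: "(nat \<times> nat) set" where
  "monos5 = (SIGMA k:{..5}. {..5-k})"

lemma card_monos5: "card monos5 = 21"
  by (simp add: monos5_def card_SigmaI eval_nat_numeral)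

lemma fin_span_homogeneous5: "fin_span {F. homogeneous 5 F} 21"
proof -
  let ?f = "\<lambda>(k,i) F. cf F i (5 - k - i) k"
  have "finite monos5" by (simp add: monos5_def)
  have "{F \<in> {F. homogeneous 5 F}. \<forall>k\<in>monos5. ?f k F = 0} \<subseteq> {0}"
    by (auto simp: monos5_def intro!: homogeneous_eq_zero[of 5])
  then have "fin_span {F \<in> {F. homogeneous 5 F}. \<forall>k\<in>monos5. ?f k F = 0} 0" by (rule fin_span_zero)
  from fin_span_functionals[OF \<open>finite monos5\<close> subspace_homogeneous _ _ this] show ?thesis
    by (simp add: card_monos5 case_prod_beta cf_def lookup_add lookup_scale3)
qed

text \<open>The 21 monomials are independent. In this form the bound applies to a spanning set
  obtained by adding one vector per point condition.\<close>

lemma fin_span_homogeneous5_ge: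
  assumes "fin_span {F. homogeneous 5 F} n"
  shows "21 \<le> n"
proof -
  let ?m = "\<lambda>(k,i). mono3 i (5 - k - i) k"
  let ?S = "(\<lambda>m. Poly_Mapping.single m (1::complex)) ` ?m ` monos5"
  have "inj_on ?m monos5"
  proof (rule inj_onI)
    fix a b assume "?m a = ?m b"
    then have "mono3 (snd a) (5 - fst a - snd a) (fst a) = mono3 (snd b) (5 - fst b - snd b) (fst b)"
      by (simp add: case_prod_beta)
    then show "a = b" by (metis lookup_mono3(1,3) prod.expand)
  qed
  then have card: "card (?m ` monos5) = 21" by (simp add: card_image card_monos5)
  have inj: "inj (\<lambda>m::mono3. Poly_Mapping.single m (1::complex))"
    by (rule injI) (metis keys_single singleton_inject one_neq_zero)
  then have cardS: "card ?S = 21" by (subst card_image[OF inj_on_subset[OF inj subset_UNIV]]) (rule card)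
  have "finite monos5" by (simp add: monos5_def)
  then have fin: "finite ?S" by simp
  have indep: "poly3.independent ?S"
  proof
    assume "poly3.dependent ?S"
    then obtain u w where u: "w \<in> ?S" "u w \<noteq> 0" "(\<Sum>v\<in>?S. scale3 (u v) v) = 0"
      unfolding poly3.dependent_finite[OF fin] by blast
    then obtain m where m: "w = Poly_Mapping.single m 1" by auto
    have "0 = Poly_Mapping.lookup (\<Sum>v\<in>?S. scale3 (u v) v) m" using u(3) by simp
    also have "\<dots> = (\<Sum>v\<in>?S. if v = w then u w else 0)"
      unfolding lookup_sum
    proof (intro sum.cong refl)
      fix v assume "v \<in> ?S"
      then obtain m' where "v = Poly_Mapping.single m' 1" by auto
      then show "Poly_Mapping.lookup (scale3 (u v) v) m = (if v = w then u w else 0)"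
        using injD[OF inj, of m' m] m by (auto simp: lookup_scale3 lookup_single when_def)
    qed
    also have "\<dots> = u w" using u(1) fin by simp
    finally show False using u(2) by simp
  qed
  have hom: "?S \<subseteq> {F. homogeneous 5 F}"
    by (auto simp: homogeneous_def sum_3 monos5_def)
  obtain B where B: "finite B" "card B \<le> n" "{F. homogeneous 5 F} \<subseteq> poly3.span B"
    using assms by (auto simp: fin_span_def)
  then have "card ?S \<le> card B"
    using poly3.independent_span_bound[OF B(1) indep] hom by blast
  then show ?thesis using B cardS by simp
qed

section \<open>Uniqueness and the lower bound\<close>

text \<open>A fixed choice of coordinates makes vanishing at a point a single linear functional on
  forms.\<close>

definition rep :: "proj_plane \<Rightarrow> complex ^ 3" where
  "rep p = (SOME v. v \<noteq> 0 \<and> p = pt v)"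

lemma rep_nonzero: "rep p \<noteq> 0" and pt_rep: "pt (rep p) = p"
proof -
  have "\<exists>v. v \<noteq> 0 \<and> p = pt v" by (metis pt_exhaust)
  from someI_ex[OF this] show "rep p \<noteq> 0" "pt (rep p) = p" by (auto simp: rep_def)
qed

lemma vanishes_at_rep: "homogeneous d F \<Longrightarrow> vanishes_at F p \<longleftrightarrow> eval3 (rep p) F = 0"
  using vanishes_at_pt[of d F "rep p"] by (simp add: rep_nonzero pt_rep)

definition vanish_on :: "complex \<Rightarrow> complex \<Rightarrow> complex poly \<Rightarrow> complex poly \<Rightarrow> proj_plane set \<Rightarrow> bool" where
  "vanish_on s t a b Z \<longleftrightarrow> (\<forall>p\<in>Z. quintic s t a b (rep p) = 0)"

text \<open>(\<open>dx\<close> : \<open>dy\<close>) is the direction of the line from (s : t : 1) to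
  \<open>p\<close>, that is, the projection of \<open>p\<close> from the fat point.\<close>

abbreviation dx :: "complex \<Rightarrow> proj_plane \<Rightarrow> complex" where
  "dx s p \<equiv> rep p $ 1 - s * rep p $ 3"

abbreviation dy :: "complex \<Rightarrow> proj_plane \<Rightarrow> complex" where
  "dy t p \<equiv> rep p $ 2 - t * rep p $ 3"

text \<open>Projection from (s : t : 1) separates the points of \<open>Z\<close>: no two of them are
  collinear with it.\<close>

definition general_position :: "complex \<Rightarrow> complex \<Rightarrow> proj_plane set \<Rightarrow> bool" where
  "general_position s t Z \<longleftrightarrow> (\<forall>p\<in>Z. \<forall>p'\<in>Z. p \<noteq> p' \<longrightarrow> dx s p * dy t p' \<noteq> dx s p' * dy t p)"

lemma general_position_subset: "general_position s t Z \<Longrightarrow> Z' \<subseteq> Z \<Longrightarrow> general_position s t Z'"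
  by (auto simp: general_position_def)

lemma vanish_on_subset: "vanish_on s t a b Z \<Longrightarrow> Z' \<subseteq> Z \<Longrightarrow> vanish_on s t a b Z'"
  by (auto simp: vanish_on_def)

lemma pt_chart_inject: "pt (chart s t) = pt (chart s' t') \<longleftrightarrow> s = s' \<and> t = t'"
proof
  assume "pt (chart s t) = pt (chart s' t')"
  then obtain c where "chart s' t' = c *s chart s t" by (rule pt_eqD) auto
  then show "s = s' \<and> t = t'" by (simp add: vec3_eq_iff)
qed simp

text \<open>The centre has to avoid the finitely many lines joining two points of \<open>Z\<close>;
  the cross product of the two points is the equation of such a line.\<close>

lemma for_generic_general_position:
  assumes "finite Z"
  shows "for_generic (\<lambda>q. \<forall>s t. q = pt (chart s t) \<longrightarrow> general_position s t Z)"
proof -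
  have "for_generic (\<lambda>q. \<forall>s t. q = pt (chart s t) \<longrightarrow> dx s p * dy t p' \<noteq> dx s p' * dy t p)"
    if "p \<noteq> p'" for p p'
  proof -
    let ?c = "cross (rep p) (rep p')"
    let ?F = "Const (?c $ 1) * Var 1 + Const (?c $ 2) * Var 2 + Const (?c $ 3) * Var 3"
    have h: "homogeneous 1 ?F"
      by (intro homogeneous_add homogeneous_Const_mult homogeneous_Var)
    have c0: "?c \<noteq> 0" using cross_eq_0_imp_pt_eq[of "rep p" "rep p'"] rep_nonzero that by (auto simp: pt_rep)
    have ev: "eval3 (chart s t) ?F = dx s p * dy t p' - dx s p' * dy t p" for s t
      by (simp add: cross_def algebra_simps)
    have "\<exists>s t. eval3 (chart s t) ?F \<noteq> 0"
    proof (rule ccontr)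
      assume "\<not> ?thesis"
      then have "?c $ 1 * s + ?c $ 2 * t + ?c $ 3 = 0" for s t by simp
      from this[of 0 0] this[of 1 0] this[of 0 1] have "?c = 0" by (simp add: vec3_eq_iff)
      then show False using c0 by simp
    qed
    then obtain s t where st: "eval3 (chart s t) ?F \<noteq> 0" by blast
    have "dx s p * dy t p' \<noteq> dx s p' * dy t p" if "eval3 (chart s t) ?F \<noteq> 0" for s t
      using that unfolding ev by simp
    then show ?thesis unfolding for_generic_chart_iff pt_chart_inject
      by (intro exI[of _ 1] exI[of _ ?F] exI[of _ s] exI[of _ t] conjI h st) blast
  qed
  then have "for_generic (\<lambda>q. \<forall>(p,p')\<in>Z \<times> Z - Id. \<forall>s t. q = pt (chart s t) \<longrightarrow> dx s p * dy t p' \<noteq> dx s p' * dy t p)"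
    using assms by (intro for_generic_ball) auto
  then show ?thesis
    by (rule for_generic_mono) (unfold general_position_def, blast)
qed

lemma direction_nonzero:
  assumes "general_position s t Z" "p \<in> Z" "card Z \<ge> 2"
  shows "(dx s p, dy t p) \<noteq> (0, 0)"
proof
  assume z: "(dx s p, dy t p) = (0, 0)"
  have "Z \<noteq> {p}" using assms(3) by auto
  then obtain p' where "p' \<in> Z" "p' \<noteq> p" using assms(2) by auto
  then show False using assms(1,2) z unfolding general_position_def by (metis mult_zero_left mult_zero_right prod.inject)
qed

text \<open>This dictionary turns quintics with the fat point into pairs of binary forms with 5 + 6
  coefficients and one linear condition per point of \<open>Z\<close>.\<close>

lemma mem_fat_iff:
  "F \<in> forms_through_fat 5 Z 4 (pt (chart s t)) \<longleftrightarrow>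
    (\<exists>a b. degree a \<le> 4 \<and> degree b \<le> 5 \<and> F = quintic3 s t a b \<and> vanish_on s t a b Z)"
proof
  assume F: "F \<in> forms_through_fat 5 Z 4 (pt (chart s t))"
  then have h: "homogeneous 5 F" "vanishes_to_order 4 F (pt (chart s t))" and v: "\<forall>p\<in>Z. vanishes_at F p"
    by (auto simp: forms_through_fat_def forms_through_def)
  obtain a b where ab: "degree a \<le> 4" "degree b \<le> 5" "\<And>v. eval3 v F = quintic s t a b v"
    using quintic_of_form[OF h] by blast
  have "F = quintic3 s t a b" by (rule eval3_eqI) (simp add: ab eval3_quintic3)
  moreover have "vanish_on s t a b Z"
    using v vanishes_at_rep[OF h(1)] by (simp add: vanish_on_def ab)
  ultimately show "\<exists>a b. degree a \<le> 4 \<and> degree b \<le> 5 \<and> F = quintic3 s t a b \<and> vanish_on s t a b Z"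
    using ab by blast
next
  assume "\<exists>a b. degree a \<le> 4 \<and> degree b \<le> 5 \<and> F = quintic3 s t a b \<and> vanish_on s t a b Z"
  then obtain a b where "F = quintic3 s t a b" "vanish_on s t a b Z" by blast
  then show "F \<in> forms_through_fat 5 Z 4 (pt (chart s t))"
    using vanishes_at_rep[OF homogeneous_quintic3, of s t a b]
    by (auto simp: forms_through_fat_def forms_through_def homogeneous_quintic3
        vanishes_to_order_quintic3 vanish_on_def eval3_quintic3)
qed

lemma quintic3_smult: "quintic3 s t (smult c a) (smult c b) = scale3 c (quintic3 s t a b)"
  by (rule eval3_eqI) (simp add: eval3_quintic3 quintic_def hev_smult algebra_simps)

lemma quintics_proportional:
  assumes Z: "finite Z" "card Z \<ge> 10" "general_position s t Z"
    and ab: "degree a \<le> 4" "degree b \<le> 5" "no_common_zero a b" "vanish_on s t a b Z"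
    and ab': "degree a' \<le> 4" "degree b' \<le> 5" "vanish_on s t a' b' Z"
  obtains c where "a' = smult c a" "b' = smult c b"
proof -
  have d: "degree (a * b') \<le> 9" "degree (a' * b) \<le> 9"
    using degree_mult_le[of a b'] degree_mult_le[of a' b] ab ab' by linarith+
  have "a * b' - a' * b = 0"
  proof (rule hev_eq_0_imp_eq_0[of _ 9 Z "dx s" "dy t"])
    show "degree (a * b' - a' * b) \<le> 9" using d by (rule degree_diff_le)
    show "hev 9 (a * b' - a' * b) (dx s p) (dy t p) = 0" if "p \<in> Z" for p
    proof -
      \<comment> \<open>At a point of \<open>Z\<close> both pairs satisfy b = - z a with the same z,
        so their determinant vanishes there.\<close>
      have q: "hev 5 b (dx s p) (dy t p) = - (rep p $ 3 * hev 4 a (dx s p) (dy t p))"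
        "hev 5 b' (dx s p) (dy t p) = - (rep p $ 3 * hev 4 a' (dx s p) (dy t p))"
        using ab(4) ab'(3) that by (simp_all add: vanish_on_def quintic_def eq_neg_iff_add_eq_0 add.commute)
      have "hev (4 + 5) (a * b') (dx s p) (dy t p) = hev (4 + 5) (a' * b) (dx s p) (dy t p)"
        using ab ab' by (simp only: hev_mult q) simp
      then show ?thesis by (simp add: hev_diff)
    qed
    show "dx s p * dy t p' \<noteq> dx s p' * dy t p" if "p \<in> Z" "p' \<in> Z" "p \<noteq> p'" for p p'
      using Z(3) that by (auto simp: general_position_def)
  qed (use Z in auto)
  then have "a * b' = a' * b" by simp
  from no_common_zero_proportional[OF ab(1,2,3) ab'(1,2) this] that show ?thesis by blast
qed

lemma fat_proportional:
  assumes Z: "finite Z" "card Z \<ge> 10" "general_position s t Z"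
    and ab: "degree a \<le> 4" "degree b \<le> 5" "no_common_zero a b" "vanish_on s t a b Z"
    and F: "F \<in> forms_through_fat 5 Z 4 (pt (chart s t))"
  obtains c where "F = scale3 c (quintic3 s t a b)"
proof -
  obtain a' b' where "degree a' \<le> 4" "degree b' \<le> 5" "F = quintic3 s t a' b'" "vanish_on s t a' b' Z"
    using F mem_fat_iff by blast
  with quintics_proportional[OF Z ab] show ?thesis using that quintic3_smult by metis
qed

lemma irreducible_memD:
  assumes "F \<in> forms_through_fat 5 Z 4 (pt (chart s t))" "irreducible F"
  obtains a b where "degree a \<le> 4" "degree b \<le> 5" "no_common_zero a b" "vanish_on s t a b Z" "F = quintic3 s t a b"
  using assms irreducible_quintic3_imp_no_common_zero unfolding mem_fat_iff by metis

section \<open>At least eleven points\<close>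

lemma infinite_proj_plane: "infinite (UNIV :: proj_plane set)"
proof
  assume "finite (UNIV :: proj_plane set)"
  then have "finite (range (\<lambda>s. pt (chart s 0)))" by (rule rev_finite_subset) simp
  moreover have "inj (\<lambda>s. pt (chart s 0))" by (auto simp: inj_on_def pt_chart_inject)
  ultimately show False using infinite_UNIV_char_0 finite_imageD by blast
qed

lemma forms_through_split:
  "forms_through j (Z \<union> E) = {F \<in> forms_through j Z. \<forall>p\<in>E. eval3 (rep p) F = 0}"
  by (auto simp: forms_through_def vanishes_at_rep)

lemma forms_through_fat_split:
  "forms_through_fat j (Z \<union> E) m q = {F \<in> forms_through_fat j Z m q. \<forall>p\<in>E. eval3 (rep p) F = 0}"
  by (auto simp: forms_through_def forms_through_fat_def vanishes_at_rep)

lemma fin_span_forms_through: "fin_span (forms_through 5 Z) 21"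
  by (rule fin_span_subset[OF fin_span_homogeneous5]) (auto simp: forms_through_def)

lemma fin_span_forms_through_fat: "fin_span (forms_through_fat 5 Z m q) 21"
  by (rule fin_span_subset[OF fin_span_forms_through[of Z]]) (auto simp: forms_through_fat_def)

lemma dim_forms_through_ge:
  assumes "finite Z"
  shows "21 \<le> poly3.dim (forms_through 5 Z) + card Z"
proof -
  have "{F \<in> {F. homogeneous 5 F}. \<forall>p\<in>Z. eval3 (rep p) F = 0} = forms_through 5 Z"
    by (auto simp: forms_through_def vanishes_at_rep)
  then have "fin_span {F \<in> {F. homogeneous 5 F}. \<forall>p\<in>Z. eval3 (rep p) F = 0} (poly3.dim (forms_through 5 Z))"
    using fin_span_dim[OF fin_span_forms_through] by simp
  from fin_span_functionals[OF assms subspace_homogeneous _ _ this]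
  show ?thesis by (intro fin_span_homogeneous5_ge) simp
qed

text \<open>Extra points \<open>E\<close> fill \<open>Z\<close> up to ten, where uniqueness holds.
  Dropping them again bounds the space for \<open>Z\<close> by 1 + (10 - |Z|), while unexpectedness
  demands more than (21 - |Z|) - 10, the same number.\<close>

lemma card_ge_11:
  assumes fin: "finite Z" and adm: "admits_unexpected_irreducible_quintics Z"
  shows "card Z \<ge> 11"
proof (rule ccontr)
  assume "\<not> card Z \<ge> 11"
  then have le: "card Z \<le> 10" by simp
  have "infinite (UNIV - Z)" using infinite_proj_plane fin by (rule Diff_infinite_finite[rotated])
  then obtain E where E: "finite E" "card E = 10 - card Z" "E \<subseteq> UNIV - Z"
    using infinite_arbitrarily_large by metis
  have disj: "Z \<inter> E = {}" using E by auto
  have card: "card (Z \<union> E) = 10" using card_Un_disjoint[OF fin E(1) disj] E(2) le by simp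
  let ?n = "poly3.dim (forms_through 5 Z)"
  have gens: "for_generic (\<lambda>q. int (poly3.dim (forms_through_fat 5 Z 4 q)) > max 0 (int ?n - 10))"
    "for_generic (\<lambda>q. \<forall>F \<in> forms_through_fat 5 Z 4 q. F \<noteq> 0 \<longrightarrow> irreducible F)"
    using adm by (auto simp: admits_unexpected_irreducible_quintics_def admits_unexpected_curves_def choose_two)
  from for_generic_conj[OF for_generic_conj[OF gens] for_generic_general_position[of "Z \<union> E"]]
  have "for_generic (\<lambda>q. ((int (poly3.dim (forms_through_fat 5 Z 4 q)) > max 0 (int ?n - 10)) \<and>
      (\<forall>F \<in> forms_through_fat 5 Z 4 q. F \<noteq> 0 \<longrightarrow> irreducible F)) \<and>
      (\<forall>s t. q = pt (chart s t) \<longrightarrow> general_position s t (Z \<union> E)))"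
    using fin E(1) by blast
  from for_generic_ex_chart[OF this]
  obtain s t where st: "int (poly3.dim (forms_through_fat 5 Z 4 (pt (chart s t)))) > max 0 (int ?n - 10)"
    "\<And>F. F \<in> forms_through_fat 5 Z 4 (pt (chart s t)) \<Longrightarrow> F \<noteq> 0 \<Longrightarrow> irreducible F"
    "general_position s t (Z \<union> E)"
    by blast
  let ?V = "forms_through_fat 5 Z 4 (pt (chart s t))"
  let ?W = "forms_through_fat 5 (Z \<union> E) 4 (pt (chart s t))"
  have "fin_span ?W 1"
  proof (cases "?W \<subseteq> {0}")
    case False
    then obtain F where F: "F \<in> ?W" "F \<noteq> 0" by auto
    then have "F \<in> ?V" by (simp add: forms_through_fat_split)
    then have "irreducible F" using st(2) F by blast
    with F(1) obtain a b where ab: "degree a \<le> 4" "degree b \<le> 5" "no_common_zero a b"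
      "vanish_on s t a b (Z \<union> E)" "F = quintic3 s t a b" by (rule irreducible_memD)
    have "?W \<subseteq> poly3.span {F}"
    proof
      fix G assume "G \<in> ?W"
      then obtain c where "G = scale3 c F"
        using fat_proportional[OF _ _ st(3) ab(1-4)] fin E(1) card unfolding ab(5) by (metis finite_UnI order_refl)
      then show "G \<in> poly3.span {F}" by (simp add: poly3.span_base poly3.span_scale)
    qed
    then show ?thesis unfolding fin_span_def by (intro exI[of _ "{F}"]) auto
  qed (rule fin_span_zero)
  then have "fin_span ?V (1 + card E)"
    unfolding forms_through_fat_split
    by (intro fin_span_functionals E subspace_forms_through_fat) simp_all
  then have "poly3.dim ?V \<le> 1 + card E" by (rule fin_span_dim_le)
  then show False using st(1) dim_forms_through_ge[OF fin] E(2) le by linarith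
qed

section \<open>First-order deformations of a kernel\<close>

text \<open>With kernel vectors \<open>c h\<close> of \<open>M h\<close>, the vectors \<open>((M h - M 0) / h) c h = M 0 (- c h / h)\<close>
  lie in the range of \<open>M 0\<close>, which is closed, so their limit \<open>D c0\<close> does too.\<close>

lemma kernel_first_order:
  fixes M :: "complex \<Rightarrow> complex ^ 'm ^ 'n" and D :: "complex ^ 'm ^ 'n"
  assumes deriv: "\<And>i j. ((\<lambda>h. M h $ i $ j) has_field_derivative D $ i $ j) (at 0)"
    and h: "\<And>n. h n \<noteq> 0" "h \<longlonglongrightarrow> 0"
    and ker: "\<And>n. \<exists>c. c \<noteq> 0 \<and> M (h n) *v c = 0"
  obtains c0 c1 where "c0 \<noteq> 0" "M 0 *v c0 = 0" "M 0 *v c1 + D *v c0 = 0"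
proof -
  \<comment> \<open>Normalizing first keeps the limit vector different from 0.\<close>
  have "\<exists>c. norm c = 1 \<and> M (h n) *v c = 0" for n
  proof -
    obtain c where c: "c \<noteq> 0" "M (h n) *v c = 0" using ker by blast
    have "M (h n) *v (complex_of_real (1 / norm c) *s c) = complex_of_real (1 / norm c) *s (M (h n) *v c)"
      by (simp add: vector_scalar_commute)
    then have "M (h n) *v (complex_of_real (1 / norm c) *s c) = 0" using c by simp
    moreover have "complex_of_real (1 / norm c) *s c = (1 / norm c) *\<^sub>R c"
      unfolding vec_eq_iff vector_scaleR_component vector_smult_component
      by (intro allI scaleR_conv_of_real[symmetric])
    then have "norm (complex_of_real (1 / norm c) *s c) = 1" using c(1) by simp
    ultimately show ?thesis by blast
  qed
  then obtain c where c: "\<And>n. norm (c n) = 1" "\<And>n. M (h n) *v c n = 0" by metis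
  have "compact (sphere (0 :: complex ^ 'm) 1)" by simp
  then obtain c0 r where r: "c0 \<in> sphere 0 1" "strict_mono r" "(c \<circ> r) \<longlonglongrightarrow> c0"
    unfolding compact_def using c(1) by (metis mem_sphere_0)
  have hr: "(\<lambda>n. h (r n)) \<longlonglongrightarrow> 0"
    using LIMSEQ_subseq_LIMSEQ[OF h(2) r(2)] by (simp add: o_def)
  define Q where "Q n = (\<chi> i j. (M (h (r n)) $ i $ j - M 0 $ i $ j) / h (r n))" for n
  have Q: "(\<lambda>n. Q n $ i $ j) \<longlonglongrightarrow> D $ i $ j" for i j
  proof -
    have "((\<lambda>y. (M y $ i $ j - M 0 $ i $ j) / (y - 0)) \<longlongrightarrow> D $ i $ j) (at 0)"
      using deriv[of i j] by (simp add: has_field_derivative_iff)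
    moreover have "filterlim (\<lambda>n. h (r n)) (at 0) sequentially"
      using hr h(1) by (simp add: filterlim_at)
    ultimately show ?thesis unfolding Q_def by (auto dest: filterlim_compose)
  qed
  have lim: "(\<lambda>n. A n *v c (r n)) \<longlonglongrightarrow> A0 *v c0" if "\<And>i j. (\<lambda>n. A n $ i $ j) \<longlonglongrightarrow> A0 $ i $ j"
    for A :: "nat \<Rightarrow> complex ^ 'm ^ 'n" and A0
  proof (rule vec_tendstoI)
    fix i
    have "(\<lambda>n. c (r n) $ j) \<longlonglongrightarrow> c0 $ j" for j
      using tendsto_vec_nth[OF r(3)] by (simp add: o_def)
    then show "(\<lambda>n. (A n *v c (r n)) $ i) \<longlonglongrightarrow> (A0 *v c0) $ i"
      by (auto simp: matrix_vector_mult_def intro!: tendsto_sum tendsto_mult that)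
  qed
  \<comment> \<open>As \<open>M (h (r n))\<close> annihilates the vector, only the difference of the
    two matrices acts.\<close>
  have MQ: "M 0 *v c (r n) = - (h (r n) *s (Q n *v c (r n)))" for n
  proof -
    have "M 0 = M (h (r n)) - (\<chi> i j. h (r n) * Q n $ i $ j)"
      using h(1) by (simp add: Q_def vec_eq_iff)
    then have "M 0 *v c (r n) = M (h (r n)) *v c (r n) - (\<chi> i j. h (r n) * Q n $ i $ j) *v c (r n)"
      by (metis matrix_vector_mult_diff_rdistrib)
    also have "(\<chi> i j. h (r n) * Q n $ i $ j) *v c (r n) = h (r n) *s (Q n *v c (r n))"
      by (simp add: matrix_vector_mult_def vec_eq_iff sum_distrib_left mult.assoc)
    finally show ?thesis using c(2) by simp
  qed
  have Qr: "Q n *v c (r n) \<in> range ((*v) (M 0))" for n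
  proof -
    have "M 0 *v ((- 1 / h (r n)) *s c (r n)) = (- 1 / h (r n)) *s (M 0 *v c (r n))"
      by (rule vector_scalar_commute)
    also have "\<dots> = Q n *v c (r n)" using h(1)[of "r n"] by (simp add: MQ vec_eq_iff)
    finally show ?thesis by (metis rangeI)
  qed
  have "linear ((*v) (M 0))"
  proof (rule linearI)
    show "M 0 *v (a *\<^sub>R x) = a *\<^sub>R (M 0 *v x)" for a x
      by (simp add: matrix_vector_mult_def vec_eq_iff scaleR_sum_right)
  qed (simp add: matrix_vector_right_distrib)
  then have "subspace (range ((*v) (M 0)))" by (rule linear_subspace_image) simp
  then have "closed (range ((*v) (M 0)))" by (rule closed_subspace)
  then have "D *v c0 \<in> range ((*v) (M 0))"
    by (rule closed_sequentially[OF _ Qr lim[OF Q]])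
  then obtain c1 where c1: "D *v c0 = M 0 *v c1" by auto
  have "(\<lambda>n. M 0 *v c (r n)) \<longlonglongrightarrow> M 0 *v c0" by (rule lim) simp
  moreover have "(\<lambda>n. - (h (r n) *s (Q n *v c (r n)))) \<longlonglongrightarrow> 0"
  proof (rule vec_tendstoI)
    fix i
    have "(\<lambda>n. (Q n *v c (r n)) $ i) \<longlonglongrightarrow> (D *v c0) $ i" by (rule tendsto_vec_nth[OF lim[OF Q]])
    from tendsto_minus[OF tendsto_mult[OF hr this]]
    show "(\<lambda>n. (- (h (r n) *s (Q n *v c (r n)))) $ i) \<longlonglongrightarrow> (0 :: complex ^ 'n) $ i" by simp
  qed
  ultimately have "M 0 *v c0 = 0" unfolding MQ by (rule LIMSEQ_unique)
  moreover have "M 0 *v (- c1) + D *v c0 = 0"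
    using c1 by (simp add: matrix_vector_mult_def vec_eq_iff sum_negf)
  moreover have "c0 \<noteq> 0" using r(1) by auto
  ultimately show ?thesis using that by blast
qed

text \<open>The dehomogenization of the derivative in \<open>y\<close> of the form of degree \<open>n\<close> given by \<open>p\<close>,
  by Euler's relation.\<close>

definition dyp :: "nat \<Rightarrow> complex poly \<Rightarrow> complex poly" where
  "dyp n p = smult (of_nat n) p - pCons 0 (pderiv p)"

lemma coeff_dyp: "coeff (dyp n p) i = (of_nat n - of_nat i) * coeff p i"
  by (cases i) (simp_all add: dyp_def coeff_pderiv algebra_simps)

lemma degree_dyp: "degree p \<le> Suc n \<Longrightarrow> degree (dyp (Suc n) p) \<le> n"
proof (rule degree_le, intro allI impI)
  fix i assume d: "degree p \<le> Suc n" and "n < i"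
  then consider "i = Suc n" | "i > degree p" by linarith
  then show "coeff (dyp (Suc n) p) i = 0"
    by cases (simp_all add: coeff_dyp coeff_eq_0)
qed

lemma degree_pderiv_le: "degree p \<le> Suc n \<Longrightarrow> degree (pderiv p) \<le> n" for p :: "complex poly"
  by (simp add: degree_pderiv)

lemma hev_sum: "hev n (sum f A) x y = (\<Sum>a\<in>A. hev n (f a) x y)"
  by (induction A rule: infinite_finite_induct) (simp_all add: hev_add)

lemma hev_has_field_derivative:
  "((\<lambda>h. hev (Suc n) p (x + h * \<alpha>) (y + h * \<beta>)) has_field_derivative
     \<alpha> * hev n (pderiv p) x y + \<beta> * hev n (dyp (Suc n) p) x y) (at 0)"
proof -
  have "((\<lambda>h. hev (Suc n) p (x + h * \<alpha>) (y + h * \<beta>)) has_field_derivative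
      (\<Sum>i\<le>Suc n. coeff p i * (of_nat i * x ^ (i - 1) * \<alpha> * y ^ (Suc n - i)
        + x ^ i * (of_nat (Suc n - i) * y ^ (Suc n - i - 1) * \<beta>)))) (at 0)"
    unfolding hev_def
    by (rule DERIV_sum) (auto intro!: derivative_eq_intros)
  also have "(\<Sum>i\<le>Suc n. coeff p i * (of_nat i * x ^ (i - 1) * \<alpha> * y ^ (Suc n - i)
        + x ^ i * (of_nat (Suc n - i) * y ^ (Suc n - i - 1) * \<beta>))) =
      \<alpha> * (\<Sum>i\<le>Suc n. of_nat i * coeff p i * x ^ (i - 1) * y ^ (Suc n - i))
      + \<beta> * (\<Sum>i\<le>Suc n. of_nat (Suc n - i) * coeff p i * x ^ i * y ^ (Suc n - i - 1))"
    unfolding sum_distrib_left sum.distrib[symmetric] by (intro sum.cong) (auto simp: algebra_simps)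
  also have "(\<Sum>i\<le>Suc n. of_nat i * coeff p i * x ^ (i - 1) * y ^ (Suc n - i)) = hev n (pderiv p) x y"
    by (subst sum.atMost_Suc_shift) (simp add: hev_def coeff_pderiv mult.assoc)
  also have "(\<Sum>i\<le>Suc n. of_nat (Suc n - i) * coeff p i * x ^ i * y ^ (Suc n - i - 1)) = hev n (dyp (Suc n) p) x y"
  proof -
    have "of_nat (Suc n - i) * coeff p i * x ^ i * y ^ (Suc n - i - 1) = coeff (dyp (Suc n) p) i * (x ^ i * y ^ (n - i))"
      if "i \<le> n" for i
      using that by (simp add: coeff_dyp of_nat_diff)
    then have "(\<Sum>i\<le>n. of_nat (Suc n - i) * coeff p i * x ^ i * y ^ (Suc n - i - 1)) = hev n (dyp (Suc n) p) x y"
      unfolding hev_def by (intro sum.cong) auto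
    then show ?thesis by simp
  qed
  finally show ?thesis .
qed

text \<open>The derivative at h = 0 of the quintic centred at (s + h u : t + h w : 1) with
  \<open>a\<close> and \<open>b\<close> held fixed; moving the centre changes x by - h u z and y by
  - h w z.\<close>

definition quintic_deriv ::
  "complex \<Rightarrow> complex \<Rightarrow> complex \<Rightarrow> complex \<Rightarrow> complex poly \<Rightarrow> complex poly \<Rightarrow> complex ^ 3 \<Rightarrow> complex" where
  "quintic_deriv u w s t a b v = (let x = v $ 1 - s * v $ 3; y = v $ 2 - t * v $ 3; z = v $ 3 in
     - z * (u * (z * hev 3 (pderiv a) x y + hev 4 (pderiv b) x y)
       + w * (z * hev 3 (dyp 4 a) x y + hev 4 (dyp 5 b) x y)))"

lemma quintic_has_field_derivative:
  "((\<lambda>h. quintic (s + h * u) (t + h * w) a b v) has_field_derivative quintic_deriv u w s t a b v) (at 0)"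
proof -
  have "(\<lambda>h. quintic (s + h * u) (t + h * w) a b v) =
      (\<lambda>h. v $ 3 * hev 4 a ((v $ 1 - s * v $ 3) + h * (- u * v $ 3)) ((v $ 2 - t * v $ 3) + h * (- w * v $ 3))
        + hev 5 b ((v $ 1 - s * v $ 3) + h * (- u * v $ 3)) ((v $ 2 - t * v $ 3) + h * (- w * v $ 3)))"
    by (simp add: quintic_def algebra_simps)
  moreover have "hev 4 a ((v $ 1 - s * v $ 3) + h * (- u * v $ 3)) ((v $ 2 - t * v $ 3) + h * (- w * v $ 3)) =
      hev (Suc 3) a ((v $ 1 - s * v $ 3) + h * (- u * v $ 3)) ((v $ 2 - t * v $ 3) + h * (- w * v $ 3))"
      "hev 5 b ((v $ 1 - s * v $ 3) + h * (- u * v $ 3)) ((v $ 2 - t * v $ 3) + h * (- w * v $ 3)) =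
      hev (Suc 4) b ((v $ 1 - s * v $ 3) + h * (- u * v $ 3)) ((v $ 2 - t * v $ 3) + h * (- w * v $ 3))" for h
    by simp_all
  ultimately have eq: "(\<lambda>h. quintic (s + h * u) (t + h * w) a b v) =
      (\<lambda>h. v $ 3 * hev (Suc 3) a ((v $ 1 - s * v $ 3) + h * (- u * v $ 3)) ((v $ 2 - t * v $ 3) + h * (- w * v $ 3))
        + hev (Suc 4) b ((v $ 1 - s * v $ 3) + h * (- u * v $ 3)) ((v $ 2 - t * v $ 3) + h * (- w * v $ 3)))"
    by simp
  show ?thesis
    unfolding eq
    by (rule DERIV_cong[OF DERIV_add[OF DERIV_cmult[OF hev_has_field_derivative] hev_has_field_derivative]])
      (simp add: quintic_deriv_def Let_def algebra_simps)
qed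

lemma quintic_linear:
  assumes "finite J"
  shows "quintic s t (\<Sum>j\<in>J. smult (c j) (\<alpha> j)) (\<Sum>j\<in>J. smult (c j) (\<beta> j)) v = (\<Sum>j\<in>J. c j * quintic s t (\<alpha> j) (\<beta> j) v)"
  by (simp add: quintic_def hev_sum hev_smult sum_distrib_left sum.distrib algebra_simps)

text \<open>One equation for each of 13 points in 5 + 6 unknown coefficients: a 13 by 11 matrix with
  a kernel at every \<open>h n\<close>. The pair (a1, b1) takes the part of a derivative of (a, b),
  although no differentiable family is chosen.\<close>

lemma quintic_first_order:
  assumes Z: "finite Z" "card Z = 13" and h: "\<And>n. h n \<noteq> 0" "h \<longlonglongrightarrow> 0"
    and ker: "\<And>n. \<exists>a b. degree a \<le> 4 \<and> degree b \<le> 5 \<and> (a \<noteq> 0 \<or> b \<noteq> 0) \<and>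
      vanish_on (s + h n * u) (t + h n * w) a b Z"
  obtains a b a1 b1 where "degree a \<le> 4" "degree b \<le> 5" "a \<noteq> 0 \<or> b \<noteq> 0" "vanish_on s t a b Z"
    "degree a1 \<le> 4" "degree b1 \<le> 5"
    "\<And>p. p \<in> Z \<Longrightarrow> quintic s t a1 b1 (rep p) + quintic_deriv u w s t a b (rep p) = 0"
proof -
  \<comment> \<open>Matrices are indexed by types, so coefficients and points are numbered by types
    of sizes 11 and 13; numbers below 5 belong to \<open>a\<close>, the other six to
    \<open>b\<close>.\<close>
  obtain e :: "11 \<Rightarrow> nat" where e: "bij_betw e UNIV {..<11}"
    using bij_betw_iff_card[of "UNIV :: 11 set" "{..<11::nat}"] by auto
  obtain g :: "13 \<Rightarrow> proj_plane" where g: "bij_betw g UNIV Z"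
    using bij_betw_iff_card[of "UNIV :: 13 set" Z] Z by auto
  have gZ: "range g = Z" using g by (simp add: bij_betw_def)
  define \<alpha> \<beta> :: "11 \<Rightarrow> complex poly" where "\<alpha> j = (if e j < 5 then monom 1 (e j) else 0)"
    and "\<beta> j = (if e j < 5 then 0 else monom 1 (e j - 5))" for j
  define A B where "A c = (\<Sum>j\<in>UNIV. smult (c $ j) (\<alpha> j))" and "B c = (\<Sum>j\<in>UNIV. smult (c $ j) (\<beta> j))"
    for c :: "complex ^ 11"
  have e11: "e j < 11" for j using e by (auto simp: bij_betw_def)
  have coeffs: "coeff (A c) i = (if i < 5 then c $ inv e i else 0)"
    "coeff (B c) i = (if i < 6 then c $ inv e (i + 5) else 0)" for c i
  proof -
    have inv: "e j = i \<longleftrightarrow> j = inv e i" if "i < 11" for i j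
    proof -
      have "inj e" "i \<in> range e" using e that by (auto simp: bij_betw_def)
      then show ?thesis by (metis f_inv_into_f inv_f_f)
    qed
    have "coeff (A c) i = (\<Sum>j\<in>UNIV. if e j = i \<and> i < 5 then c $ j else 0)"
      unfolding A_def coeff_sum by (intro sum.cong) (auto simp: \<alpha>_def)
    also have "\<dots> = (if i < 5 then c $ inv e i else 0)"
      using inv[of i] by (cases "i < 5") auto
    finally show "coeff (A c) i = (if i < 5 then c $ inv e i else 0)" .
    have "coeff (B c) i = (\<Sum>j\<in>UNIV. if e j = i + 5 \<and> i < 6 then c $ j else 0)"
    proof (unfold B_def coeff_sum, intro sum.cong refl)
      fix j show "coeff (smult (c $ j) (\<beta> j)) i = (if e j = i + 5 \<and> i < 6 then c $ j else 0)"
        using e11[of j] by (auto simp: \<beta>_def)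
    qed
    also have "\<dots> = (if i < 6 then c $ inv e (i + 5) else 0)"
      using inv[of "i + 5"] by (cases "i < 6") auto
    finally show "coeff (B c) i = (if i < 6 then c $ inv e (i + 5) else 0)" .
  qed
  have inve: "inv e (e j) = j" for j using e by (simp add: bij_betw_def)
  have deg: "degree (A c) \<le> 4" "degree (B c) \<le> 5" for c
    by (rule degree_le, simp add: coeffs)+
  have nz: "A c \<noteq> 0 \<or> B c \<noteq> 0" if c: "c \<noteq> 0" for c
  proof -
    obtain j where j: "c $ j \<noteq> 0" using c by (metis vec_eq_iff zero_index)
    show ?thesis
    proof (cases "e j < 5")
      case True
      then have "coeff (A c) (e j) \<noteq> 0" using j inve by (simp add: coeffs)
      then show ?thesis by auto
    next
      case False
      then have "coeff (B c) (e j - 5) \<noteq> 0" using j inve e11[of j] by (simp add: coeffs)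
      then show ?thesis by auto
    qed
  qed
  have surj: "\<exists>c. A c = a \<and> B c = b" if "degree a \<le> 4" "degree b \<le> 5" for a b
  proof -
    define c where "c = (\<chi> j. if e j < 5 then coeff a (e j) else coeff b (e j - 5))"
    have "e (inv e i) = i" if "i < 11" for i
      using e that by (metis bij_betw_def f_inv_into_f lessThan_iff)
    then have "coeff (A c) i = coeff a i" "coeff (B c) i = coeff b i" for i
      using that by (auto simp: coeffs c_def coeff_eq_0)
    then show ?thesis by (intro exI[of _ c]) (simp add: poly_eq_iff)
  qed
  define M where "M k = (\<chi> i j. quintic (s + k * u) (t + k * w) (\<alpha> j) (\<beta> j) (rep (g i)))" for k
  define D where "D = (\<chi> i j. quintic_deriv u w s t (\<alpha> j) (\<beta> j) (rep (g i)))"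
  have M: "(M k *v c) $ i = quintic (s + k * u) (t + k * w) (A c) (B c) (rep (g i))" for k c i
    unfolding A_def B_def
    by (subst quintic_linear) (simp_all add: M_def matrix_vector_mult_def mult.commute)
  have D: "(D *v c) $ i = quintic_deriv u w s t (A c) (B c) (rep (g i))" for c i
  proof (rule DERIV_unique)
    have "((\<lambda>k. \<Sum>j\<in>UNIV. c $ j * quintic (s + k * u) (t + k * w) (\<alpha> j) (\<beta> j) (rep (g i)))
      has_field_derivative (\<Sum>j\<in>UNIV. c $ j * quintic_deriv u w s t (\<alpha> j) (\<beta> j) (rep (g i)))) (at 0)"
      by (intro DERIV_sum DERIV_cmult quintic_has_field_derivative)
    then show "((\<lambda>k. quintic (s + k * u) (t + k * w) (A c) (B c) (rep (g i))) has_field_derivative (D *v c) $ i) (at 0)"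
      by (simp add: A_def B_def quintic_linear D_def matrix_vector_mult_def mult.commute)
  qed (rule quintic_has_field_derivative)
  have kerM: "\<exists>c. c \<noteq> 0 \<and> M (h n) *v c = 0" for n
  proof -
    obtain a b where ab: "degree a \<le> 4" "degree b \<le> 5" "a \<noteq> 0 \<or> b \<noteq> 0"
      "vanish_on (s + h n * u) (t + h n * w) a b Z" using ker by blast
    obtain c where c: "A c = a" "B c = b" using surj ab by blast
    have "M (h n) *v c = 0"
      using ab(4) gZ by (auto simp: vec_eq_iff M c vanish_on_def)
    moreover have "c \<noteq> 0" using ab(3) c by (auto simp: A_def B_def)
    ultimately show ?thesis by blast
  qed
  have "((\<lambda>k. M k $ i $ j) has_field_derivative D $ i $ j) (at 0)" for i j
    by (simp add: M_def D_def quintic_has_field_derivative)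
  from kernel_first_order[OF this h kerM]
  obtain c0 c1 where c: "c0 \<noteq> 0" "M 0 *v c0 = 0" "M 0 *v c1 + D *v c0 = 0" by blast
  have v: "vanish_on s t (A c0) (B c0) Z"
    using c(2) gZ by (force simp: vec_eq_iff M vanish_on_def)
  have "quintic s t (A c1) (B c1) (rep p) + quintic_deriv u w s t (A c0) (B c0) (rep p) = 0" if p: "p \<in> Z" for p
  proof -
    obtain i where "p = g i" using p gZ by auto
    then show ?thesis using c(3) M[of 0 c1 i] D[of c0 i]
      by (metis add_0_right mult_zero_left vector_add_component zero_index)
  qed
  then show ?thesis using that[of "A c0" "B c0" "A c1" "B c1"] deg nz[OF c(1)] v by blast
qed

section \<open>At most twelve points\<close>

text \<open>(a1, b1) and (a2, b2) are the first-order changes of (a, b) as the centre moves along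
  \<open>s\<close> and along \<open>t\<close>.\<close>

lemma deformation_contradiction:
  assumes Z: "finite Z" "card Z = 13" "general_position s t Z"
    and ab: "degree a \<le> 4" "degree b \<le> 5" "no_common_zero a b" "vanish_on s t a b Z"
    and 1: "degree a1 \<le> 4" "degree b1 \<le> 5"
      "\<And>p. p \<in> Z \<Longrightarrow> quintic s t a1 b1 (rep p) + quintic_deriv 1 0 s t a b (rep p) = 0"
    and 2: "degree a2 \<le> 4" "degree b2 \<le> 5"
      "\<And>p. p \<in> Z \<Longrightarrow> quintic s t a2 b2 (rep p) + quintic_deriv 0 1 s t a b (rep p) = 0"
  shows False
proof -
  \<comment> \<open>The deformed equation at a point of \<open>Z\<close> after putting z = - b / a
    and multiplying by a^2.\<close>
  define P1 where "P1 = a * a * b1 - a * b * a1 - b * b * pderiv a + a * b * pderiv b"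
  define P2 where "P2 = a * a * b2 - a * b * a2 - b * b * dyp 4 a + a * b * dyp 5 b"
  \<comment> \<open>The single b^2 is 5 b^2 - 4 b^2, from Euler's relation for \<open>b\<close> and
    for \<open>a\<close>.\<close>
  define Q where "Q = b * b + a * (pCons 0 b1 + b2) - b * (pCons 0 a1 + a2)"
  have dm: "degree (p * q) \<le> m + n" if "degree p \<le> m" "degree q \<le> n" for p q :: "complex poly" and m n
    using degree_mult_le[of p q] that by linarith
  have dd: "degree (pderiv a) \<le> 3" "degree (pderiv b) \<le> 4" "degree (dyp 4 a) \<le> 3" "degree (dyp 5 b) \<le> 4"
    using degree_pderiv_le[of a 3] degree_pderiv_le[of b 4] degree_dyp[of a 3] degree_dyp[of b 4] ab by simp_all
  note d2 = dm[OF ab(1,1)] dm[OF ab(1,2)] dm[OF ab(2,2)]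
  have h13: "degree (a * a * B1 - a * b * A1 - b * b * A' + a * b * B') \<le> 13"
    "hev 13 (a * a * B1 - a * b * A1 - b * b * A' + a * b * B') x y =
      hev 4 a x y * hev 4 a x y * hev 5 B1 x y - hev 4 a x y * hev 5 b x y * hev 4 A1 x y
      - hev 5 b x y * hev 5 b x y * hev 3 A' x y + hev 4 a x y * hev 5 b x y * hev 4 B' x y"
    if "degree B1 \<le> 5" "degree A1 \<le> 4" "degree A' \<le> 3" "degree B' \<le> 4" for A1 B1 A' B' x y
  proof -
    note d3 = dm[OF d2(1) that(1)] dm[OF d2(2) that(2)] dm[OF d2(3) that(3)] dm[OF d2(2) that(4)]
    show "degree (a * a * B1 - a * b * A1 - b * b * A' + a * b * B') \<le> 13"
      using d3 by (intro degree_add_le degree_diff_le) simp_all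
    have "hev (4 + 4 + 5) (a * a * B1) x y = hev 4 a x y * hev 4 a x y * hev 5 B1 x y"
      "hev (4 + 5 + 4) (a * b * A1) x y = hev 4 a x y * hev 5 b x y * hev 4 A1 x y"
      "hev (5 + 5 + 3) (b * b * A') x y = hev 5 b x y * hev 5 b x y * hev 3 A' x y"
      "hev (4 + 5 + 4) (a * b * B') x y = hev 4 a x y * hev 5 b x y * hev 4 B' x y"
      using ab(1,2) d2 that by (simp_all only: hev_mult)
    then show "hev 13 (a * a * B1 - a * b * A1 - b * b * A' + a * b * B') x y =
      hev 4 a x y * hev 4 a x y * hev 5 B1 x y - hev 4 a x y * hev 5 b x y * hev 4 A1 x y
      - hev 5 b x y * hev 5 b x y * hev 3 A' x y + hev 4 a x y * hev 5 b x y * hev 4 B' x y"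
      by (simp add: hev_add hev_diff)
  qed
  note P1d = h13(1)[OF 1(2,1) dd(1,2), folded P1_def] and P2d = h13(1)[OF 2(2,1) dd(3,4), folded P2_def]
  have onZ: "hev 4 a (dx s p) (dy t p) \<noteq> 0" "hev 13 P1 (dx s p) (dy t p) = 0" "hev 13 P2 (dx s p) (dy t p) = 0"
    if p: "p \<in> Z" for p
  proof -
    let ?h = "\<lambda>n q. hev n q (dx s p) (dy t p)"
    let ?z = "rep p $ 3"
    have b: "?h 5 b = - (?z * ?h 4 a)"
      using ab(4) p by (simp add: vanish_on_def quintic_def eq_neg_iff_add_eq_0 add.commute)
    have "(dx s p, dy t p) \<noteq> (0, 0)" using direction_nonzero[OF Z(3) p] Z(2) by simp
    \<comment> \<open>If \<open>a\<close> vanished here, so would b = - z a.\<close>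
    then show "?h 4 a \<noteq> 0" using ab(3) b unfolding no_common_zero_def by force
    have b1: "?h 5 b1 = ?z * (?z * ?h 3 (pderiv a) + ?h 4 (pderiv b)) - ?z * ?h 4 a1"
      using 1(3)[OF p] by (simp add: quintic_def quintic_deriv_def Let_def algebra_simps)
    show "?h 13 P1 = 0"
      unfolding P1_def h13(2)[OF 1(2,1) dd(1,2)] b b1 by (simp add: algebra_simps)
    have b2: "?h 5 b2 = ?z * (?z * ?h 3 (dyp 4 a) + ?h 4 (dyp 5 b)) - ?z * ?h 4 a2"
      using 2(3)[OF p] by (simp add: quintic_def quintic_deriv_def Let_def algebra_simps)
    show "?h 13 P2 = 0"
      unfolding P2_def h13(2)[OF 2(2,1) dd(3,4)] b b2 by (simp add: algebra_simps)
  qed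
  have indep: "dx s p * dy t p' \<noteq> dx s p' * dy t p" if "p \<in> Z" "p' \<in> Z" "p \<noteq> p'" for p p'
    using Z(3) that by (auto simp: general_position_def)
  have aQ: "pCons 0 P1 + P2 = a * Q"
  proof -
    \<comment> \<open>The derivatives in y enter as 4 a - x a' and 5 b - x b', so those in x cancel;
      the multiples are written as sums to leave only ring operations.\<close>
    have id: "x * (a * a * b1 - a * b * a1 - b * b * a' + a * b * b') + (a * a * b2 - a * b * a2
        - b * b * ((a + a + a + a) - x * a') + a * b * ((b + b + b + b + b) - x * b')) =
        a * (b * b + a * (x * b1 + b2) - b * (x * a1 + a2))" for x a' b' :: "complex poly"
      by (simp add: algebra_simps)
    have x: "pCons 0 q = [:0, 1:] * q" for q :: "complex poly" by simp
    have four: "of_nat 4 = (1 + 1 + 1 + 1 :: complex)" and five: "of_nat 5 = (1 + 1 + 1 + 1 + 1 :: complex)" by simp_all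
    have smult_n: "smult (of_nat 4) p = p + p + p + p" "smult (of_nat 5) p = p + p + p + p + p" for p :: "complex poly"
      unfolding four five smult_add_left smult_1_left by (rule refl)+
    have dyps: "dyp 4 a = (a + a + a + a) - [:0, 1:] * pderiv a" "dyp 5 b = (b + b + b + b + b) - [:0, 1:] * pderiv b"
      by (simp_all only: dyp_def smult_n x[of "pderiv _"])
    show ?thesis
      unfolding P1_def P2_def Q_def dyps x[of "_ + _"] x[of a1] x[of b1] by (rule id)
  qed
  have dQ: "degree Q \<le> 10"
  proof -
    have "degree (pCons 0 b1 + b2) \<le> 6" "degree (pCons 0 a1 + a2) \<le> 5"
      using 1 2 by (intro degree_add_le; simp add: degree_pCons_eq_if)+
    from dm[OF ab(1) this(1)] dm[OF ab(2) this(2)] d2(3)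
    show ?thesis unfolding Q_def by (intro degree_add_le degree_diff_le) simp_all
  qed
  have "Q = 0"
  proof (rule hev_eq_0_imp_eq_0[OF dQ Z(1) _ _ indep])
    fix p assume p: "p \<in> Z"
    have "hev 14 (pCons 0 P1 + P2) (dx s p) (dy t p) = 0"
      using onZ[OF p] hev_pCons_0[OF P1d] hev_Suc[OF P2d] by (simp add: hev_add)
    moreover have "hev (4 + 10) (a * Q) (dx s p) (dy t p) = hev 4 a (dx s p) (dy t p) * hev 10 Q (dx s p) (dy t p)"
      by (rule hev_mult[OF ab(1) dQ])
    ultimately show "hev 10 Q (dx s p) (dy t p) = 0" using onZ(1)[OF p] aQ by simp
  qed (use Z in auto)
  then have P2: "P2 = - pCons 0 P1" using aQ by (simp add: eq_neg_iff_add_eq_0 add.commute del: minus_pCons)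
  \<comment> \<open>As a form \<open>P1\<close> is y E; at y = 1 the form E is \<open>P1\<close>
    itself, in formal degree 12.\<close>
  have d12: "degree P1 \<le> 12"
    using P2d unfolding P2 by (cases "P1 = 0") (auto simp: degree_pCons_eq)
  have "P1 = 0"
  proof (rule hev_eq_0_imp_eq_0[OF d12 Z(1) _ _ indep])
    fix p assume p: "p \<in> Z"
    have "hev 13 P1 (dx s p) (dy t p) = dy t p * hev 12 P1 (dx s p) (dy t p)"
      "hev 13 P2 (dx s p) (dy t p) = - (dx s p * hev 12 P1 (dx s p) (dy t p))"
      using hev_Suc[OF d12] hev_pCons_0[OF d12] by (simp_all add: P2 hev_minus del: minus_pCons)
    moreover have "(dx s p, dy t p) \<noteq> (0, 0)" using direction_nonzero[OF Z(3) p] Z(2) by simp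
    ultimately show "hev 12 P1 (dx s p) (dy t p) = 0" using onZ[OF p] by auto
  qed (use Z in auto)
  then have "P2 = 0" using P2 by simp
  have cop: "coprime a (b * b)" using no_common_zero_coprime[OF ab(1-3)] by simp
  have "b * b * pderiv a = a * (a * b1 - b * a1 + b * pderiv b)"
    using \<open>P1 = 0\<close> unfolding P1_def by (simp add: algebra_simps)
  then have "a dvd b * b * pderiv a" by (metis dvd_triv_left)
  then have "a dvd pderiv a" using coprime_dvd_mult_right_iff[OF cop] by simp
  then have "pderiv a = 0"
  proof (rule contrapos_pp)
    assume "pderiv a \<noteq> 0"
    then have "degree (pderiv a) < degree a" by (simp add: degree_pderiv pderiv_eq_0_iff)
    then show "\<not> a dvd pderiv a" using \<open>pderiv a \<noteq> 0\<close> dvd_imp_degree_le by fastforce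
  qed
  \<comment> \<open>As a form \<open>a\<close> is now c y^4. That y^4 does not divide 4 c y^3 b^2 is
    visible at y = 1 only in the coefficient of x^10.\<close>
  then have "degree a = 0" by (simp add: pderiv_eq_0_iff)
  then obtain c where c: "a = [:c:]" by (metis degree_eq_zeroE)
  have c0: "c \<noteq> 0" using no_common_zero_nz[OF ab(1-3)] c by simp
  have b5: "coeff b 5 \<noteq> 0" using no_common_zero_top[OF ab(1-3)] c by (simp add: coeff_pCons numeral_eq_Suc)
  have "b * b * dyp 4 a = a * a * b2 - a * b * a2 + a * b * dyp 5 b"
    using \<open>P2 = 0\<close> unfolding P2_def by (simp add: algebra_simps)
  moreover have "dyp 4 a = [:4 * c:]" by (simp add: dyp_def c)
  ultimately have "smult (4 * c) (b * b) = smult (c * c) b2 - smult c (b * a2) + smult c (b * dyp 5 b)"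
    by (simp add: c)
  then have "4 * c * coeff (b * b) (5 + 5) = c * c * coeff b2 10 - c * coeff (b * a2) 10 + c * coeff (b * dyp 5 b) 10"
    by (metis coeff_add coeff_diff coeff_smult numeral_Bit0)
  moreover have "coeff b2 10 = 0" "coeff (b * a2) 10 = 0" "coeff (b * dyp 5 b) 10 = 0"
    using 2(2) dm[OF ab(2) 2(1)] dm[OF ab(2) dd(4)] by (simp_all add: coeff_eq_0)
  ultimately show False using c0 b5 by (simp only: coeff_mult_top[OF ab(2,2)]) simp
qed

lemma card_le_12:
  assumes fin: "finite Z" and adm: "admits_unexpected_irreducible_quintics Z"
  shows "card Z \<le> 12"
proof (rule ccontr)
  assume "\<not> card Z \<le> 12"
  then have "13 \<le> card Z" by simp
  \<comment> \<open>Quintics through \<open>Z\<close> pass through \<open>Y\<close>, and thirteen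
    points are enough both for uniqueness and for the degrees 10 and 12.\<close>
  then obtain Y where Y: "Y \<subseteq> Z" "card Y = 13" "finite Y" by (metis obtain_subset_with_card_n)
  have "for_generic (\<lambda>q. poly3.dim (forms_through_fat 5 Z 4 q) > 0)"
    using adm unfolding admits_unexpected_irreducible_quintics_def admits_unexpected_curves_def
    by (auto elim!: for_generic_mono)
  moreover have "for_generic (\<lambda>q. \<forall>F \<in> forms_through_fat 5 Z 4 q. F \<noteq> 0 \<longrightarrow> irreducible F)"
    using adm by (simp add: admits_unexpected_irreducible_quintics_def)
  ultimately have "for_generic (\<lambda>q. (poly3.dim (forms_through_fat 5 Z 4 q) > 0 \<and>
      (\<forall>F \<in> forms_through_fat 5 Z 4 q. F \<noteq> 0 \<longrightarrow> irreducible F)) \<and>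
      (\<forall>s t. q = pt (chart s t) \<longrightarrow> general_position s t Y))"
    using for_generic_general_position[OF Y(3)] by (intro for_generic_conj)
  from this[unfolded for_generic_chart_iff pt_chart_inject]
  obtain F s t where F: "eval3 (chart s t) F \<noteq> 0"
    and good': "\<forall>s t. eval3 (chart s t) F \<noteq> 0 \<longrightarrow> (poly3.dim (forms_through_fat 5 Z 4 (pt (chart s t))) > 0 \<and>
      (\<forall>F \<in> forms_through_fat 5 Z 4 (pt (chart s t)). F \<noteq> 0 \<longrightarrow> irreducible F)) \<and>
      (\<forall>s' t'. s = s' \<and> t = t' \<longrightarrow> general_position s' t' Y)"
    by (elim exE conjE) (rule that)
  have good: "poly3.dim (forms_through_fat 5 Z 4 (pt (chart s t))) > 0"
      "\<And>G. G \<in> forms_through_fat 5 Z 4 (pt (chart s t)) \<Longrightarrow> G \<noteq> 0 \<Longrightarrow> irreducible G" "general_position s t Y"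
    if "eval3 (chart s t) F \<noteq> 0" for s t
    using good'[rule_format, OF that] by simp_all
  have member: "\<exists>a b. degree a \<le> 4 \<and> degree b \<le> 5 \<and> no_common_zero a b \<and> vanish_on s t a b Y"
    if "eval3 (chart s t) F \<noteq> 0" for s t
  proof -
    let ?V = "forms_through_fat 5 Z 4 (pt (chart s t))"
    have "\<not> ?V \<subseteq> {0}" using good(1)[OF that] fin_span_dim_le[OF fin_span_zero[of ?V 0]] by auto
    then obtain G where "G \<in> ?V" "G \<noteq> 0" by auto
    moreover from this have "irreducible G" using good(2)[OF that] by blast
    ultimately obtain a b where "degree a \<le> 4" "degree b \<le> 5" "no_common_zero a b" "vanish_on s t a b Z"
      by (metis irreducible_memD)
    then show ?thesis using vanish_on_subset[OF _ Y(1)] by blast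
  qed
  obtain a b where ab: "degree a \<le> 4" "degree b \<le> 5" "no_common_zero a b" "vanish_on s t a b Y"
    using member[OF F] by blast
  have gp: "general_position s t Y" using good(3)[OF F] .
  have "\<exists>a1 b1. degree a1 \<le> 4 \<and> degree b1 \<le> 5 \<and>
      (\<forall>p\<in>Y. quintic s t a1 b1 (rep p) + quintic_deriv u w s t a b (rep p) = 0)" for u w
  proof -
    let ?f = "on_line (chart s t) (vector [u, w, 0]) F"
    have l: "chart s t + r *s vector [u, w, 0] = chart (s + r * u) (t + r * w)" for r
      by (simp add: vec3_eq_iff)
    have f: "poly ?f r = eval3 (chart (s + r * u) (t + r * w)) F" for r
      unfolding poly_on_line l ..
    \<comment> \<open>A sequence of centres tending to the given one in the direction (u, w); by
      continuity its tail stays in the good open set.\<close>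
    have "(\<lambda>n. inverse (of_nat (Suc n)) :: complex) \<longlonglongrightarrow> 0"
      by (rule LIMSEQ_Suc[OF lim_inverse_n])
    then have "(\<lambda>n. poly ?f (inverse (of_nat (Suc n)))) \<longlonglongrightarrow> poly ?f 0"
      by (rule isCont_tendsto_compose[OF poly_isCont])
    moreover have "poly ?f 0 \<noteq> 0" using F by (simp add: f)
    ultimately have "\<forall>\<^sub>F n in sequentially. poly ?f (inverse (of_nat (Suc n))) \<noteq> 0"
      by (rule tendsto_imp_eventually_ne)
    then obtain N where N: "\<And>n. n \<ge> N \<Longrightarrow> poly ?f (inverse (of_nat (Suc n))) \<noteq> 0"
      by (auto simp: eventually_sequentially)
    define h where "h n = (inverse (of_nat (Suc (n + N))) :: complex)" for n
    have h: "h n \<noteq> 0" for n by (simp add: h_def del: of_nat_Suc)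
    have h0: "h \<longlonglongrightarrow> 0"
      using LIMSEQ_ignore_initial_segment[OF \<open>(\<lambda>n. inverse (of_nat (Suc n)) :: complex) \<longlonglongrightarrow> 0\<close>, of N]
      by (simp add: h_def[abs_def])
    have ker: "\<exists>a b. degree a \<le> 4 \<and> degree b \<le> 5 \<and> (a \<noteq> 0 \<or> b \<noteq> 0) \<and>
      vanish_on (s + h n * u) (t + h n * w) a b Y" for n
    proof -
      have "eval3 (chart (s + h n * u) (t + h n * w)) F \<noteq> 0"
        using N[of "n + N"] unfolding f h_def by simp
      from member[OF this] obtain a' b' where "degree a' \<le> 4" "degree b' \<le> 5" "no_common_zero a' b'"
        "vanish_on (s + h n * u) (t + h n * w) a' b' Y" by blast
      then show ?thesis using no_common_zero_nz[of a' b'] by (intro exI[of _ a'] exI[of _ b']) simp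
    qed
    obtain a0 b0 a1 b1 where 0: "degree a0 \<le> 4" "degree b0 \<le> 5" "a0 \<noteq> 0 \<or> b0 \<noteq> 0" "vanish_on s t a0 b0 Y"
      "degree a1 \<le> 4" "degree b1 \<le> 5"
      "\<And>p. p \<in> Y \<Longrightarrow> quintic s t a1 b1 (rep p) + quintic_deriv u w s t a0 b0 (rep p) = 0"
      by (rule quintic_first_order[OF Y(3,2) h h0 ker]) (rule that; assumption)
    \<comment> \<open>Uniqueness at (s, t) makes the limit pair a multiple of the fixed (a, b);
      dividing by \<open>c\<close> lets every direction deform the same quintic.\<close>
    obtain c where c: "a0 = smult c a" "b0 = smult c b"
      by (rule quintics_proportional[OF Y(3) _ gp ab 0(1,2,4)]) (use Y(2) in auto)
    have "c \<noteq> 0" using 0(3) c by auto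
    have dyp: "dyp n (smult c p) = smult c (dyp n p)" for n p
      by (simp add: dyp_def pderiv_smult smult_diff_right mult.commute)
    have "quintic_deriv u w s t a0 b0 v = c * quintic_deriv u w s t a b v" for v
      by (simp add: c quintic_deriv_def pderiv_smult dyp hev_smult Let_def algebra_simps)
    moreover have "quintic s t a1 b1 v = c * quintic s t (smult (1 / c) a1) (smult (1 / c) b1) v" for v
      using \<open>c \<noteq> 0\<close> by (simp add: quintic_def hev_smult field_simps)
    ultimately have "c * (quintic s t (smult (1 / c) a1) (smult (1 / c) b1) (rep p) + quintic_deriv u w s t a b (rep p)) = 0"
      if "p \<in> Y" for p
      using 0(7)[OF that] by (simp only: distrib_left)
    then have "quintic s t (smult (1 / c) a1) (smult (1 / c) b1) (rep p) + quintic_deriv u w s t a b (rep p) = 0"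
      if "p \<in> Y" for p
      using that \<open>c \<noteq> 0\<close> by simp
    then show ?thesis using 0(5,6) by (intro exI[of _ "smult (1 / c) a1"] exI[of _ "smult (1 / c) b1"]) auto
  qed
  from this[of 1 0] this[of 0 1] show False
    using deformation_contradiction[OF Y(3,2) gp ab] by metis
qed

section \<open>Duals of line arrangements\<close>

lemma dot3_cross: "dot3 c (cross u x) = dot3 (cross c u) x" "dot3 u (cross u x) = 0"
  by (simp_all add: dot3_def cross_def algebra_simps)

text \<open>On the moment curve (1, r, r^2) each plane becomes a nonzero polynomial in r, and so
  does the product of all of them.\<close>

lemma avoid_planes:
  assumes "finite A" "0 \<notin> A"
  obtains x where "\<And>a. a \<in> A \<Longrightarrow> dot3 a x \<noteq> 0"
proof -
  define f where "f a = [:a $ 1, a $ 2, a $ 3:]" for a :: "complex ^ 3"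
  have "f a \<noteq> 0" if "a \<in> A" for a
  proof -
    have "a \<noteq> 0" using that assms(2) by auto
    then show ?thesis by (auto simp: f_def vec3_eq_iff)
  qed
  then have "prod f A \<noteq> 0" using assms(1) by simp
  then obtain \<tau> where "poly (prod f A) \<tau> \<noteq> 0" using poly_all_0_iff_0 by blast
  then have "poly (f a) \<tau> \<noteq> 0" if "a \<in> A" for a using that assms(1) by (auto simp: poly_prod)
  then show ?thesis
    by (intro that[of "vector [1, \<tau>, \<tau> * \<tau>]"]) (auto simp: f_def dot3_def algebra_simps)
qed

text \<open>The vector \<open>cross u x\<close> lies in the plane of \<open>u\<close> and avoids the
  plane of \<open>c\<close> as soon as \<open>x\<close> avoids that of \<open>cross c u\<close>, a
  proper plane unless \<open>c\<close> and \<open>u\<close> give the same point.\<close>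

lemma plane_subset_Union:
  assumes C: "finite C" "C \<noteq> {}" "0 \<notin> C" and u: "u \<noteq> 0"
    and sub: "\<And>v. v \<noteq> 0 \<Longrightarrow> dot3 u v = 0 \<Longrightarrow> \<exists>c\<in>C. dot3 c v = 0"
  shows "pt u \<in> pt ` C"
proof (rule ccontr)
  assume *: "pt u \<notin> pt ` C"
  have "cross c u \<noteq> 0" if "c \<in> C" for c
    using cross_eq_0_imp_pt_eq[of c u] that u C(3) * by (metis image_eqI)
  then obtain x where x: "\<And>c. c \<in> C \<Longrightarrow> dot3 (cross c u) x \<noteq> 0"
    using avoid_planes[of "(\<lambda>c. cross c u) ` C"] C(1) by (metis (no_types, lifting) finite_imageI image_iff)
  then have x': "dot3 c (cross u x) \<noteq> 0" if "c \<in> C" for c using that by (simp add: dot3_cross)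
  then have "cross u x \<noteq> 0" using C(2) by (auto simp: dot3_def)
  from sub[OF this dot3_cross(2)] show False using x' by blast
qed

lemma pt_in_dual_line: "u \<noteq> 0 \<Longrightarrow> v \<noteq> 0 \<Longrightarrow> pt v \<in> dual_line (pt u) \<longleftrightarrow> dot3 u v = 0"
proof -
  assume nz: "u \<noteq> 0" "v \<noteq> 0"
  have "pt v \<in> dual_line (pt u) \<longleftrightarrow> (\<forall>c d. c \<noteq> 0 \<longrightarrow> d \<noteq> 0 \<longrightarrow> c * d * dot3 u v = 0)"
    unfolding dual_line_def sum_3 dot3_def coords_pt[OF nz(1)] coords_pt[OF nz(2)] mem_Collect_eq
  proof (intro iffI allI impI ballI)
    fix c d :: complex
    assume *: "\<forall>x\<in>{c *s u |c. c \<noteq> 0}. \<forall>y\<in>{c *s v |c. c \<noteq> 0}. x $ 1 * y $ 1 + x $ 2 * y $ 2 + x $ 3 * y $ 3 = 0"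
      and "c \<noteq> 0" "d \<noteq> 0"
    then have "(c *s u) $ 1 * (d *s v) $ 1 + (c *s u) $ 2 * (d *s v) $ 2 + (c *s u) $ 3 * (d *s v) $ 3 = 0"
      by blast
    then show "c * d * (u $ 1 * v $ 1 + u $ 2 * v $ 2 + u $ 3 * v $ 3) = 0"
      by (simp add: distrib_left mult_ac)
  next
    fix x y
    assume *: "\<forall>c d. c \<noteq> 0 \<longrightarrow> d \<noteq> 0 \<longrightarrow> c * d * (u $ 1 * v $ 1 + u $ 2 * v $ 2 + u $ 3 * v $ 3) = 0"
      and "x \<in> {c *s u |c. c \<noteq> 0}" "y \<in> {c *s v |c. c \<noteq> 0}"
    then obtain c d where "x = c *s u" "c \<noteq> 0" "y = d *s v" "d \<noteq> 0" by blast
    then show "x $ 1 * y $ 1 + x $ 2 * y $ 2 + x $ 3 * y $ 3 = 0"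
      using *[rule_format, of c d] by (simp add: distrib_left mult_ac)
  qed
  also have "\<dots> \<longleftrightarrow> dot3 u v = 0" by (metis mult_eq_0_iff one_neq_zero)
  finally show ?thesis .
qed

lemma inj_dual_line: "inj dual_line"
proof (rule injI)
  fix p p' assume eq: "dual_line p = dual_line p'"
  obtain u u' where u: "u \<noteq> 0" "p = pt u" "u' \<noteq> 0" "p' = pt u'" by (metis pt_exhaust)
  have "pt u \<in> pt ` {u'}"
  proof (rule plane_subset_Union)
    fix v :: "complex ^ 3" assume "v \<noteq> 0" "dot3 u v = 0"
    then show "\<exists>c\<in>{u'}. dot3 c v = 0" using eq u pt_in_dual_line by (metis singletonI)
  qed (use u in auto)
  then show "p = p'" using u by simp
qed

text \<open>A line inside a finite union of lines is one of them, so the zero set of F determines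
  the arrangement.\<close>

lemma arrangement_eq:
  assumes C: "finite C" "C \<noteq> {}" "0 \<notin> C" and F: "homogeneous d F"
    and zero: "\<And>v. eval3 v F = 0 \<longleftrightarrow> (\<exists>c\<in>C. dot3 c v = 0)"
  shows "arrangement F = dual_line ` pt ` C"
proof -
  have sub: "dual_line (pt u) \<subseteq> zero_locus F \<longleftrightarrow> (\<forall>v. v \<noteq> 0 \<longrightarrow> dot3 u v = 0 \<longrightarrow> (\<exists>c\<in>C. dot3 c v = 0))"
    if "u \<noteq> 0" for u
  proof
    assume *: "dual_line (pt u) \<subseteq> zero_locus F"
    show "\<forall>v. v \<noteq> 0 \<longrightarrow> dot3 u v = 0 \<longrightarrow> (\<exists>c\<in>C. dot3 c v = 0)"
    proof (intro allI impI)
      fix v :: "complex ^ 3" assume v: "v \<noteq> 0" "dot3 u v = 0"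
      then have "vanishes_at F (pt v)" using * pt_in_dual_line[OF that v(1)] by (auto simp: zero_locus_def)
      then show "\<exists>c\<in>C. dot3 c v = 0" using vanishes_at_pt[OF F v(1)] zero by simp
    qed
  next
    assume *: "\<forall>v. v \<noteq> 0 \<longrightarrow> dot3 u v = 0 \<longrightarrow> (\<exists>c\<in>C. dot3 c v = 0)"
    show "dual_line (pt u) \<subseteq> zero_locus F"
    proof
      fix r assume r: "r \<in> dual_line (pt u)"
      obtain v where v: "v \<noteq> 0" "r = pt v" by (rule pt_exhaust)
      then have "dot3 u v = 0" using r pt_in_dual_line[OF that v(1)] by simp
      then have "vanishes_at F r" using * v vanishes_at_pt[OF F v(1)] zero by simp
      then show "r \<in> zero_locus F" by (simp add: zero_locus_def)
    qed
  qed
  have "dual_line p \<subseteq> zero_locus F \<longleftrightarrow> p \<in> pt ` C" for p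
  proof -
    obtain u where u: "u \<noteq> 0" "p = pt u" by (rule pt_exhaust)
    show ?thesis
    proof
      assume "dual_line p \<subseteq> zero_locus F"
      then show "p \<in> pt ` C" using sub[OF u(1)] u plane_subset_Union[OF C u(1)] by simp
    next
      assume "p \<in> pt ` C"
      then obtain c where "c \<in> C" "p = pt c" by blast
      moreover from this have "c \<noteq> 0" using C(3) by auto
      ultimately show "dual_line p \<subseteq> zero_locus F" using sub[of c] by auto
    qed
  qed
  then show ?thesis unfolding arrangement_def by auto
qed

lemma dual_points_image: "dual_points (dual_line ` S) = S"
  using inj_dual_line by (auto simp: dual_points_def inj_image_mem_iff)

lemma dual_points_Diff: "dual_points (A - {dual_line p}) = dual_points A - {p}"
  using inj_dual_line by (auto simp: dual_points_def inj_eq)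

section \<open>A criterion for unexpected irreducible quintics\<close>

text \<open>The bound 9 is the expected 21 - 12. With at most one point removed it becomes 10, the
  number of conditions of the fat point, so the expected dimension is 0 and any nonzero quintic is
  unexpected.\<close>

lemma unexpected_subset:
  assumes Z: "finite Z" "card Z = 12" "fin_span (forms_through 5 Z) 9"
    and gen: "for_generic (\<lambda>q. \<exists>s t a b. q = pt (chart s t) \<and> degree a \<le> 4 \<and> degree b \<le> 5 \<and>
       no_common_zero a b \<and> vanish_on s t a b Z)"
    and Y: "Y \<subseteq> Z" "card Y \<ge> 11"
  shows "admits_unexpected_irreducible_quintics Y"
proof -
  have finY: "finite Y" using Y Z by (metis finite_subset)
  have c: "card (Z - Y) \<le> 1" using Y Z by (simp add: card_Diff_subset finY)
  have "{F \<in> forms_through 5 Y. \<forall>p\<in>Z - Y. eval3 (rep p) F = 0} = forms_through 5 Z"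
    using forms_through_split[of 5 Y "Z - Y"] Z(1) Y(1) by (simp add: Un_absorb1)
  then have "fin_span (forms_through 5 Y) (9 + card (Z - Y))"
    using Z by (intro fin_span_functionals[where f = "\<lambda>p F. eval3 (rep p) F"] subspace_forms_through) auto
  then have dim: "poly3.dim (forms_through 5 Y) \<le> 10"
    using fin_span_dim_le c by fastforce
  have good: "poly3.dim (forms_through_fat 5 Y 4 (pt (chart s t))) > 0 \<and>
      (\<forall>F \<in> forms_through_fat 5 Y 4 (pt (chart s t)). F \<noteq> 0 \<longrightarrow> irreducible F)"
    if ab: "degree a \<le> 4" "degree b \<le> 5" "no_common_zero a b" "vanish_on s t a b Z"
      and gp: "general_position s t Z" for s t a b
  proof
    note vY = vanish_on_subset[OF ab(4) Y(1)]
    have "quintic3 s t a b \<in> forms_through_fat 5 Y 4 (pt (chart s t))"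
      using ab vY mem_fat_iff by blast
    moreover have "quintic3 s t a b \<noteq> 0" using irreducible_quintic3[OF ab(1-3), of s t] by auto
    ultimately show "poly3.dim (forms_through_fat 5 Y 4 (pt (chart s t))) > 0"
      using dim_pos fin_span_forms_through_fat by blast
    show "\<forall>F \<in> forms_through_fat 5 Y 4 (pt (chart s t)). F \<noteq> 0 \<longrightarrow> irreducible F"
    proof (intro ballI impI)
      fix F assume F: "F \<in> forms_through_fat 5 Y 4 (pt (chart s t))" "F \<noteq> 0"
      obtain c where "F = scale3 c (quintic3 s t a b)"
        by (rule fat_proportional[OF finY _ general_position_subset[OF gp Y(1)] ab(1-3) vY F(1)])
          (use Y(2) in auto)
      then have F': "F = quintic3 s t (smult c a) (smult c b)" "c \<noteq> 0"
        using F(2) by (auto simp: quintic3_smult)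
      have "no_common_zero (smult c a) (smult c b)"
        using ab(3) F'(2) by (simp add: no_common_zero_def hev_smult)
      then show "irreducible F"
        unfolding F'(1) using ab(1,2) by (intro irreducible_quintic3) auto
    qed
  qed
  have "for_generic (\<lambda>q. poly3.dim (forms_through_fat 5 Y 4 q) > 0 \<and>
      (\<forall>F \<in> forms_through_fat 5 Y 4 q. F \<noteq> 0 \<longrightarrow> irreducible F))"
  proof (rule for_generic_mono[OF for_generic_conj[OF gen for_generic_general_position[OF Z(1)]]])
    fix q assume "(\<exists>s t a b. q = pt (chart s t) \<and> degree a \<le> 4 \<and> degree b \<le> 5 \<and>
       no_common_zero a b \<and> vanish_on s t a b Z) \<and> (\<forall>s t. q = pt (chart s t) \<longrightarrow> general_position s t Z)"
    then show "poly3.dim (forms_through_fat 5 Y 4 q) > 0 \<and>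
      (\<forall>F \<in> forms_through_fat 5 Y 4 q. F \<noteq> 0 \<longrightarrow> irreducible F)" using good by blast
  qed
  then have "for_generic (\<lambda>q. poly3.dim (forms_through_fat 5 Y 4 q) > 0)"
    "for_generic (\<lambda>q. \<forall>F \<in> forms_through_fat 5 Y 4 q. F \<noteq> 0 \<longrightarrow> irreducible F)"
    by (auto elim!: for_generic_mono)
  moreover have "max 0 (int (poly3.dim (forms_through 5 Y)) - int (5 choose 2)) = 0"
    using dim by (simp add: choose_two)
  ultimately show ?thesis
    unfolding admits_unexpected_irreducible_quintics_def admits_unexpected_curves_def by simp
qed

lemma vanish_on_image:
  assumes "0 \<notin> C" "\<And>v. v \<in> C \<Longrightarrow> quintic s t a b v = 0"
  shows "vanish_on s t a b (pt ` C)"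
  unfolding vanish_on_def
proof (clarify)
  fix v assume v: "v \<in> C"
  then have "v \<noteq> 0" using assms(1) by auto
  then have "vanishes_at (quintic3 s t a b) (pt v)"
    using vanishes_at_pt[OF homogeneous_quintic3] assms(2)[OF v] by (simp add: eval3_quintic3)
  then show "quintic s t a b (rep (pt v)) = 0"
    using vanishes_at_rep[OF homogeneous_quintic3] by (simp add: eval3_quintic3)
qed

lemma forms_through_image:
  "0 \<notin> C \<Longrightarrow> forms_through j (pt ` C) = {F. homogeneous j F \<and> (\<forall>v\<in>C. eval3 v F = 0)}"
  unfolding forms_through_def using vanishes_at_pt by (auto; metis)

section \<open>Quintics through explicit points as a linear system\<close>

lemma eval3_homogeneous5:
  assumes "homogeneous 5 F"
  shows "eval3 v F = cf F 5 0 0 * (v $ 1 ^ 5 * v $ 2 ^ 0 * v $ 3 ^ 0) + cf F 4 1 0 * (v $ 1 ^ 4 * v $ 2 ^ 1 * v $ 3 ^ 0) + cf F 3 2 0 * (v $ 1 ^ 3 * v $ 2 ^ 2 * v $ 3 ^ 0)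
     + cf F 2 3 0 * (v $ 1 ^ 2 * v $ 2 ^ 3 * v $ 3 ^ 0) + cf F 1 4 0 * (v $ 1 ^ 1 * v $ 2 ^ 4 * v $ 3 ^ 0) + cf F 0 5 0 * (v $ 1 ^ 0 * v $ 2 ^ 5 * v $ 3 ^ 0)
     + cf F 4 0 1 * (v $ 1 ^ 4 * v $ 2 ^ 0 * v $ 3 ^ 1) + cf F 3 1 1 * (v $ 1 ^ 3 * v $ 2 ^ 1 * v $ 3 ^ 1) + cf F 2 2 1 * (v $ 1 ^ 2 * v $ 2 ^ 2 * v $ 3 ^ 1)
     + cf F 1 3 1 * (v $ 1 ^ 1 * v $ 2 ^ 3 * v $ 3 ^ 1) + cf F 0 4 1 * (v $ 1 ^ 0 * v $ 2 ^ 4 * v $ 3 ^ 1) + cf F 3 0 2 * (v $ 1 ^ 3 * v $ 2 ^ 0 * v $ 3 ^ 2)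
     + cf F 2 1 2 * (v $ 1 ^ 2 * v $ 2 ^ 1 * v $ 3 ^ 2) + cf F 1 2 2 * (v $ 1 ^ 1 * v $ 2 ^ 2 * v $ 3 ^ 2) + cf F 0 3 2 * (v $ 1 ^ 0 * v $ 2 ^ 3 * v $ 3 ^ 2)
     + cf F 2 0 3 * (v $ 1 ^ 2 * v $ 2 ^ 0 * v $ 3 ^ 3) + cf F 1 1 3 * (v $ 1 ^ 1 * v $ 2 ^ 1 * v $ 3 ^ 3) + cf F 0 2 3 * (v $ 1 ^ 0 * v $ 2 ^ 2 * v $ 3 ^ 3)
     + cf F 1 0 4 * (v $ 1 ^ 1 * v $ 2 ^ 0 * v $ 3 ^ 4) + cf F 0 1 4 * (v $ 1 ^ 0 * v $ 2 ^ 1 * v $ 3 ^ 4) + cf F 0 0 5 * (v $ 1 ^ 0 * v $ 2 ^ 0 * v $ 3 ^ 5)"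
  unfolding eval3_homogeneous[OF assms] by (simp add: eval_nat_numeral algebra_simps)

lemma homogeneous5_eq_zero:
  assumes "homogeneous 5 F"
    "cf F 5 0 0 = 0" "cf F 4 1 0 = 0" "cf F 3 2 0 = 0" "cf F 2 3 0 = 0" "cf F 1 4 0 = 0" "cf F 0 5 0 = 0" "cf F 4 0 1 = 0"
    "cf F 3 1 1 = 0" "cf F 2 2 1 = 0" "cf F 1 3 1 = 0" "cf F 0 4 1 = 0" "cf F 3 0 2 = 0" "cf F 2 1 2 = 0" "cf F 1 2 2 = 0"
    "cf F 0 3 2 = 0" "cf F 2 0 3 = 0" "cf F 1 1 3 = 0" "cf F 0 2 3 = 0" "cf F 1 0 4 = 0" "cf F 0 1 4 = 0" "cf F 0 0 5 = 0"
  shows "F = 0"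
  by (rule eval3_zero_imp_zero) (simp add: eval3_homogeneous5[OF assms(1)] assms(2-) del: One_nat_def)

text \<open>\<open>K\<close> lists the free variables of the linear system: coefficients that
  determine a form through \<open>C\<close>.\<close>

lemma fin_span_forms_through_coeffs:
  assumes "finite K" "0 \<notin> C"
    and zero: "\<And>F. homogeneous 5 F \<Longrightarrow> (\<And>v. v \<in> C \<Longrightarrow> eval3 v F = 0) \<Longrightarrow> (\<And>i j k. (i, j, k) \<in> K \<Longrightarrow> cf F i j k = 0) \<Longrightarrow> F = 0"
  shows "fin_span (forms_through 5 (pt ` C)) (card K)"
proof -
  let ?f = "\<lambda>(i,j,k) F. cf F i j k"
  have "{F \<in> forms_through 5 (pt ` C). \<forall>k\<in>K. ?f k F = 0} \<subseteq> {0}"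
    unfolding forms_through_image[OF assms(2)] using zero by fastforce
  then have "fin_span {F \<in> forms_through 5 (pt ` C). \<forall>k\<in>K. ?f k F = 0} 0" by (rule fin_span_zero)
  then have "fin_span (forms_through 5 (pt ` C)) (0 + card K)"
    by (intro fin_span_functionals[where f = ?f] assms(1) subspace_forms_through)
      (auto simp: cf_def lookup_add lookup_scale3)
  then show ?thesis by simp
qed

section \<open>The monomial and the Hessian arrangement\<close>

definition mu3 :: "complex set" where
  "mu3 = {w. w ^ 3 = 1}"

lemma card_mu3: "card mu3 = 3"
  unfolding mu3_def by (rule card_roots_unity_eq) simp

lemma finite_mu3: "finite mu3"
  using card_mu3 by (metis card.infinite zero_neq_numeral)

lemma mu3D: "w \<in> mu3 \<Longrightarrow> w ^ 3 = 1"
  by (simp add: mu3_def)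

lemma mu3_nonzero: "w \<in> mu3 \<Longrightarrow> w \<noteq> 0"
  by (auto simp: mu3_def)

lemma mu3_mult: "u \<in> mu3 \<Longrightarrow> w \<in> mu3 \<Longrightarrow> u * w \<in> mu3"
  by (simp add: mu3_def power_mult_distrib)

lemma one_mu3: "1 \<in> mu3"
  by (simp add: mu3_def)

lemma norm_mu3: "w \<in> mu3 \<Longrightarrow> norm w = 1"
proof -
  assume "w \<in> mu3"
  then have "norm w ^ 3 = 1 ^ 3" using mu3D[of w] by (simp flip: norm_power)
  then show ?thesis by (rule power_eq_imp_eq_base) simp_all
qed

lemma cube_eq_iff: "a ^ 3 = b ^ 3 \<longleftrightarrow> (\<exists>w\<in>mu3. b = w * a)" for a b :: complex
proof
  assume *: "a ^ 3 = b ^ 3"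
  show "\<exists>w\<in>mu3. b = w * a"
  proof (cases "a = 0")
    case True
    then show ?thesis using * by (intro bexI[of _ 1]) (auto simp: mu3_def)
  next
    case False
    then show ?thesis using * by (intro bexI[of _ "b / a"]) (auto simp: mu3_def power_divide)
  qed
qed (auto simp: mu3_def power_mult_distrib)

text \<open>Three roots exceed degree 2. On \<open>mu3\<close> a power depends only on its exponent
  mod 3, so forms at the points of the arrangements reduce to this shape.\<close>

lemma quadratic_zero_on_mu3:
  assumes "\<And>w. w \<in> mu3 \<Longrightarrow> c0 + c1 * w + c2 * w ^ 2 = 0"
  shows "c0 = 0 \<and> c1 = 0 \<and> c2 = 0"
proof (rule ccontr)
  assume *: "\<not> ?thesis"
  define p where "p = [:c0, c1, c2:]"
  have "p \<noteq> 0" using * by (auto simp: p_def)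
  have "mu3 \<subseteq> {x. poly p x = 0}"
    using assms by (auto simp: p_def algebra_simps power2_eq_square)
  then have "3 \<le> card {x. poly p x = 0}"
    using poly_roots_finite[OF \<open>p \<noteq> 0\<close>] card_mono card_mu3 by metis
  also have "\<dots> \<le> degree p" using card_poly_roots_bound[OF \<open>p \<noteq> 0\<close>] .
  also have "\<dots> \<le> 2" by (simp add: p_def)
  finally show False by simp
qed

text \<open>Besides the coordinate lines these are the linear factors y - w x, z - w y and x - w z
  of the differences of cubes.\<close>

definition M5_vectors :: "(complex ^ 3) set" where
  "M5_vectors = {vector [1, 0, 0], vector [0, 1, 0], vector [0, 0, 1]}
     \<union> (\<lambda>w. vector [- w, 1, 0]) ` mu3 \<union> (\<lambda>w. vector [0, - w, 1]) ` mu3 \<union> (\<lambda>w. vector [1, 0, - w]) ` mu3"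

text \<open>The twelve lines of the four triangles in the Hesse pencil: the coordinate triangle and
  the lines x + u y + w z = 0.\<close>

definition Hessian_vectors :: "(complex ^ 3) set" where
  "Hessian_vectors = {vector [1, 0, 0], vector [0, 1, 0], vector [0, 0, 1]}
     \<union> (\<lambda>(u, w). vector [1, u, w]) ` (mu3 \<times> mu3)"

lemma zero_notin_vectors: "0 \<notin> M5_vectors" "0 \<notin> Hessian_vectors"
  by (auto simp: M5_vectors_def Hessian_vectors_def vec3_eq_iff)

lemma finite_vectors: "finite M5_vectors" "finite Hessian_vectors"
  by (auto simp: M5_vectors_def Hessian_vectors_def finite_mu3)

lemma inj_on_ptI:
  assumes "0 \<notin> C" "\<And>v c. v \<in> C \<Longrightarrow> c \<noteq> 0 \<Longrightarrow> c *s v \<in> C \<Longrightarrow> c = 1"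
  shows "inj_on pt C"
proof (rule inj_onI)
  fix v w assume vw: "v \<in> C" "w \<in> C" "pt v = pt w"
  then have "v \<noteq> 0" "w \<noteq> 0" using assms(1) by auto
  then obtain c where "c \<noteq> 0" "w = c *s v" using pt_eqD[OF vw(3)] by blast
  then show "v = w" using assms(2)[of v c] vw by simp
qed

lemma inj_on_pt_vectors: "inj_on pt M5_vectors" "inj_on pt Hessian_vectors"
  by (rule inj_on_ptI[OF zero_notin_vectors(1)];
      auto simp: M5_vectors_def vec3_eq_iff mu3_nonzero dest: mu3_nonzero)
    (rule inj_on_ptI[OF zero_notin_vectors(2)];
      auto simp: Hessian_vectors_def vec3_eq_iff mu3_nonzero dest: mu3_nonzero)

lemma card_vectors: "card M5_vectors = 12" "card Hessian_vectors = 12"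
proof -
  let ?E = "{vector [1, 0, 0], vector [0, 1, 0], vector [0, 0, 1 :: complex]} :: (complex ^ 3) set"
  have E: "card ?E = 3" by (simp add: vec3_eq_iff)
  have A: "card ((\<lambda>w. vector [- w, 1, 0] :: complex ^ 3) ` mu3) = 3"
    "card ((\<lambda>w. vector [0, - w, 1] :: complex ^ 3) ` mu3) = 3"
    "card ((\<lambda>w. vector [1, 0, - w] :: complex ^ 3) ` mu3) = 3"
    by (subst card_image; auto simp: inj_on_def vec3_eq_iff card_mu3)+
  have B: "card ((\<lambda>(u, w). vector [1, u, w] :: complex ^ 3) ` (mu3 \<times> mu3)) = 9"
    by (subst card_image) (auto simp: inj_on_def vec3_eq_iff card_mu3 card_cartesian_product)
  show "card M5_vectors = 12"
    unfolding M5_vectors_def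
    by (subst card_Un_disjoint, (auto simp: finite_mu3 vec3_eq_iff dest: mu3_nonzero)[3],
        subst card_Un_disjoint, (auto simp: finite_mu3 vec3_eq_iff dest: mu3_nonzero)[3],
        subst card_Un_disjoint, (auto simp: finite_mu3 vec3_eq_iff dest: mu3_nonzero)[3], simp only: E A)
  show "card Hessian_vectors = 12"
    unfolding Hessian_vectors_def
    by (subst card_Un_disjoint, (auto simp: finite_mu3 vec3_eq_iff dest: mu3_nonzero)[3], simp only: E B)
qed

lemma homogeneous_numeral: "homogeneous 0 (numeral n)"
proof -
  have "(numeral n :: poly3) = Const (numeral n)" by (simp add: Const_def)
  then show ?thesis by (metis homogeneous_Const)
qed

lemma M5_zero_iff:
  "eval3 v (Var 1 * Var 2 * Var 3 * (Var 1^3 - Var 2^3) * (Var 2^3 - Var 3^3) * (Var 3^3 - Var 1^3)) = 0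
    \<longleftrightarrow> (\<exists>c\<in>M5_vectors. dot3 c v = 0)"
proof -
  have "v $ 1 ^ 3 = v $ 2 ^ 3 \<longleftrightarrow> (\<exists>w\<in>mu3. - (w * v $ 1) + v $ 2 = 0)"
    "v $ 2 ^ 3 = v $ 3 ^ 3 \<longleftrightarrow> (\<exists>w\<in>mu3. - (w * v $ 2) + v $ 3 = 0)"
    "v $ 3 ^ 3 = v $ 1 ^ 3 \<longleftrightarrow> (\<exists>w\<in>mu3. v $ 1 - w * v $ 3 = 0)"
    unfolding cube_eq_iff by (auto simp: add_eq_0_iff)
  then show ?thesis
    unfolding M5_vectors_def bex_Un by (simp add: dot3_def disj_ac)
qed

lemma M5_eq: "M5 = dual_line ` pt ` M5_vectors"
proof -
  have "homogeneous (1 + 1 + 1 + 1 * 3 + 1 * 3 + 1 * 3)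
    (Var 1 * Var 2 * Var 3 * (Var 1^3 - Var 2^3) * (Var 2^3 - Var 3^3) * (Var 3^3 - Var 1^3))"
    by (intro homogeneous_mult homogeneous_diff homogeneous_power homogeneous_Var)
  from arrangement_eq[OF finite_vectors(1) _ zero_notin_vectors(1) this M5_zero_iff]
  show ?thesis by (simp add: M5_def Let_def M5_vectors_def)
qed

text \<open>Taking cube roots gives x^3 + y^3 + z^3 = 3 w x y z with \<open>w\<close> in
  \<open>mu3\<close>. Now put w z for z in x^3 + y^3 + z^3 - 3 x y z = (x + y + z) (x + e y + e^2 z)
  (x + e^2 y + e z), where \<open>e\<close> is a primitive cube root of unity.\<close>

lemma Hessian_cubic:
  fixes x y z :: complex
  assumes "x \<noteq> 0" "y \<noteq> 0" "z \<noteq> 0"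
  shows "(x ^ 3 + y ^ 3 + z ^ 3) ^ 3 = 27 * x ^ 3 * y ^ 3 * z ^ 3 \<longleftrightarrow> (\<exists>u\<in>mu3. \<exists>w\<in>mu3. x + u * y + w * z = 0)"
proof
  assume *: "(x ^ 3 + y ^ 3 + z ^ 3) ^ 3 = 27 * x ^ 3 * y ^ 3 * z ^ 3"
  have "(3 * (x * y * z)) ^ 3 = (x ^ 3 + y ^ 3 + z ^ 3) ^ 3"
    unfolding * by (simp add: power_mult_distrib)
  then obtain w where w: "w \<in> mu3" "x ^ 3 + y ^ 3 + z ^ 3 = w * (3 * (x * y * z))"
    unfolding cube_eq_iff by blast
  have "\<exists>e\<in>mu3. e \<noteq> 1"
  proof (rule ccontr)
    assume "\<not> ?thesis"
    then have "mu3 \<subseteq> {1}" by auto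
    then have "card mu3 \<le> 1" by (metis card_mono card.empty card_insert_disjoint empty_iff finite.intros One_nat_def)
    then show False by (simp add: card_mu3)
  qed
  then obtain e where e: "e \<in> mu3" "e \<noteq> 1" by blast
  have "(e - 1) * (e ^ 2 + e + 1) = e ^ 3 - 1" by (simp add: algebra_simps power2_eq_square power3_eq_cube)
  then have e2: "e ^ 2 = - e - 1" using e mu3D[OF e(1)] by (simp add: add_eq_0_iff2 add.assoc)
  have w3: "w ^ 3 = 1" by (rule mu3D) fact
  have "(x + y + w * z) * (x + e * y + (- e - 1) * w * z) * (x + (- e - 1) * y + e * w * z)
      = x ^ 3 + y ^ 3 + w ^ 3 * z ^ 3 - 3 * x * y * (w * z)"
    using e2 by algebra
  also have "\<dots> = 0" using w(2) w3 by (simp add: algebra_simps)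
  finally consider "x + 1 * y + w * z = 0" | "x + e * y + (e ^ 2 * w) * z = 0" | "x + e ^ 2 * y + (e * w) * z = 0"
    unfolding e2 by auto
  moreover have "1 \<in> mu3" "e ^ 2 \<in> mu3" "e * w \<in> mu3" "e ^ 2 * w \<in> mu3"
    using e(1) w(1) by (simp_all add: power2_eq_square mu3_mult one_mu3)
  ultimately show "\<exists>u\<in>mu3. \<exists>w\<in>mu3. x + u * y + w * z = 0"
    using e(1) w(1) by cases blast+
next
  assume "\<exists>u\<in>mu3. \<exists>w\<in>mu3. x + u * y + w * z = 0"
  then obtain u w where uw: "u \<in> mu3" "w \<in> mu3" "x + u * y + w * z = 0" by blast
  have "y ^ 3 = (u * y) ^ 3" "z ^ 3 = (w * z) ^ 3" using uw(1,2) by (simp_all add: mu3_def power_mult_distrib)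
  moreover have "(x ^ 3 + p ^ 3 + r ^ 3) ^ 3 = 27 * x ^ 3 * p ^ 3 * r ^ 3" if "x + p + r = 0" for p r :: complex
  proof -
    have x: "x = - (p + r)" using that by (simp add: add_eq_0_iff add.assoc)
    have "x ^ 3 + p ^ 3 + r ^ 3 = 3 * x * p * r" unfolding x by (simp add: algebra_simps power3_eq_cube)
    then show ?thesis by (simp add: power_mult_distrib)
  qed
  ultimately show "(x ^ 3 + y ^ 3 + z ^ 3) ^ 3 = 27 * x ^ 3 * y ^ 3 * z ^ 3" using uw(3) by metis
qed

lemma Hessian_zero_iff:
  "eval3 v (Var 1 * Var 2 * Var 3 * ((Var 1^3 + Var 2^3 + Var 3^3)^3 - 27 * Var 1^3 * Var 2^3 * Var 3^3)) = 0
    \<longleftrightarrow> (\<exists>c\<in>Hessian_vectors. dot3 c v = 0)"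
proof (cases "v $ 1 = 0 \<or> v $ 2 = 0 \<or> v $ 3 = 0")
  case True
  then show ?thesis by (auto simp: Hessian_vectors_def dot3_def)
next
  case False
  then show ?thesis
    using Hessian_cubic[of "v $ 1" "v $ 2" "v $ 3"] by (auto simp: Hessian_vectors_def dot3_def)
qed

lemma Hessian_eq: "Hessian = dual_line ` pt ` Hessian_vectors"
proof -
  have h3: "homogeneous 3 (Var i ^ 3)" for i by (rule homogeneous_power_linear) (rule homogeneous_Var)
  have "homogeneous (3 * 3) ((Var 1^3 + Var 2^3 + Var 3^3)^3)"
    by (intro homogeneous_power homogeneous_add h3)
  moreover have "homogeneous (0 + 3 + 3 + 3) (27 * Var 1^3 * Var 2^3 * Var 3^3)"
    by (intro homogeneous_mult h3 homogeneous_numeral)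
  ultimately have "homogeneous 9 ((Var 1^3 + Var 2^3 + Var 3^3)^3 - 27 * Var 1^3 * Var 2^3 * Var 3^3)"
    by (intro homogeneous_diff) simp_all
  then have "homogeneous (1 + 1 + 1 + 9)
    (Var 1 * Var 2 * Var 3 * ((Var 1^3 + Var 2^3 + Var 3^3)^3 - 27 * Var 1^3 * Var 2^3 * Var 3^3))"
    by (intro homogeneous_mult homogeneous_Var)
  from arrangement_eq[OF finite_vectors(2) _ zero_notin_vectors(2) this Hessian_zero_iff]
  show ?thesis by (simp add: Hessian_def Let_def Hessian_vectors_def)
qed

lemma A3_2_eq: "A3_2 = M5 - {dual_line (pt (vector [0, 0, 1]))}"
proof -
  let ?c = "vector [0, 0, 1] :: complex ^ 3"
  have c: "?c \<in> M5_vectors" by (simp add: M5_vectors_def)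
  let ?C = "M5_vectors - {?c}"
  have C: "?C = {vector [1, 0, 0], vector [0, 1, 0]}
     \<union> (\<lambda>w. vector [- w, 1, 0]) ` mu3 \<union> (\<lambda>w. vector [0, - w, 1]) ` mu3 \<union> (\<lambda>w. vector [1, 0, - w]) ` mu3"
    unfolding M5_vectors_def by (auto simp: vec3_eq_iff dest: mu3_nonzero)
  have zero: "eval3 v (Var 1 * Var 2 * (Var 1^3 - Var 2^3) * (Var 2^3 - Var 3^3) * (Var 3^3 - Var 1^3)) = 0
    \<longleftrightarrow> (\<exists>c\<in>?C. dot3 c v = 0)" for v
  proof -
    have "v $ 1 ^ 3 = v $ 2 ^ 3 \<longleftrightarrow> (\<exists>w\<in>mu3. - (w * v $ 1) + v $ 2 = 0)"
      "v $ 2 ^ 3 = v $ 3 ^ 3 \<longleftrightarrow> (\<exists>w\<in>mu3. - (w * v $ 2) + v $ 3 = 0)"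
      "v $ 3 ^ 3 = v $ 1 ^ 3 \<longleftrightarrow> (\<exists>w\<in>mu3. v $ 1 - w * v $ 3 = 0)"
      unfolding cube_eq_iff by (auto simp: add_eq_0_iff)
    then show ?thesis unfolding C bex_Un by (simp add: dot3_def disj_ac)
  qed
  have hom: "homogeneous (1 + 1 + 1 * 3 + 1 * 3 + 1 * 3)
    (Var 1 * Var 2 * (Var 1^3 - Var 2^3) * (Var 2^3 - Var 3^3) * (Var 3^3 - Var 1^3))"
    by (intro homogeneous_mult homogeneous_diff homogeneous_power homogeneous_Var)
  have "finite ?C" "?C \<noteq> {}" "0 \<notin> ?C"
    using finite_vectors(1) zero_notin_vectors(1) by (simp, unfold C, simp, unfold C[symmetric], simp)
  then have "A3_2 = dual_line ` pt ` ?C"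
    unfolding A3_2_def Let_def by (rule arrangement_eq[OF _ _ _ hom zero])
  also have "\<dots> = M5 - {dual_line (pt ?c)}"
    unfolding M5_eq using inj_on_image_set_diff[OF inj_on_pt_vectors(1), of M5_vectors "{?c}"] c
    by (simp add: image_set_diff[OF inj_dual_line])
  finally show ?thesis .
qed

lemma M5_2_eq:
  assumes "w1 \<in> mu3" "w2 \<in> mu3" "w1 \<noteq> w2"
  obtains c where "c \<in> M5_vectors" "M5_2 w1 w2 = M5 - {dual_line (pt c)}"
proof -
  \<comment> \<open>The deleted line is z = w3 y for the remaining cube root of unity
    \<open>w3\<close>.\<close>
  have "card (mu3 - {w1, w2}) = 1"
    using assms card_mu3 finite_mu3 by (simp add: card_Diff_subset)
  then obtain w3 where w3': "mu3 - {w1, w2} = {w3}" by (rule card_1_singletonE)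
  then have mu: "mu3 = {w1, w2, w3}" "w3 \<noteq> w1" "w3 \<noteq> w2" using assms by blast+
  let ?c = "vector [0, - w3, 1] :: complex ^ 3"
  have c: "?c \<in> M5_vectors" using mu(1) by (auto simp: M5_vectors_def)
  let ?C = "M5_vectors - {?c}"
  have C: "?C = {vector [1, 0, 0], vector [0, 1, 0], vector [0, 0, 1]}
     \<union> (\<lambda>w. vector [- w, 1, 0]) ` mu3 \<union> {vector [0, - w1, 1], vector [0, - w2, 1]} \<union> (\<lambda>w. vector [1, 0, - w]) ` mu3"
  proof -
    have "w3 \<noteq> 0" using mu3_nonzero mu(1) by blast
    then have "?c \<noteq> vector [1, 0, 0]" "?c \<noteq> vector [0, 1, 0]" "?c \<noteq> vector [0, 0, 1]"
      "\<And>w. ?c \<noteq> vector [- w, 1, 0]" "?c \<noteq> vector [0, - w1, 1]" "?c \<noteq> vector [0, - w2, 1]"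
      "\<And>w. ?c \<noteq> vector [1, 0, - w]"
      using mu by (simp_all add: vec3_eq_iff)
    moreover have "(\<lambda>w. vector [0, - w, 1] :: complex ^ 3) ` mu3 = {vector [0, - w1, 1], vector [0, - w2, 1], ?c}"
      unfolding mu(1) by simp
    ultimately show ?thesis unfolding M5_vectors_def by blast
  qed
  have zero: "eval3 v (Var 1 * Var 2 * Var 3 * (Var 1^3 - Var 2^3) * (Var 1^3 - Var 3^3) * (Var 3 - Const w1 * Var 2) * (Var 3 - Const w2 * Var 2)) = 0
    \<longleftrightarrow> (\<exists>c\<in>?C. dot3 c v = 0)" for v
  proof -
    have "v $ 1 ^ 3 = v $ 2 ^ 3 \<longleftrightarrow> (\<exists>w\<in>mu3. - (w * v $ 1) + v $ 2 = 0)"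
      "v $ 1 ^ 3 = v $ 3 ^ 3 \<longleftrightarrow> (\<exists>w\<in>mu3. v $ 1 - w * v $ 3 = 0)"
      unfolding cube_eq_iff[of "v $ 1" "v $ 2"] cube_eq_iff[of "v $ 3" "v $ 1", symmetric] eq_commute[of "v $ 1 ^ 3" "v $ 3 ^ 3"]
      by (auto simp: add_eq_0_iff cube_eq_iff)
    moreover have "v $ 3 = w * v $ 2 \<longleftrightarrow> - (w * v $ 2) + v $ 3 = 0" for w
      by (auto simp: add_eq_0_iff)
    ultimately show ?thesis unfolding C bex_Un by (simp add: dot3_def disj_ac)
  qed
  have hom: "homogeneous (1 + 1 + 1 + 1 * 3 + 1 * 3 + 1 + 1)
    (Var 1 * Var 2 * Var 3 * (Var 1^3 - Var 2^3) * (Var 1^3 - Var 3^3) * (Var 3 - Const w1 * Var 2) * (Var 3 - Const w2 * Var 2))"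
    by (intro homogeneous_mult homogeneous_diff homogeneous_power homogeneous_Var homogeneous_Const_mult)
  have "finite ?C" "?C \<noteq> {}" "0 \<notin> ?C"
    using finite_vectors(1) zero_notin_vectors(1) by (simp, unfold C, simp, unfold C[symmetric], simp)
  then have "M5_2 w1 w2 = dual_line ` pt ` ?C"
    unfolding M5_2_def Let_def by (rule arrangement_eq[OF _ _ _ hom zero])
  also have "\<dots> = M5 - {dual_line (pt ?c)}"
    unfolding M5_eq using inj_on_image_set_diff[OF inj_on_pt_vectors(1), of M5_vectors "{?c}"] c
    by (simp add: image_set_diff[OF inj_dual_line])
  finally show ?thesis using that c by blast
qed

lemma mu3_powers:
  assumes "w \<in> mu3"
  shows "w ^ 3 = 1" "w ^ 4 = w" "w ^ 5 = w ^ 2"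
proof -
  show "w ^ 3 = 1" by (rule mu3D) fact
  moreover have "w ^ 4 = w ^ 3 * w" "w ^ 5 = w ^ 3 * w ^ 2"
    by (simp_all add: eval_nat_numeral)
  ultimately show "w ^ 4 = w" "w ^ 5 = w ^ 2" by simp_all
qed

lemma fin_span_M5: "fin_span (forms_through 5 (pt ` M5_vectors)) 9"
proof -
  \<comment> \<open>The six monomials with all exponents positive vanish at every point. On each
    side of the coordinate triangle the two monomials with exponents 4 and 1 agree up to sign at the
    points, so one of each pair is free too.\<close>
  let ?K = "{(1,4,0), (0,1,4), (4,0,1), (3,1,1), (1,3,1), (1,1,3), (2,2,1), (2,1,2), (1,2,2)} :: (nat \<times> nat \<times> nat) set"
  have "fin_span (forms_through 5 (pt ` M5_vectors)) (card ?K)"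
  proof (rule fin_span_forms_through_coeffs)
    fix F assume F: "homogeneous 5 F" and v: "\<And>v. v \<in> M5_vectors \<Longrightarrow> eval3 v F = 0"
      and K: "\<And>i j k. (i, j, k) \<in> ?K \<Longrightarrow> cf F i j k = 0"
    note ev = v[unfolded eval3_homogeneous5[OF F]]
    have K': "cf F 1 4 0 = 0" "cf F 0 1 4 = 0" "cf F 4 0 1 = 0" "cf F 3 1 1 = 0" "cf F 1 3 1 = 0" "cf F 1 1 3 = 0"
      "cf F 2 2 1 = 0" "cf F 2 1 2 = 0" "cf F 1 2 2 = 0"
      by (rule K, simp)+
    have c: "cf F 5 0 0 = 0" "cf F 0 5 0 = 0" "cf F 0 0 5 = 0"
      using ev[of "vector [1, 0, 0]"] ev[of "vector [0, 1, 0]"] ev[of "vector [0, 0, 1]"]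
      by (simp_all add: M5_vectors_def)
    have 1: "- cf F 3 2 0 + cf F 4 1 0 * w + cf F 2 3 0 * w ^ 2 = 0" if "w \<in> mu3" for w
      using ev[of "vector [- w, 1, 0]"] that K' c mu3_powers[OF that]
      by (simp add: M5_vectors_def algebra_simps del: One_nat_def)
    have 2: "- cf F 0 3 2 + cf F 0 4 1 * w + cf F 0 2 3 * w ^ 2 = 0" if "w \<in> mu3" for w
      using ev[of "vector [0, - w, 1]"] that K' c mu3_powers[OF that]
      by (simp add: M5_vectors_def algebra_simps del: One_nat_def)
    have 3: "- cf F 2 0 3 + cf F 1 0 4 * w + cf F 3 0 2 * w ^ 2 = 0" if "w \<in> mu3" for w
      using ev[of "vector [1, 0, - w]"] that K' c mu3_powers[OF that]
      by (simp add: M5_vectors_def algebra_simps del: One_nat_def)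
    from quadratic_zero_on_mu3[OF 1] quadratic_zero_on_mu3[OF 2] quadratic_zero_on_mu3[OF 3]
    show "F = 0" by (intro homogeneous5_eq_zero[OF F] K' c) simp_all
  qed (use zero_notin_vectors in auto)
  then show ?thesis by (simp add: eval_nat_numeral)
qed

lemma fin_span_Hessian: "fin_span (forms_through 5 (pt ` Hessian_vectors)) 9"
proof -
  \<comment> \<open>At (1, u, w) a monomial depends only on its exponents of y and z mod 3. Pure
    fifth powers aside, \<open>?K\<close> contains all but one monomial of each of the nine
    classes.\<close>
  let ?K = "{(2,0,3), (1,4,0), (1,1,3), (0,2,3), (1,3,1), (1,0,4), (0,3,2), (0,4,1), (0,1,4)} :: (nat \<times> nat \<times> nat) set"
  have "fin_span (forms_through 5 (pt ` Hessian_vectors)) (card ?K)"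
  proof (rule fin_span_forms_through_coeffs)
    fix F assume F: "homogeneous 5 F" and v: "\<And>v. v \<in> Hessian_vectors \<Longrightarrow> eval3 v F = 0"
      and K: "\<And>i j k. (i, j, k) \<in> ?K \<Longrightarrow> cf F i j k = 0"
    note ev = v[unfolded eval3_homogeneous5[OF F]]
    have K': "cf F 2 0 3 = 0" "cf F 1 4 0 = 0" "cf F 1 1 3 = 0" "cf F 0 2 3 = 0" "cf F 1 3 1 = 0" "cf F 1 0 4 = 0"
      "cf F 0 3 2 = 0" "cf F 0 4 1 = 0" "cf F 0 1 4 = 0"
      by (rule K, simp)+
    have c: "cf F 5 0 0 = 0" "cf F 0 5 0 = 0" "cf F 0 0 5 = 0"
      using ev[of "vector [1, 0, 0]"] ev[of "vector [0, 1, 0]"] ev[of "vector [0, 0, 1]"]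
      by (simp_all add: Hessian_vectors_def)
    have "(cf F 2 3 0 + cf F 4 1 0 * u + cf F 3 2 0 * u ^ 2) + (cf F 4 0 1 + cf F 3 1 1 * u + cf F 2 2 1 * u ^ 2) * w
        + (cf F 3 0 2 + cf F 2 1 2 * u + cf F 1 2 2 * u ^ 2) * w ^ 2 = 0" if "u \<in> mu3" "w \<in> mu3" for u w
    proof -
      have "vector [1, u, w] \<in> Hessian_vectors" using that by (auto simp: Hessian_vectors_def)
      from ev[OF this] show ?thesis
        using K' c mu3_powers[OF that(1)] mu3_powers[OF that(2)]
        by (simp add: algebra_simps del: One_nat_def)
    qed
    note q = quadratic_zero_on_mu3[OF this]
    from quadratic_zero_on_mu3[OF conjunct1[OF q]] quadratic_zero_on_mu3[OF conjunct1[OF conjunct2[OF q]]]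
      quadratic_zero_on_mu3[OF conjunct2[OF conjunct2[OF q]]]
    show "F = 0" by (intro homogeneous5_eq_zero[OF F] K' c) simp_all
  qed (use zero_notin_vectors in auto)
  then show ?thesis by (simp add: eval_nat_numeral)
qed

section \<open>The generic quintics of the two arrangements\<close>

lemma hev_pCons_4:
  "hev 4 [:c0, c1, c2, c3, c4:] x y = c0 * y ^ 4 + c1 * (x * y ^ 3) + c2 * (x ^ 2 * y ^ 2) + c3 * (x ^ 3 * y) + c4 * x ^ 4"
  by (simp add: hev_def eval_nat_numeral)

lemma hev_pCons_5:
  "hev 5 [:0, c1, c2, c3, c4:] x y = x * y * (c1 * y ^ 3 + c2 * (x * y ^ 2) + c3 * (x ^ 2 * y) + c4 * x ^ 3)"
  by (simp add: hev_def eval_nat_numeral algebra_simps)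

lemma for_generic_nonvanishing:
  assumes "\<exists>d. homogeneous d F" "eval3 (chart s t) F \<noteq> 0"
    and "\<And>s t. eval3 (chart s t) F \<noteq> 0 \<Longrightarrow> \<exists>a b. degree a \<le> 4 \<and> degree b \<le> 5 \<and> no_common_zero a b \<and> vanish_on s t a b Z"
  shows "for_generic (\<lambda>q. \<exists>s t a b. q = pt (chart s t) \<and> degree a \<le> 4 \<and> degree b \<le> 5 \<and>
       no_common_zero a b \<and> vanish_on s t a b Z)"
proof -
  obtain d where d: "homogeneous d F" using assms(1) by blast
  have "\<exists>s' t' a b. pt (chart s t) = pt (chart s' t') \<and> degree a \<le> 4 \<and> degree b \<le> 5 \<and>
       no_common_zero a b \<and> vanish_on s' t' a b Z" if nz: "eval3 (chart s t) F \<noteq> 0" for s t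
  proof -
    obtain a b where "degree a \<le> 4 \<and> degree b \<le> 5 \<and> no_common_zero a b \<and> vanish_on s t a b Z"
      using assms(3)[OF nz] by blast
    then show ?thesis by (intro exI[of _ s] exI[of _ t] exI[of _ a] exI[of _ b] conjI refl) simp_all
  qed
  with d assms(2) show ?thesis
    unfolding for_generic_chart_iff by (metis (no_types, lifting))
qed

lemma homogeneous_mult_ex: "\<exists>d. homogeneous d F \<Longrightarrow> \<exists>d. homogeneous d G \<Longrightarrow> \<exists>d. homogeneous d (F * G)"
  using homogeneous_mult by blast

lemma homogeneous_Var_cube: "homogeneous 3 (Var i ^ 3)"
  by (rule homogeneous_power_linear) (rule homogeneous_Var)

text \<open>For the sample centre (5 : 2 : 1): the norm of 5 + 2 w is at least 3, so its cube is not
  - 1.\<close>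

lemma generic_factor_nonzero:
  assumes "w \<in> mu3"
  shows "5 + 2 * w \<noteq> 0" "1 + (5 + 2 * w) ^ 3 \<noteq> 0"
proof -
  have "norm (5 :: complex) \<le> norm (5 + 2 * w) + norm (2 * w)"
    using norm_triangle_ineq4[of "5 + 2 * w" "2 * w"] by simp
  then have n: "norm (5 + 2 * w) \<ge> 3" by (simp add: norm_mult norm_mu3[OF assms])
  then show "5 + 2 * w \<noteq> 0" by auto
  have "norm ((5 + 2 * w) ^ 3) \<ge> 3 ^ 3" unfolding norm_power by (rule power_mono[OF n]) simp
  show "1 + (5 + 2 * w) ^ 3 \<noteq> 0"
  proof
    assume "1 + (5 + 2 * w) ^ 3 = 0"
    then have "(5 + 2 * w) ^ 3 = - 1" by (simp add: add_eq_0_iff)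
    then show False using \<open>norm ((5 + 2 * w) ^ 3) \<ge> 3 ^ 3\<close> by simp
  qed
qed

lemma homogeneous_generic_factor: "homogeneous 3 (Var 3 ^ 3 + (Var 1 + Const w * Var 2) ^ 3)"
  by (intro homogeneous_add homogeneous_Var_cube homogeneous_power_linear homogeneous_Const_mult homogeneous_Var)

lemma cube_sum_zero:
  fixes x y :: complex
  assumes "x ^ 3 + y ^ 3 = 0"
  obtains w where "w \<in> mu3" "x = - (w * y)"
proof -
  have "(- x) ^ 3 = y ^ 3" using assms by (simp add: add_eq_0_iff)
  then obtain w where "w \<in> mu3" "- x = w * y" by (metis cube_eq_iff)
  then show ?thesis using that[of w] by (metis minus_minus)
qed

text \<open>The forms \<open>a\<close> and \<open>b\<close> of the generic quintic come from the derivation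
  \<open>(x\<^sup>4, y\<^sup>4, z\<^sup>4)\<close> tangent to the arrangement: for a derivation \<open>\<theta>\<close> of degree \<open>4\<close> the quintic
  at the point \<open>q\<close> is \<open>p \<bullet> \<theta>(p \<times> q)\<close>, and \<open>p \<times> q = (y, -x, tx - sy)\<close> in the coordinates
  \<open>x = p\<^sub>1 - s p\<^sub>3\<close>, \<open>y = p\<^sub>2 - t p\<^sub>3\<close>.\<close>

lemma generic_quintic_M5:
  "for_generic (\<lambda>q. \<exists>s t a b. q = pt (chart s t) \<and> degree a \<le> 4 \<and> degree b \<le> 5 \<and>
       no_common_zero a b \<and> vanish_on s t a b (pt ` M5_vectors))"
proof (rule for_generic_nonvanishing)
  \<comment> \<open>On the chart the factors are, up to nonzero scalars, the values of
    \<open>a\<close> at the five zeros of b = x y (x^3 + y^3).\<close>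
  let ?F = "Var 1 * (Var 3 ^ 3 + Var 1 ^ 3) * (Var 2 * (Var 3 ^ 3 + Var 2 ^ 3)) *
    (\<Prod>w\<in>mu3. (Var 1 + Const w * Var 2) * (Var 3 ^ 3 + (Var 1 + Const w * Var 2) ^ 3))"
  have "\<exists>d. homogeneous d (Var 1 + Const w * Var 2)" for w
    by (intro exI[of _ 1] homogeneous_add homogeneous_Const_mult homogeneous_Var)
  moreover have "\<exists>d. homogeneous d (Var 3 ^ 3 + Var i ^ 3)" for i
    by (intro exI[of _ 3] homogeneous_add homogeneous_Var_cube)
  ultimately show "\<exists>d. homogeneous d ?F"
    using homogeneous_Var(1) homogeneous_generic_factor
    by (intro homogeneous_mult_ex homogeneous_prod_ex) blast+
  have "5 + 2 * w \<noteq> 0 \<and> 1 + (5 + 2 * w) ^ 3 \<noteq> 0" if "w \<in> mu3" for w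
    using generic_factor_nonzero[OF that] ..
  then show "eval3 (chart 5 2) ?F \<noteq> 0"
    by (auto simp: eval3_prod finite_mu3 mult.commute)
  fix s t assume F: "eval3 (chart s t) ?F \<noteq> 0"
  then have s: "s \<noteq> 0" "1 + s ^ 3 \<noteq> 0" and t: "t \<noteq> 0" "1 + t ^ 3 \<noteq> 0"
    and st: "\<And>w. w \<in> mu3 \<Longrightarrow> s + w * t \<noteq> 0 \<and> 1 + (s + w * t) ^ 3 \<noteq> 0"
    by (auto simp: eval3_prod finite_mu3)
  define a where "a = [:s + s ^ 4, - (4 * s ^ 3 * t), 6 * s ^ 2 * t ^ 2, - (4 * s * t ^ 3), t + t ^ 4:]"
  define b where "b = [:0, 1, 0, 0, 1 :: complex:]"
  have A: "hev 4 a x y = s * y ^ 4 + t * x ^ 4 + (t * x - s * y) ^ 4" for x y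
    unfolding a_def hev_pCons_4 by algebra
  have B: "hev 5 b x y = x * y * (x ^ 3 + y ^ 3)" for x y
    unfolding b_def hev_pCons_5 by (simp add: add.commute)
  have "no_common_zero a b"
    unfolding no_common_zero_def
  proof (intro allI impI notI)
    fix x y assume nz: "(x, y) \<noteq> (0, 0)" and z: "hev 4 a x y = 0" "hev 5 b x y = 0"
    from z(2) consider "x = 0" | "y = 0" | "y \<noteq> 0" "x ^ 3 + y ^ 3 = 0" unfolding B by auto
    then show False
    proof cases
      case 1
      have "hev 4 a x y = s * (1 + s ^ 3) * y ^ 4" unfolding A 1 by (simp add: algebra_simps eval_nat_numeral)
      then show False using z(1) s nz 1 by simp
    next
      case 2
      have "hev 4 a x y = t * (1 + t ^ 3) * x ^ 4" unfolding A 2 by (simp add: algebra_simps eval_nat_numeral)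
      then show False using z(1) t nz 2 by simp
    next
      case 3
      then obtain w where w: "w \<in> mu3" "x = - (w * y)" using cube_sum_zero by blast
      \<comment> \<open>Here w^4 = w turns s + w^4 t into s + w t.\<close>
      have "hev 4 a x y = (s + w * t) * (1 + (s + w * t) ^ 3) * y ^ 4"
        unfolding A w(2) using mu3D[OF w(1)] by algebra
      then show False using z(1) 3(1) st[OF w(1)] by simp
    qed
  qed
  moreover have "vanish_on s t a b (pt ` M5_vectors)"
  proof (rule vanish_on_image[OF zero_notin_vectors(1)])
    fix v assume v: "v \<in> M5_vectors"
    have q: "quintic s t a b v = v $ 1 * (v $ 2 - t * v $ 3) ^ 4 + v $ 2 * (v $ 1 - s * v $ 3) ^ 4
        + v $ 3 * (t * v $ 1 - s * v $ 2) ^ 4" for v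
      unfolding quintic_def A B by algebra
    from v consider "v = vector [1, 0, 0]" | "v = vector [0, 1, 0]" | "v = vector [0, 0, 1]"
      | w where "w \<in> mu3" "v = vector [- w, 1, 0]" | w where "w \<in> mu3" "v = vector [0, - w, 1]"
      | w where "w \<in> mu3" "v = vector [1, 0, - w]"
      by (auto simp: M5_vectors_def)
    then show "quintic s t a b v = 0"
    proof cases
      case 4
      then show ?thesis by (simp add: q mu3_powers)
    next
      case 5
      then show ?thesis by (simp add: q mu3_powers power_mult_distrib)
    next
      case 6
      then show ?thesis by (simp add: q mu3_powers power_mult_distrib)
    qed (simp_all add: q)
  qed
  ultimately show "\<exists>a b. degree a \<le> 4 \<and> degree b \<le> 5 \<and> no_common_zero a b \<and> vanish_on s t a b (pt ` M5_vectors)"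
    by (intro exI[of _ a] exI[of _ b]) (simp add: a_def b_def)
qed

text \<open>Here the derivation is \<open>(x(y\<^sup>3 - z\<^sup>3), y(z\<^sup>3 - x\<^sup>3), z(x\<^sup>3 - y\<^sup>3))\<close>.\<close>

lemma generic_quintic_Hessian:
  "for_generic (\<lambda>q. \<exists>s t a b. q = pt (chart s t) \<and> degree a \<le> 4 \<and> degree b \<le> 5 \<and>
       no_common_zero a b \<and> vanish_on s t a b (pt ` Hessian_vectors))"
proof (rule for_generic_nonvanishing)
  \<comment> \<open>The first two groups of factors exclude common zeros with x = 0 or y = 0; the
    difference of cubes and the product exclude those on the cubic factor of
    \<open>b\<close>.\<close>
  let ?F = "Var 1 * (Var 3 ^ 3 - Var 1 ^ 3) * (Var 2 * (Var 3 ^ 3 - Var 2 ^ 3)) * (Var 1 ^ 3 - Var 2 ^ 3) *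
    (\<Prod>w\<in>mu3. Var 3 ^ 3 + (Var 1 + Const w * Var 2) ^ 3)"
  have "\<exists>d. homogeneous d (Var i ^ 3 - Var j ^ 3)" for i j
    by (intro exI[of _ 3] homogeneous_diff homogeneous_Var_cube)
  then show "\<exists>d. homogeneous d ?F"
    using homogeneous_Var(1) homogeneous_generic_factor
    by (intro homogeneous_mult_ex homogeneous_prod_ex) blast+
  have "1 + (5 + 2 * w) ^ 3 \<noteq> 0" if "w \<in> mu3" for w
    using generic_factor_nonzero[OF that] by blast
  then show "eval3 (chart 5 2) ?F \<noteq> 0"
    by (auto simp: eval3_prod finite_mu3 mult.commute)
  fix s t assume F: "eval3 (chart s t) ?F \<noteq> 0"
  then have s: "s \<noteq> 0" "s ^ 3 \<noteq> 1" and t: "t \<noteq> 0" "t ^ 3 \<noteq> 1" and d: "s ^ 3 \<noteq> t ^ 3"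
    and st: "\<And>w. w \<in> mu3 \<Longrightarrow> 1 + (s + w * t) ^ 3 \<noteq> 0"
    by (auto simp: eval3_prod finite_mu3)
  define a where "a = [:s ^ 4 - s, 2 * t - 2 * t * s ^ 3, 0, 2 * t ^ 3 * s - 2 * s, t - t ^ 4:]"
  define b where "b = [:0, 1 + 2 * s ^ 3, - (6 * t * s ^ 2), 6 * t ^ 2 * s, - (1 + 2 * t ^ 3):]"
  have A: "hev 4 a x y = t * x ^ 4 - 2 * s * x ^ 3 * y + 2 * t * x * y ^ 3 - s * y ^ 4
      - (t * x - s * y) ^ 3 * (t * x + s * y)" for x y
    unfolding a_def hev_pCons_4 by algebra
  have B: "hev 5 b x y = - (x * y * (x ^ 3 - y ^ 3 + 2 * (t * x - s * y) ^ 3))" for x y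
    unfolding b_def hev_pCons_5 by algebra
  have "no_common_zero a b"
    unfolding no_common_zero_def
  proof (intro allI impI notI)
    fix x y assume nz: "(x, y) \<noteq> (0, 0)" and z: "hev 4 a x y = 0" "hev 5 b x y = 0"
    let ?m = "t * x - s * y"
    from z(2) consider "x = 0" | "y = 0" | "x ^ 3 - y ^ 3 + 2 * ?m ^ 3 = 0" unfolding B by auto
    then show False
    proof cases
      case 1
      have "hev 4 a x y = s * (s ^ 3 - 1) * y ^ 4" unfolding A 1 by (simp add: algebra_simps eval_nat_numeral)
      then show False using z(1) s nz 1 by simp
    next
      case 2
      have "hev 4 a x y = t * (1 - t ^ 3) * x ^ 4" unfolding A 2 by (simp add: algebra_simps eval_nat_numeral)
      then show False using z(1) t nz 2 by simp
    next
      case 3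
      \<comment> \<open>On the cubic factor of \<open>b\<close> this combination leaves only m (x^3
        + y^3), so the roots of the cubic need not be found.\<close>
      have "2 * hev 4 a x y = 3 * ?m * (x ^ 3 + y ^ 3) - (t * x + s * y) * (x ^ 3 - y ^ 3 + 2 * ?m ^ 3)"
        unfolding A by algebra
      then have "?m = 0 \<or> x ^ 3 + y ^ 3 = 0" using z(1) 3 by simp
      then show False
      proof
        assume m: "?m = 0"
        then have xy: "x ^ 3 = y ^ 3" using 3 by simp
        have y: "y \<noteq> 0" using xy nz by auto
        have "t * x = s * y" using m by simp
        then have "t ^ 3 * x ^ 3 = s ^ 3 * y ^ 3" by (metis power_mult_distrib)
        then show False using xy y d by simp
      next
        assume *: "x ^ 3 + y ^ 3 = 0"
        then obtain w where w: "w \<in> mu3" "x = - (w * y)" using cube_sum_zero by blast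
        have y: "y \<noteq> 0" using w nz by auto
        have "2 * ?m ^ 3 = 2 * y ^ 3" using 3 * by algebra
        moreover have "?m ^ 3 = - ((s + w * t) ^ 3 * y ^ 3)" unfolding w(2) by algebra
        ultimately have "- ((s + w * t) ^ 3 * y ^ 3) = y ^ 3" by (simp add: mult.commute)
        then have "(1 + (s + w * t) ^ 3) * y ^ 3 = 0" by algebra
        then show False using y st[OF w(1)] by simp
      qed
    qed
  qed
  moreover have "vanish_on s t a b (pt ` Hessian_vectors)"
  proof (rule vanish_on_image[OF zero_notin_vectors(2)])
    fix v assume v: "v \<in> Hessian_vectors"
    let ?x = "v $ 1 - s * v $ 3" and ?y = "v $ 2 - t * v $ 3" and ?m = "t * v $ 1 - s * v $ 2"
    have q: "quintic s t a b v = v $ 2 * ((v $ 1 - s * v $ 3) * ((v $ 2 - t * v $ 3) ^ 3 - (t * v $ 1 - s * v $ 2) ^ 3))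
        + v $ 3 * ((t * v $ 1 - s * v $ 2) * ((v $ 1 - s * v $ 3) ^ 3 + (v $ 2 - t * v $ 3) ^ 3))
        - v $ 1 * ((v $ 2 - t * v $ 3) * ((v $ 1 - s * v $ 3) ^ 3 + (t * v $ 1 - s * v $ 2) ^ 3))" for v
      unfolding quintic_def A B by algebra
    from v consider "v = vector [1, 0, 0]" | "v = vector [0, 1, 0]" | "v = vector [0, 0, 1]"
      | u w where "u \<in> mu3" "w \<in> mu3" "v = vector [1, u, w]"
      by (auto simp: Hessian_vectors_def)
    then show "quintic s t a b v = 0"
    proof cases
      case 4
      \<comment> \<open>(y, - x, m) is the cross product of the point with the centre, hence
        orthogonal to (1, u, w).\<close>
      have y: "?y = u * ?x - w * ?m" unfolding 4(3) vector_3 by (simp add: algebra_simps)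
      have "u * (X * ((u * X - w * M) ^ 3 - M ^ 3)) + w * (M * (X ^ 3 + (u * X - w * M) ^ 3))
        - (u * X - w * M) * (X ^ 3 + M ^ 3) = 0" for X M
        using mu3D[OF 4(1)] mu3D[OF 4(2)] by algebra
      from this[of ?x ?m] show ?thesis unfolding q[of v] y by (simp add: 4(3))
    qed (simp_all add: q)
  qed
  ultimately show "\<exists>a b. degree a \<le> 4 \<and> degree b \<le> 5 \<and> no_common_zero a b \<and> vanish_on s t a b (pt ` Hessian_vectors)"
    by (intro exI[of _ a] exI[of _ b]) (simp add: a_def b_def)
qed

section \<open>The arrangements and their deletions\<close>

lemma dual_points_M5: "finite (dual_points M5)" "card (dual_points M5) = 12"
  unfolding M5_eq dual_points_image
  by (simp_all add: finite_vectors card_image[OF inj_on_pt_vectors(1)] card_vectors)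

lemma dual_points_Hessian: "finite (dual_points Hessian)" "card (dual_points Hessian) = 12"
  unfolding Hessian_eq dual_points_image
  by (simp_all add: finite_vectors card_image[OF inj_on_pt_vectors(2)] card_vectors)

lemma unexpected_M5:
  assumes "Y \<subseteq> dual_points M5" "card Y \<ge> 11"
  shows "admits_unexpected_irreducible_quintics Y"
  using unexpected_subset[OF dual_points_M5 _ _ assms] fin_span_M5 generic_quintic_M5
  by (simp add: M5_eq dual_points_image)

lemma unexpected_Hessian:
  assumes "Y \<subseteq> dual_points Hessian" "card Y \<ge> 11"
  shows "admits_unexpected_irreducible_quintics Y"
  using unexpected_subset[OF dual_points_Hessian _ _ assms] fin_span_Hessian generic_quintic_Hessian
  by (simp add: Hessian_eq dual_points_image)

lemma deleted_arrangement:
  assumes A: "A = dual_line ` P" and fin: "finite (dual_points A)" and card: "card (dual_points A) = 12" and "L \<in> A"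
  shows "card (dual_points (A - {L})) = 11" "dual_points (A - {L}) \<subseteq> dual_points A"
proof -
  obtain p where p: "p \<in> P" "L = dual_line p" using assms by blast
  have "dual_points (A - {L}) = dual_points A - {p}" unfolding p(2) by (rule dual_points_Diff)
  moreover have "p \<in> dual_points A" using p by (simp add: A dual_points_image)
  ultimately show "card (dual_points (A - {L})) = 11" "dual_points (A - {L}) \<subseteq> dual_points A"
    using fin card by auto
qed

lemmas deleted_M5 = deleted_arrangement[OF M5_eq dual_points_M5]
lemmas deleted_Hessian = deleted_arrangement[OF Hessian_eq dual_points_Hessian]

theorem theorem4p4:
  shows "(\<forall>Z. finite Z \<and> admits_unexpected_irreducible_quintics Z \<longrightarrow> card Z \<in> {11, 12})
    \<and> (\<forall>A \<in> {M5, Hessian}.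
          card (dual_points A) = 12 \<and> admits_unexpected_irreducible_quintics (dual_points A))
    \<and> (\<forall>w1 w2. w1 ^ 3 = 1 \<and> w2 ^ 3 = 1 \<and> w1 \<noteq> w2 \<longrightarrow>
          card (dual_points (M5_2 w1 w2)) = 11
          \<and> admits_unexpected_irreducible_quintics (dual_points (M5_2 w1 w2))
          \<and> (\<exists>L \<in> M5. M5_2 w1 w2 = M5 - {L}))
    \<and> (card (dual_points A3_2) = 11
          \<and> admits_unexpected_irreducible_quintics (dual_points A3_2)
          \<and> (\<exists>L \<in> M5. A3_2 = M5 - {L}))
    \<and> (\<forall>L \<in> Hessian.
          card (dual_points (Hessian - {L})) = 11
          \<and> admits_unexpected_irreducible_quintics (dual_points (Hessian - {L})))"
proof (intro conjI allI impI ballI)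
  fix Z assume "finite Z \<and> admits_unexpected_irreducible_quintics Z"
  then have "11 \<le> card Z" "card Z \<le> 12" using card_ge_11 card_le_12 by blast+
  then show "card Z \<in> {11, 12}" by auto
next
  fix A assume "A \<in> {M5, Hessian}"
  then show "card (dual_points A) = 12" "admits_unexpected_irreducible_quintics (dual_points A)"
    using dual_points_M5 dual_points_Hessian unexpected_M5 unexpected_Hessian by auto
next
  fix w1 w2 :: complex assume "w1 ^ 3 = 1 \<and> w2 ^ 3 = 1 \<and> w1 \<noteq> w2"
  then obtain c where c: "c \<in> M5_vectors" "M5_2 w1 w2 = M5 - {dual_line (pt c)}"
    using M5_2_eq[of w1 w2] by (auto simp: mu3_def)
  have L: "dual_line (pt c) \<in> M5" using c(1) by (simp add: M5_eq)
  show "card (dual_points (M5_2 w1 w2)) = 11" "admits_unexpected_irreducible_quintics (dual_points (M5_2 w1 w2))"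
    using deleted_M5[OF L] unexpected_M5 unfolding c(2) by simp_all
  show "\<exists>L \<in> M5. M5_2 w1 w2 = M5 - {L}" using L c(2) by blast
next
  let ?L = "dual_line (pt (vector [0, 0, 1]))"
  have L: "?L \<in> M5" by (simp add: M5_eq M5_vectors_def)
  show "card (dual_points A3_2) = 11" "admits_unexpected_irreducible_quintics (dual_points A3_2)"
    using deleted_M5[OF L] unexpected_M5 unfolding A3_2_eq by simp_all
  show "\<exists>L \<in> M5. A3_2 = M5 - {L}" using L A3_2_eq by blast
next
  fix L assume "L \<in> Hessian"
  then show "card (dual_points (Hessian - {L})) = 11"
    "admits_unexpected_irreducible_quintics (dual_points (Hessian - {L}))"
    using deleted_Hessian unexpected_Hessian by simp_all
qed

end
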